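(* Let $r,d\in\mathbb{N}$. There exists a randomized algorithm which, given a word $w\in F(X_r)$, decides in quasi-linear time $\tilde O(|w|)$ whether $w=1$ in the free solvable group $S_{r,d}$, with the following guarantees (i.e. it is false-biased): (a) if $w=1$ in $S_{r,d}$, then the algorithm outputs $Yes$; (b) if $w\neq1$ in $S_{r,d}$, then the algorithm outputs $No$ with probability at least $\left(1-\tfrac{1}{|w|}\right)^{\log_3|w|}$.
   Context: $F=F(X_r)$ is the free group with basis $X_r=\{x_1,\dots,x_r\}$; elements are given as words over $X_r^{\pm}=\{x_1^{\pm1},\dots,x_r^{\pm1}\}$ and $|w|$ denotes word length. Put $F^{(0)}=F$, $F^{(i)}=[F^{(i-1)},F^{(i-1)}]$; the free solvable group of rank $r$ and class $d$ is $S_{r,d}=F/F^{(d)}$. Computational model: a random access machine with integers written in binary (adding two $n$-bit integers costs $O(n)$, multiplying them costs $O(n\log n\log\log n)$). Each letter of $X_r^{\pm}$ is encoded by a unique bit-string of length $\lceil\log_2 r\rceil+1$, and a word by the concatenation of the codes of its letters. A randomized (Monte Carlo) algorithm additionally has access to a random number generator supplying uniformly random integers from prescribed intervals $[0,N]$; its running time bound is deterministic, its output may be incorrect, and probabilities are taken over its random choices. A Monte Carlo decision algorithm is false-biased if it is always correct when it answers negatively. $\tilde O(n)$ (quasi-linear) means $O(n\log^k n)$ for some constant $k\in\mathbb{N}$. *)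

theory Defs
  imports
    "HOL-Probability.Probability_Mass_Function"
    "HOL-Algebra.Generated_Groups"
    "HOL-Library.Landau_Symbols"
    "HOL-Library.Log_Nat"
begin

section \<open>Free groups and free solvable groups\<close>

text \<open>The letter \<open>(i, True)\<close> stands for \<open>x\<^sub>i\<close>, the letter \<open>(i, False)\<close> for its inverse.\<close>

type_synonym letter = "nat \<times> bool"

definition letters :: "nat \<Rightarrow> letter set" where
  "letters r = {1..r} \<times> UNIV"

definition inv_letter :: "letter \<Rightarrow> letter" where
  "inv_letter x = (fst x, \<not> snd x)"

fun cons_reduced :: "letter \<Rightarrow> letter list \<Rightarrow> letter list" where
  "cons_reduced x [] = [x]"
| "cons_reduced x (y # ys) = (if y = inv_letter x then ys else x # y # ys)"

definition reduce :: "letter list \<Rightarrow> letter list" where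
  "reduce w = foldr cons_reduced w []"

definition freely_reduced :: "letter list \<Rightarrow> bool" where
  "freely_reduced w \<longleftrightarrow> (\<forall>i. Suc i < length w \<longrightarrow> w ! Suc i \<noteq> inv_letter (w ! i))"

definition free_group :: "nat \<Rightarrow> letter list monoid" where
  "free_group r =
     \<lparr>carrier = {w \<in> lists (letters r). freely_reduced w},
      mult = (\<lambda>u v. reduce (u @ v)),
      one = []\<rparr>"

definition derived_term :: "nat \<Rightarrow> nat \<Rightarrow> letter list set" where
  "derived_term r i = (derived (free_group r) ^^ i) (carrier (free_group r))"

definition free_solvable_group :: "nat \<Rightarrow> nat \<Rightarrow> letter list set monoid" where
  "free_solvable_group r d = free_group r Mod derived_term r d"

text \<open>The element of \<open>S\<^sub>r\<^sub>,\<^sub>d\<close> represented by a word, which need not be freely reduced.\<close>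

definition solvable_value :: "nat \<Rightarrow> nat \<Rightarrow> letter list \<Rightarrow> letter list set" where
  "solvable_value r d w = derived_term r d #>\<^bsub>free_group r\<^esub> reduce w"


subsection \<open>These are groups\<close>

lemma inv_letter_inv_letter [simp]: "inv_letter (inv_letter x) = x"
  by (simp add: inv_letter_def)

lemma inv_letter_in_letters [simp]: "inv_letter x \<in> letters r \<longleftrightarrow> x \<in> letters r"
  by (cases x) (simp add: inv_letter_def letters_def)

lemma freely_reduced_Nil [simp]: "freely_reduced []"
  by (simp add: freely_reduced_def)

lemma freely_reduced_Cons:
  "freely_reduced (x # w) \<longleftrightarrow> freely_reduced w \<and> (w = [] \<or> hd w \<noteq> inv_letter x)"
  unfolding freely_reduced_def
  by (cases w) (auto simp: nth_Cons split: nat.splits)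

lemma reduced_cons_reduced: "freely_reduced w \<Longrightarrow> freely_reduced (cons_reduced x w)"
  by (cases w) (auto simp: freely_reduced_Cons)

lemma reduced_foldr: "freely_reduced z \<Longrightarrow> freely_reduced (foldr cons_reduced u z)"
  by (induction u) (auto intro: reduced_cons_reduced)

lemma cons_reduced_cancel:
  assumes "freely_reduced w"
  shows "cons_reduced x (cons_reduced (inv_letter x) w) = w"
proof (cases w)
  case (Cons y ys)
  then show ?thesis using assms by (cases ys) (auto simp: freely_reduced_Cons)
qed simp

lemma foldr_cons_reduced:
  assumes "freely_reduced z"
  shows "foldr cons_reduced (cons_reduced x u) z = cons_reduced x (foldr cons_reduced u z)"
  using cons_reduced_cancel[OF reduced_foldr[OF assms]] by (cases u) auto

lemma foldr_reduce:
  assumes "freely_reduced z"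
  shows "foldr cons_reduced (reduce u) z = foldr cons_reduced u z"
  by (induction u) (auto simp: reduce_def foldr_cons_reduced[OF assms])

lemma reduce_append: "reduce (u @ v) = foldr cons_reduced u (reduce v)"
  by (simp add: reduce_def)

lemma reduced_reduce [simp]: "freely_reduced (reduce w)"
  by (simp add: reduce_def reduced_foldr)

lemma reduce_reduced: "freely_reduced w \<Longrightarrow> reduce w = w"
proof (induction w)
  case (Cons x w)
  then show ?case by (cases w) (auto simp: reduce_def freely_reduced_Cons)
qed (simp add: reduce_def)

lemma reduce_in_lists: "w \<in> lists A \<Longrightarrow> reduce w \<in> lists A"
proof (induction w)
  case (Cons x w)
  then show ?case by (cases "reduce w") (auto simp: reduce_def)
qed (simp add: reduce_def)

lemma reduce_inverse: "reduce (rev (map inv_letter w) @ w) = []"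
proof (induction w)
  case (Cons x w)
  have "reduce (rev (map inv_letter (x # w)) @ x # w)
      = foldr cons_reduced (rev (map inv_letter w))
          (cons_reduced (inv_letter x) (cons_reduced x (reduce w)))"
    by (simp add: reduce_def)
  also have "\<dots> = reduce (rev (map inv_letter w) @ w)"
    using cons_reduced_cancel[of "reduce w" "inv_letter x"] by (simp add: reduce_append)
  finally show ?case using Cons by simp
qed (simp add: reduce_def)

lemma group_free_group: "group (free_group r)"
proof (rule groupI)
  fix u v w
  have "reduce (reduce (u @ v) @ w) = foldr cons_reduced (u @ v) (reduce w)"
    by (simp only: reduce_append[of "reduce (u @ v)"] foldr_reduce[OF reduced_reduce])
  also have "\<dots> = foldr cons_reduced u (reduce (v @ w))"
    by (simp add: reduce_append)
  also have "\<dots> = reduce (u @ reduce (v @ w))"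
    by (simp only: reduce_append[of u] reduce_reduced[OF reduced_reduce])
  finally show "u \<otimes>\<^bsub>free_group r\<^esub> v \<otimes>\<^bsub>free_group r\<^esub> w =
             u \<otimes>\<^bsub>free_group r\<^esub> (v \<otimes>\<^bsub>free_group r\<^esub> w)"
    by (simp add: free_group_def)
next
  fix w assume w: "w \<in> carrier (free_group r)"
  let ?v = "reduce (rev (map inv_letter w))"
  have "?v \<otimes>\<^bsub>free_group r\<^esub> w = \<one>\<^bsub>free_group r\<^esub>"
    using reduce_inverse[of w] by (simp add: free_group_def reduce_append foldr_reduce)
  moreover have "?v \<in> carrier (free_group r)"
    using w reduce_in_lists[of "rev (map inv_letter w)" "letters r"]
    by (auto simp: free_group_def in_lists_conv_set)
  ultimately show "\<exists>v\<in>carrier (free_group r). v \<otimes>\<^bsub>free_group r\<^esub> w = \<one>\<^bsub>free_group r\<^esub>"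
    by blast
next
  show "u \<otimes>\<^bsub>free_group r\<^esub> v \<in> carrier (free_group r)"
    if "u \<in> carrier (free_group r)" "v \<in> carrier (free_group r)" for u v
    using that reduce_in_lists[of "u @ v" "letters r"] by (simp add: free_group_def)
qed (auto simp: free_group_def reduce_reduced)

lemma derived_term_normal: "derived_term r d \<lhd> free_group r"
proof -
  interpret group "free_group r" by (rule group_free_group)
  show ?thesis
    unfolding derived_term_def
    by (induction d) (auto intro: normal_self derived_is_normal)
qed

lemma group_free_solvable_group: "group (free_solvable_group r d)"
  unfolding free_solvable_group_def by (rule normal.factorgroup_is_group[OF derived_term_normal])


section \<open>Randomized random access machines\<close>

text \<open>
  Memory cells are indexed by natural numbers, hold arbitrary integers and are initially \<open>0\<close>.
  The input is a bit string that is read once, from left to right. In the following table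
  \<open>M[a]\<close> is the content of cell \<open>a\<close>.

    \<^item> \<open>Const a k\<close>: \<open>M[a] := k\<close>
    \<^item> \<open>Add a b c\<close>, \<open>Sub a b c\<close>, \<open>Mult a b c\<close>: \<open>M[a] := M[b] op M[c]\<close>
    \<^item> \<open>Load a b\<close>: \<open>M[a] := M[M[b]]\<close>
    \<^item> \<open>Store a b\<close>: \<open>M[M[a]] := M[b]\<close>
    \<^item> \<open>Jump l\<close>; \<open>JumpZero a l\<close> (if \<open>M[a] = 0\<close>); \<open>JumpPos a l\<close> (if \<open>M[a] > 0\<close>)
    \<^item> \<open>Read a\<close>: \<open>M[a] :=\<close> the next input bit, or \<open>-1\<close> if the input is exhausted
    \<^item> \<open>Rand a b\<close>: \<open>M[a] :=\<close> a uniformly random integer from \<open>[0, M[b]]\<close>,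
      independent of all previous ones
    \<^item> \<open>Halt v\<close>: stop with answer Yes (\<open>v = True\<close>) or No (\<open>v = False\<close>)

  Conventions for degenerate cases: a negative indirect address denotes cell \<open>0\<close>, a negative
  bound in \<open>Rand\<close> counts as \<open>0\<close>, and running off the program loops for ever without an answer.
\<close>

datatype instr =
    Const nat int
  | Add nat nat nat
  | Sub nat nat nat
  | Mult nat nat nat
  | Load nat nat
  | Store nat nat
  | Jump nat
  | JumpZero nat nat
  | JumpPos nat nat
  | Read nat
  | Rand nat nat
  | Halt bool

type_synonym program = "instr list"

record config =
  pc :: nat
  mem :: "nat \<Rightarrow> int"
  input :: "bool list"
  time :: nat
  answer :: "bool option"

text \<open>Number of bits of the signed binary representation; always positive.\<close>

definition bits :: "int \<Rightarrow> nat" where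
  "bits k = 1 + floorlog 2 (nat \<bar>k\<bar>)"

text \<open>\<open>n log n log log n\<close>, with rounded logarithms that are at least \<open>1\<close>.\<close>

definition mult_cost :: "nat \<Rightarrow> nat" where
  "mult_cost n = n * bits (int n) * bits (int (bits (int n)))"

text \<open>
  Bit cost. Indirect addresses are charged for; the direct addresses are part of the fixed program.
  Every instruction costs at least \<open>1\<close>.
\<close>

fun cost :: "instr \<Rightarrow> (nat \<Rightarrow> int) \<Rightarrow> nat" where
  "cost (Const a k) M = bits k"
| "cost (Add a b c) M = max (bits (M b)) (bits (M c))"
| "cost (Sub a b c) M = max (bits (M b)) (bits (M c))"
| "cost (Mult a b c) M = mult_cost (max (bits (M b)) (bits (M c)))"
| "cost (Load a b) M = bits (M b) + bits (M (nat (M b)))"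
| "cost (Store a b) M = bits (M a) + bits (M b)"
| "cost (Jump l) M = 1"
| "cost (JumpZero a l) M = bits (M a)"
| "cost (JumpPos a l) M = bits (M a)"
| "cost (Read a) M = 1"
| "cost (Rand a b) M = bits (M b)"
| "cost (Halt v) M = 1"

fun effect :: "instr \<Rightarrow> config \<Rightarrow> config pmf" where
  "effect (Const a k) s = return_pmf (s\<lparr>mem := (mem s)(a := k)\<rparr>)"
| "effect (Add a b c) s = return_pmf (s\<lparr>mem := (mem s)(a := mem s b + mem s c)\<rparr>)"
| "effect (Sub a b c) s = return_pmf (s\<lparr>mem := (mem s)(a := mem s b - mem s c)\<rparr>)"
| "effect (Mult a b c) s = return_pmf (s\<lparr>mem := (mem s)(a := mem s b * mem s c)\<rparr>)"
| "effect (Load a b) s = return_pmf (s\<lparr>mem := (mem s)(a := mem s (nat (mem s b)))\<rparr>)"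
| "effect (Store a b) s = return_pmf (s\<lparr>mem := (mem s)(nat (mem s a) := mem s b)\<rparr>)"
| "effect (Jump l) s = return_pmf (s\<lparr>pc := l\<rparr>)"
| "effect (JumpZero a l) s = return_pmf (if mem s a = 0 then s\<lparr>pc := l\<rparr> else s)"
| "effect (JumpPos a l) s = return_pmf (if mem s a > 0 then s\<lparr>pc := l\<rparr> else s)"
| "effect (Read a) s = return_pmf
     (case input s of
        [] \<Rightarrow> s\<lparr>mem := (mem s)(a := - 1)\<rparr>
      | v # vs \<Rightarrow> s\<lparr>mem := (mem s)(a := of_bool v), input := vs\<rparr>)"
| "effect (Rand a b) s =
     map_pmf (\<lambda>k. s\<lparr>mem := (mem s)(a := k)\<rparr>) (pmf_of_set {0..max 0 (mem s b)})"
| "effect (Halt v) s = return_pmf (s\<lparr>answer := Some v\<rparr>)"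

text \<open>The program counter and the clock are advanced before the effect, so that jumps overwrite \<open>pc\<close>.\<close>

definition step :: "program \<Rightarrow> config \<Rightarrow> config pmf" where
  "step P s =
     (if answer s \<noteq> None \<or> pc s \<ge> length P then return_pmf s
      else effect (P ! pc s)
        (s\<lparr>pc := pc s + 1, time := time s + cost (P ! pc s) (mem s)\<rparr>))"

definition start :: "bool list \<Rightarrow> config" where
  "start xs = \<lparr>pc = 0, mem = (\<lambda>_. 0), input = xs, time = 0, answer = None\<rparr>"

fun run_steps :: "program \<Rightarrow> nat \<Rightarrow> config \<Rightarrow> config pmf" where
  "run_steps P 0 s = return_pmf s"
| "run_steps P (Suc n) s = bind_pmf (step P s) (run_steps P n)"

text \<open>
  Distribution of the configuration reached on input \<open>xs\<close> after \<open>t\<close> steps. As every step costs at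
  least \<open>1\<close>, a computation of cost at most \<open>t\<close> has halted by then, and halted configurations
  do not change any more.
\<close>

definition run :: "program \<Rightarrow> nat \<Rightarrow> bool list \<Rightarrow> config pmf" where
  "run P t xs = run_steps P t (start xs)"

text \<open>The time bound is deterministic: it has to hold for every outcome of the random choices.\<close>

definition halts_within :: "program \<Rightarrow> nat \<Rightarrow> bool list \<Rightarrow> bool" where
  "halts_within P t xs \<longleftrightarrow> (\<forall>s\<in>set_pmf (run P t xs). answer s \<noteq> None \<and> time s \<le> t)"

definition surely_answers :: "program \<Rightarrow> nat \<Rightarrow> bool list \<Rightarrow> bool \<Rightarrow> bool" where
  "surely_answers P t xs v \<longleftrightarrow> (\<forall>s\<in>set_pmf (run P t xs). answer s = Some v)"

definition answer_prob :: "program \<Rightarrow> nat \<Rightarrow> bool list \<Rightarrow> bool \<Rightarrow> real" where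
  "answer_prob P t xs v = measure_pmf.prob (run P t xs) {s. answer s = Some v}"

lemma cost_pos: "cost i M > 0"
  by (cases i) (auto simp: bits_def mult_cost_def max_def)


section \<open>Input encoding and bounds\<close>

definition letter_code :: "nat \<Rightarrow> (letter \<Rightarrow> bool list) \<Rightarrow> bool" where
  "letter_code r enc \<longleftrightarrow>
     inj_on enc (letters r) \<and> (\<forall>x\<in>letters r. int (length (enc x)) = \<lceil>log 2 (real r)\<rceil> + 1)"

definition encode_word :: "(letter \<Rightarrow> bool list) \<Rightarrow> letter list \<Rightarrow> bool list" where
  "encode_word enc w = concat (map enc w)"

definition quasi_linear :: "(nat \<Rightarrow> nat) \<Rightarrow> bool" where
  "quasi_linear T \<longleftrightarrow> (\<exists>k::nat. (\<lambda>n. real (T n)) \<in> O(\<lambda>n. real n * ln (real n) ^ k))"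

text \<open>
  \<open>(1 - 1/n) ^ log\<^sub>3 n\<close>. For \<open>n = 1\<close> this is \<open>0 ^ 0\<close>, which is taken to be \<open>1\<close>; real exponentiation
  with \<open>powr\<close> would give \<open>0\<close> there.
\<close>

definition success_bound :: "nat \<Rightarrow> real" where
  "success_bound n = (if n = 1 then 1 else (1 - 1 / real n) powr log 3 (real n))"

end

theory Submission
  imports Defs "HOL-Algebra.FiniteProduct" "HOL-Library.Sublist" "HOL-Library.Countable"
begin

text \<open>
  The word problem in \<open>S\<^sub>r\<^sub>,\<^sub>d\<close> is solved by naming the prefixes of the input word level by level.
  Two words are equal in \<open>F/[N, N]\<close> if and only if the paths that they describe in the Cayley graph of
  \<open>F/N\<close> have the same flow, i.e. traverse every edge the same number of times, counted with
  orientation (\<open>flow_eq_iff\<close>). For \<open>N = F\<^bsup>(k)\<^esup>\<close> this decides equality in \<open>S\<^sub>r\<^sub>,\<^sub>k\<^sub>+\<^sub>1\<close> as soon as the vertices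
  of the Cayley graph of \<open>S\<^sub>r\<^sub>,\<^sub>k\<close> that are visited can be told apart. So if every prefix of the input
  gets a number, its label of level \<open>k\<close>, such that labels of level \<open>k + 1\<close> coincide exactly when the
  flows computed with labels of level \<open>k\<close> as vertices coincide, and if all labels of level \<open>0\<close> are
  equal, then labels of level \<open>k\<close> coincide exactly for prefixes that are equal in \<open>S\<^sub>r\<^sub>,\<^sub>k\<close>
  (\<open>labels_faithful\<close>). The word is trivial if and only if it gets the same label of level \<open>d\<close> as the
  empty word, which is \<open>0\<close>.

  The flow changes at a single edge when one letter is read, and the point is to find the new label
  in polylogarithmic time. Edges are numbered in the order of their first use. The flow of a level
  is stored in a binary tree in heap order: node \<open>j \<ge> 1\<close> holds the flow through edge \<open>j\<close> and has the
  children \<open>2 j\<close> and \<open>2 j + 1\<close>. Every node also carries a name, which depends only on the triple of its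
  flow and the names of its two children; a table of all triples seen so far guarantees that
  different triples have different names (hash consing). The name at the root then determines the
  whole flow and is determined by it (\<open>named_inject\<close>), hence it can serve as the label. After the
  flow through edge \<open>j\<close> has changed, only the names on the path from node \<open>j\<close> to the root have to be
  renewed (\<open>rename_path\<close>), and these are logarithmically many. For a word of length \<open>n\<close> at most \<open>d n\<close>
  edges are created, all numbers stay polynomial in \<open>n\<close>, and the total bit cost is
  \<open>O(n log\<^sup>4 n)\<close>.

  All tables are looked up by direct addressing: the memory of the machine is initially \<open>0\<close>, and a
  key that consists of boundedly many polynomially bounded integers is encoded injectively by a
  polynomially bounded address (\<open>list_code_inject\<close>). The machine constructed here draws no random
  numbers. It is always correct, so its probability of answering \<open>No\<close> on a nontrivial word is \<open>1\<close>.

  The program is written in a small structured language over named variables and tables, which is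
  translated to machine code with a uniform bound on the cost per instruction (\<open>machine_program_run\<close>).
  Its effect is described by an invariant that refers to the history of labels (\<open>state_inv\<close>), from
  which correctness follows (\<open>state_inv_decides\<close>).
\<close>

section \<open>Flows of words\<close>

definition letter_sign :: "letter \<Rightarrow> int" where
  "letter_sign x = (if snd x then 1 else -1)"

text \<open>
  An edge \<open>e p i\<close> starts at the vertex reached by the word \<open>p\<close> and has the label \<open>x\<^sub>i\<close>. Reading
  \<open>x\<^sub>i\<^sup>-\<^sup>1\<close> after \<open>v\<close> traverses backwards the edge that starts at the new vertex. The function \<open>e\<close>
  abstracts from the way in which vertices are represented: by cosets in the Cayley graph and by
  numbers in the machine.
\<close>

definition step_edge :: "(letter list \<Rightarrow> nat \<Rightarrow> 'e) \<Rightarrow> letter list \<Rightarrow> letter \<Rightarrow> 'e" where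
  "step_edge e v x = e (if snd x then v else v @ [x]) (fst x)"

definition nth_edge :: "(letter list \<Rightarrow> nat \<Rightarrow> 'e) \<Rightarrow> letter list \<Rightarrow> nat \<Rightarrow> 'e" where
  "nth_edge e v n = step_edge e (take n v) (v ! n)"

definition flow :: "(letter list \<Rightarrow> nat \<Rightarrow> 'e) \<Rightarrow> letter list \<Rightarrow> 'e \<Rightarrow> int" where
  "flow e v y = (\<Sum>n<length v. if nth_edge e v n = y then letter_sign (v ! n) else 0)"

lemma flow_Nil [simp]: "flow e [] y = 0"
  by (simp add: flow_def)

lemma nth_edge_append: "n < length v \<Longrightarrow> nth_edge e (v @ v') n = nth_edge e v n"
  by (simp add: nth_edge_def nth_append)

lemma flow_snoc:
  "flow e (v @ [x]) y = flow e v y + (if step_edge e v x = y then letter_sign x else 0)"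
proof -
  have "nth_edge e (v @ [x]) (length v) = step_edge e v x"
    by (simp add: nth_edge_def)
  then show ?thesis
    by (auto simp: flow_def nth_edge_append nth_append intro!: sum.cong)
qed

lemma step_edge_append: "step_edge e (v @ u) x = step_edge (\<lambda>p. e (v @ p)) u x"
  by (simp add: step_edge_def)

lemma flow_append: "flow e (v @ u) y = flow e v y + flow (\<lambda>p. e (v @ p)) u y"
proof (induction u rule: rev_induct)
  case (snoc x u)
  have "flow e (v @ u @ [x]) y = flow e ((v @ u) @ [x]) y"
    by simp
  also have "\<dots> = flow e v y + flow (\<lambda>p. e (v @ p)) (u @ [x]) y"
    unfolding flow_snoc using snoc by (simp add: step_edge_append)
  finally show ?case by simp
qed simp

lemma flow_Cons:
  "flow e (x # u) y = (if step_edge e [] x = y then letter_sign x else 0) + flow (\<lambda>p. e (x # p)) u y"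
  using flow_append[of e "[x]" u y] flow_snoc[of e "[]" x y] by simp

lemma flow_support: "flow e v y \<noteq> 0 \<Longrightarrow> \<exists>n<length v. nth_edge e v n = y"
  by (rule ccontr) (auto simp: flow_def intro!: sum.neutral)

text \<open>
  Summing over the steps of a path a quantity that depends on the edge, with the orientation as sign, is
  the same as integrating it against the flow. In particular the sum depends on the flow only.
\<close>

lemma sum_flow_times:
  fixes g :: "'e \<Rightarrow> int"
  assumes "finite Y" "nth_edge e v ` {..<length v} \<subseteq> Y"
  shows "(\<Sum>y\<in>Y. flow e v y * g y) = (\<Sum>n<length v. letter_sign (v ! n) * g (nth_edge e v n))"
proof -
  have "(\<Sum>y\<in>Y. flow e v y * g y)
      = (\<Sum>n<length v. \<Sum>y\<in>Y. if nth_edge e v n = y then letter_sign (v ! n) * g y else 0)"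
    unfolding flow_def sum_distrib_right by (subst sum.swap) (auto intro!: sum.cong)
  also have "\<dots> = (\<Sum>n<length v. letter_sign (v ! n) * g (nth_edge e v n))"
    using assms by (intro sum.cong) auto
  finally show ?thesis .
qed

lemma flow_transport:
  assumes "\<And>n. n < length v \<Longrightarrow> (nth_edge e' v n = y') \<longleftrightarrow> (nth_edge e v n = y)"
  shows "flow e' v y' = flow e v y"
  unfolding flow_def using assms by (intro sum.cong) auto

text \<open>
  Which paths have equal flows depends only on the pattern of coincidences among the edges that they
  use. Hence the flows may be computed with any faithful representation of the visited edges.
\<close>

lemma flow_eq_transport:
  assumes pat: "\<And>u u' m n. \<lbrakk>u \<in> {v, v'}; u' \<in> {v, v'}; m < length u; n < length u'\<rbrakk>
      \<Longrightarrow> (nth_edge e u m = nth_edge e u' n) \<longleftrightarrow> (nth_edge e' u m = nth_edge e' u' n)"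
    and eq: "flow e v = flow e v'"
  shows "flow e' v = flow e' v'"
proof
  fix y'
  show "flow e' v y' = flow e' v' y'"
  proof (cases "\<exists>u\<in>{v, v'}. \<exists>m<length u. nth_edge e' u m = y'")
    case True
    then obtain u m where u: "u \<in> {v, v'}" "m < length u" "nth_edge e' u m = y'" by blast
    have "flow e' u' y' = flow e u' (nth_edge e u m)" if "u' \<in> {v, v'}" for u'
      using pat[OF that u(1) _ u(2)] u(3) by (intro flow_transport) auto
    then show ?thesis using eq by simp
  next
    case False
    then have "flow e' u y' = 0" if "u \<in> {v, v'}" for u
      using that flow_support[of e' u y'] by blast
    then show ?thesis by simp
  qed
qed

section \<open>Flows in Cayley graphs\<close>

lemma reduce_cancel: "reduce (x # inv_letter x # p) = reduce p"
  using cons_reduced_cancel[OF reduced_reduce, of x p] by (simp add: reduce_def)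

lemma reduce_Cons: "reduce (x # p) = cons_reduced x (reduce p)"
  by (simp add: reduce_def)

lemma reduce_append_reduce: "reduce (u @ reduce v) = reduce (u @ v)"
  by (simp add: reduce_append reduce_reduced)

lemma reduce_reduce_append: "reduce (reduce u @ v) = reduce (u @ v)"
  by (simp add: reduce_append foldr_reduce)

text \<open>
  A letter followed by its inverse traverses the same edge back and forth.
\<close>

lemma flow_cons_reduced:
  assumes "\<And>p. e p = e (reduce p)"
  shows "flow e (cons_reduced x w) = flow e (x # w)"
proof (cases "\<exists>ys. w = inv_letter x # ys")
  case True
  then obtain ys where w: "w = inv_letter x # ys" by blast
  have "e (x # inv_letter x # p) = e p" for p
    using assms[of p] assms[of "x # inv_letter x # p"] reduce_cancel[of x p] by simp
  moreover have "e [x, inv_letter x] = e []"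
    using assms[of "[x, inv_letter x]"] assms[of "[]"] reduce_cancel[of x "[]"] by simp
  ultimately have "flow e (x # w) y = flow e ys y" for y
    unfolding w flow_Cons by (auto simp: step_edge_def letter_sign_def inv_letter_def)
  then show ?thesis by (auto simp: w)
next
  case False
  then show ?thesis by (cases w) auto
qed

lemma flow_reduce:
  assumes "\<And>p. e p = e (reduce p)"
  shows "flow e (reduce w) = flow e w"
  using assms
proof (induction w arbitrary: e)
  case (Cons x w)
  have inv: "e (x # p) = e (x # reduce p)" for p
    using Cons.prems[of "x # p"] Cons.prems[of "x # reduce p"] reduce_append_reduce[of "[x]" p]
    by simp
  have "flow e (reduce (x # w)) = flow e (x # reduce w)"
    unfolding reduce_Cons by (rule flow_cons_reduced) (rule Cons.prems)
  moreover have "flow (\<lambda>p. e (x # p)) (reduce w) = flow (\<lambda>p. e (x # p)) w"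
    using Cons.IH[of "\<lambda>p. e (x # p)"] inv by blast
  ultimately show ?case by (auto simp: flow_Cons)
qed (simp add: reduce_def)

lemma reduce_in_carrier: "w \<in> lists (letters r) \<Longrightarrow> reduce w \<in> carrier (free_group r)"
  using reduce_in_lists[of w "letters r"] by (simp add: free_group_def)

lemma mult_reduce: "reduce u \<otimes>\<^bsub>free_group r\<^esub> reduce v = reduce (u @ v)"
  by (simp add: free_group_def reduce_append_reduce reduce_reduce_append)

lemma carrier_free_groupD:
  "w \<in> carrier (free_group r) \<Longrightarrow> w \<in> lists (letters r) \<and> reduce w = w"
  by (simp add: free_group_def reduce_reduced)

definition coset :: "nat \<Rightarrow> letter list set \<Rightarrow> letter list \<Rightarrow> letter list set" where
  "coset r N w = N #>\<^bsub>free_group r\<^esub> reduce w"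

definition cayley_edge :: "nat \<Rightarrow> letter list set \<Rightarrow> letter list \<Rightarrow> nat \<Rightarrow> letter list set \<times> nat" where
  "cayley_edge r N v i = (coset r N v, i)"

lemma cayley_edge_reduce: "cayley_edge r N (reduce p) = cayley_edge r N p"
  by (simp add: cayley_edge_def coset_def reduce_reduced fun_eq_iff)

text \<open>
  Changing the flow through one edge multiplies a product over all edges, with the flow as exponent, by
  a single factor.
\<close>

lemma (in comm_group) finprod_int_pow_add_single:
  fixes \<phi> :: "'e \<Rightarrow> int"
  assumes "finite Y" "h \<in> Y \<rightarrow> carrier G" "y\<^sub>0 \<in> Y"
  shows "finprod G (\<lambda>y. h y [^] (\<phi> y + (if y\<^sub>0 = y then k else 0))) Y
    = finprod G (\<lambda>y. h y [^] \<phi> y) Y \<otimes> h y\<^sub>0 [^] k"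
proof -
  have h: "h y \<in> carrier G" if "y \<in> Y" for y using assms(2) that by blast
  have "finprod G (\<lambda>y. h y [^] (\<phi> y + (if y\<^sub>0 = y then k else 0))) Y
      = finprod G (\<lambda>y. h y [^] \<phi> y \<otimes> (if y\<^sub>0 = y then h y [^] k else \<one>)) Y"
    using h by (intro finprod_cong') (auto simp: int_pow_mult)
  also have "\<dots> = finprod G (\<lambda>y. h y [^] \<phi> y) Y
      \<otimes> finprod G (\<lambda>y. if y\<^sub>0 = y then h y [^] k else \<one>) Y"
    using h by (intro finprod_multf) auto
  also have "finprod G (\<lambda>y. if y\<^sub>0 = y then h y [^] k else \<one>) Y = h y\<^sub>0 [^] k"
    using assms h by (intro finprod_singleton) auto
  finally show ?thesis .
qed

locale normal_in_free =
  fixes r :: nat and N :: "letter list set"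
  assumes normal_N: "N \<lhd> free_group r"
begin

abbreviation "F \<equiv> free_group r"

sublocale F: group F by (rule group_free_group)
sublocale N: normal N F by (rule normal_N)

abbreviation "D \<equiv> derived F N"

lemma normal_D: "D \<lhd> F"
  by (rule F.derived_is_normal[OF normal_N])

sublocale D: normal D F by (rule normal_D)

lemma D_subset_N: "D \<subseteq> N"
  by (rule F.derived_incl[OF subset_refl N.subgroup_axioms])

abbreviation "nflow \<equiv> flow (cayley_edge r N)"

text \<open>
  An element \<open>g\<close> of \<open>N\<close> describes a closed path at the base vertex, so the path described by \<open>h\<close> starts
  there again after \<open>g\<close> has been read. On \<open>N\<close> the flow is therefore a homomorphism to an abelian group.
\<close>

lemma flow_mult:
  assumes "g \<in> N" "h \<in> carrier F"
  shows "nflow (g \<otimes>\<^bsub>F\<^esub> h) y = nflow g y + nflow h y"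
proof -
  have g: "g \<in> carrier F" "reduce g = g" using assms(1) N.subset carrier_free_groupD by auto
  have h: "h \<in> lists (letters r)" "reduce h = h" using assms(2) carrier_free_groupD by auto
  have "nflow (g \<otimes>\<^bsub>F\<^esub> h) y = nflow (reduce (g @ h)) y"
    using mult_reduce[of r g h] g h by simp
  also have "\<dots> = nflow (g @ h) y"
    using flow_reduce[of "cayley_edge r N" "g @ h"] by (simp add: cayley_edge_reduce)
  also have "\<dots> = nflow g y + flow (\<lambda>p. cayley_edge r N (g @ p)) h y"
    by (rule flow_append)
  also have "flow (\<lambda>p. cayley_edge r N (g @ p)) h y = nflow h y"
  proof (rule flow_transport)
    fix n assume n: "n < length h"
    have eq: "coset r N (g @ p) = coset r N p" if "p \<in> lists (letters r)" for p
    proof -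
      have "coset r N (g @ p) = N #>\<^bsub>F\<^esub> (g \<otimes>\<^bsub>F\<^esub> reduce p)"
        using mult_reduce[of r g p] g by (simp add: coset_def)
      also have "\<dots> = N #>\<^bsub>F\<^esub> g #>\<^bsub>F\<^esub> reduce p"
        using g reduce_in_carrier[OF that] by (simp add: F.coset_mult_assoc N.subset)
      also have "N #>\<^bsub>F\<^esub> g = N"
        using assms(1) by (simp add: N.rcos_const)
      finally show ?thesis by (simp add: coset_def)
    qed
    have "take n h \<in> lists (letters r)" "take n h @ [h ! n] \<in> lists (letters r)"
      using h n by (auto simp: in_lists_conv_set dest: in_set_takeD)
    then show "(nth_edge (\<lambda>p. cayley_edge r N (g @ p)) h n = y) = (nth_edge (cayley_edge r N) h n = y)"
      by (auto simp: nth_edge_def step_edge_def cayley_edge_def eq)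
  qed
  finally show ?thesis .
qed

lemma flow_one: "nflow \<one>\<^bsub>F\<^esub> y = 0"
  by (simp add: free_group_def)

lemma flow_inv:
  assumes "g \<in> N"
  shows "nflow (inv\<^bsub>F\<^esub> g) y = - nflow g y"
proof -
  have "g \<in> carrier F" using assms N.subset by blast
  then have "nflow (inv\<^bsub>F\<^esub> g) y + nflow g y = nflow (inv\<^bsub>F\<^esub> g \<otimes>\<^bsub>F\<^esub> g) y"
    using flow_mult[of "inv\<^bsub>F\<^esub> g" g y] assms by simp
  also have "\<dots> = 0" using \<open>g \<in> carrier F\<close> flow_one by simp
  finally show ?thesis by simp
qed

text \<open>
  The elements of \<open>N\<close> with flow \<open>0\<close> form a subgroup, which contains all commutators because the flow
  is a homomorphism with abelian target.
\<close>

lemma flow_derived: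
  assumes "g \<in> D"
  shows "nflow g = (\<lambda>_. 0)"
proof -
  let ?Z = "{g \<in> N. \<forall>y. nflow g y = 0}"
  have "subgroup ?Z F"
  proof (rule F.subgroupI)
    show "?Z \<noteq> {}" using N.one_closed flow_one by blast
  qed (use N.subset in \<open>auto simp: flow_mult flow_inv\<close>)
  moreover have "derived_set F N \<subseteq> ?Z"
  proof
    fix z assume "z \<in> derived_set F N"
    then obtain a b where ab: "a \<in> N" "b \<in> N"
      and z: "z = a \<otimes>\<^bsub>F\<^esub> b \<otimes>\<^bsub>F\<^esub> inv\<^bsub>F\<^esub> a \<otimes>\<^bsub>F\<^esub> inv\<^bsub>F\<^esub> b" by auto
    have "a \<in> carrier F" "b \<in> carrier F" using ab N.subset by auto
    then have "nflow z y = 0" for y unfolding z using ab by (simp add: flow_mult flow_inv)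
    moreover have "z \<in> N" unfolding z using ab by simp
    ultimately show "z \<in> ?Z" by simp
  qed
  ultimately have "D \<subseteq> ?Z"
    unfolding derived_def by (intro F.generate_subgroup_incl)
  then show ?thesis using assms by (auto simp: fun_eq_iff)
qed

lemma coset_eq_iff:
  assumes "M \<lhd> F" "v \<in> lists (letters r)" "v' \<in> lists (letters r)"
  shows "coset r M v = coset r M v' \<longleftrightarrow> reduce v \<otimes>\<^bsub>F\<^esub> inv\<^bsub>F\<^esub> reduce v' \<in> M"
proof -
  interpret M: normal M F by fact
  have c: "reduce v \<in> carrier F" "reduce v' \<in> carrier F"
    using assms reduce_in_carrier by auto
  have "coset r M v = coset r M v' \<longleftrightarrow> reduce v \<in> M #>\<^bsub>F\<^esub> reduce v'"
    unfolding coset_def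
    using c F.rcos_self[OF _ M.subgroup_axioms] F.repr_independence[OF _ _ M.subgroup_axioms] by blast
  also have "\<dots> \<longleftrightarrow> reduce v \<otimes>\<^bsub>F\<^esub> inv\<^bsub>F\<^esub> reduce v' \<in> M"
    by (rule M.rcos_module[OF F.group_axioms c(2,1)])
  finally show ?thesis .
qed

text \<open>
  The two words differ by a factor \<open>u \<in> [N, N]\<close> on the left, which contributes nothing to the flow.
\<close>

lemma flow_eq_if_coset_eq:
  assumes v: "v \<in> lists (letters r)" "v' \<in> lists (letters r)"
    and eq: "coset r D v = coset r D v'"
  shows "nflow v = nflow v'"
proof
  fix y
  let ?u = "reduce v \<otimes>\<^bsub>F\<^esub> inv\<^bsub>F\<^esub> reduce v'"
  have c: "reduce v \<in> carrier F" "reduce v' \<in> carrier F"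
    using v reduce_in_carrier by auto
  have u: "?u \<in> D" using coset_eq_iff[OF normal_D v] eq by blast
  have red: "nflow (reduce p) y = nflow p y" for p
    using flow_reduce[of "cayley_edge r N" p] by (simp add: cayley_edge_reduce)
  have "nflow v y = nflow (?u \<otimes>\<^bsub>F\<^esub> reduce v') y"
    using c red by (simp add: F.m_assoc)
  also have "\<dots> = nflow ?u y + nflow (reduce v') y"
    using u c D_subset_N by (intro flow_mult) auto
  also have "\<dots> = nflow v' y" using flow_derived[OF u] red by simp
  finally show "nflow v y = nflow v' y" .
qed

lemma letter_in_carrier: "x \<in> letters r \<Longrightarrow> [x] \<in> carrier F"
  by (simp add: free_group_def freely_reduced_def)

lemma mult_inv_letter: "x \<in> letters r \<Longrightarrow> [inv_letter x] = inv\<^bsub>F\<^esub> [x]"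
  using letter_in_carrier[of x] letter_in_carrier[of "inv_letter x"]
  by (intro F.inv_equality[symmetric]) (auto simp: free_group_def reduce_def)

lemma reduce_snoc:
  assumes "x \<in> letters r"
  shows "reduce (w @ [x]) = reduce w \<otimes>\<^bsub>F\<^esub> [x]"
  using mult_reduce[of r w "[x]"] by (simp add: reduce_def)

lemma coset_snoc:
  assumes "w \<in> lists (letters r)" "x \<in> letters r"
  shows "coset r N (w @ [x]) = coset r N w #>\<^bsub>F\<^esub> [x]"
  using assms reduce_in_carrier[of w r] letter_in_carrier[of x]
  by (simp add: coset_def reduce_snoc F.coset_mult_assoc N.subset)

lemma coset_snoc_inv:
  assumes "w \<in> lists (letters r)" "x \<in> letters r"
  shows "coset r N (w @ [inv_letter x]) #>\<^bsub>F\<^esub> [x] = coset r N w"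
proof -
  have "reduce (w @ [inv_letter x, x]) = reduce w"
    using reduce_cancel[of "inv_letter x" "[]"] by (simp add: reduce_append reduce_def)
  then show ?thesis
    using assms coset_snoc[of "w @ [inv_letter x]" x] by (simp add: coset_def)
qed

text \<open>
  Every edge leads from a coset \<open>c\<close> to the coset \<open>c x\<^sub>i\<close>, and a letter moves along it in one of the two
  directions.
\<close>

lemma step_edge_cases:
  assumes "w \<in> lists (letters r)" "x \<in> letters r"
  obtains (forward) i where "x = (i, True)" "i \<in> {1..r}"
      "step_edge (cayley_edge r N) w x = (coset r N w, i)"
      "coset r N w #>\<^bsub>F\<^esub> [(i, True)] = coset r N (w @ [x])"
  | (backward) i where "x = (i, False)" "i \<in> {1..r}"
      "step_edge (cayley_edge r N) w x = (coset r N (w @ [x]), i)"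
      "coset r N (w @ [x]) #>\<^bsub>F\<^esub> [(i, True)] = coset r N w"
proof -
  obtain i b where x: "x = (i, b)" by fastforce
  have i: "i \<in> {1..r}" using assms x by (auto simp: letters_def)
  show thesis
  proof (cases b)
    case True
    then show thesis
      using forward[of i] i x coset_snoc[OF assms] by (simp add: step_edge_def cayley_edge_def)
  next
    case False
    then have "x = inv_letter (i, True)" "(i, True) \<in> letters r"
      using x i by (auto simp: inv_letter_def letters_def)
    then have "coset r N (w @ [x]) #>\<^bsub>F\<^esub> [(i, True)] = coset r N w"
      using coset_snoc_inv[OF assms(1), of "(i, True)"] by simp
    then show thesis
      using backward[of i] i x False by (simp add: step_edge_def cayley_edge_def)
  qed
qed

definition "edges = {(coset r N p, i) | p i. p \<in> lists (letters r) \<and> i \<in> {1..r}}"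

lemma step_edge_in_edges:
  assumes "w \<in> lists (letters r)" "x \<in> letters r"
  shows "step_edge (cayley_edge r N) w x \<in> edges"
  using assms
proof (cases rule: step_edge_cases)
  case forward
  then show ?thesis using assms by (auto simp: edges_def)
next
  case backward
  moreover have "w @ [x] \<in> lists (letters r)" using assms by simp
  ultimately show ?thesis by (auto simp: edges_def simp del: lists.simps append_in_lists_conv)
qed

definition "path_edges w = nth_edge (cayley_edge r N) w ` {..<length w}"

lemma path_edges_snoc: "path_edges (w @ [x]) = insert (step_edge (cayley_edge r N) w x) (path_edges w)"
proof -
  have "nth_edge (cayley_edge r N) (w @ [x]) ` {..<length w} = path_edges w"
    unfolding path_edges_def by (intro image_cong) (auto simp: nth_edge_append)
  then show ?thesis
    by (simp add: path_edges_def lessThan_Suc) (simp add: nth_edge_def)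
qed

lemma path_edges_in_edges: "w \<in> lists (letters r) \<Longrightarrow> path_edges w \<subseteq> edges"
proof (induction w rule: rev_induct)
  case (snoc x w)
  then show ?case using step_edge_in_edges[of w x] by (simp add: path_edges_snoc)
qed (simp add: path_edges_def)

text \<open>
  The differences of a potential \<open>P\<close> on the vertices telescope along a path.
\<close>

lemma potential_along_path:
  fixes P :: "letter list set \<Rightarrow> int"
  assumes "w \<in> lists (letters r)"
  shows "(\<Sum>n<length w. letter_sign (w ! n) *
      (case nth_edge (cayley_edge r N) w n of (c, i) \<Rightarrow> P (c #>\<^bsub>F\<^esub> [(i, True)]) - P c))
    = P (coset r N w) - P (coset r N [])" (is "?S w = _")
  using assms
proof (induction w rule: rev_induct)
  case (snoc x w)
  then have w: "w \<in> lists (letters r)" "x \<in> letters r" by auto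
  have "?S (w @ [x]) = ?S w + letter_sign x *
      (case step_edge (cayley_edge r N) w x of (c, i) \<Rightarrow> P (c #>\<^bsub>F\<^esub> [(i, True)]) - P c)"
    by (simp add: nth_edge_append nth_append) (simp add: nth_edge_def)
  also have "\<dots> = P (coset r N (w @ [x])) - P (coset r N [])"
    using w
  proof (cases rule: step_edge_cases)
    case (forward i)
    show ?thesis unfolding forward(3) using forward(1,4) snoc.IH w by (simp add: letter_sign_def)
  next
    case (backward i)
    show ?thesis unfolding backward(3) using backward(1,4) snoc.IH w by (simp add: letter_sign_def)
  qed
  finally show ?case .
qed simp

text \<open>
  The flow determines the end point of a path: choose the indicator function of the end point of the
  first path as potential. Its total increase is determined by the flow, so it is the same along the
  second path.
\<close>

lemma endpoint_eq_if_flow_eq: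
  assumes v: "v \<in> lists (letters r)" "v' \<in> lists (letters r)" and eq: "nflow v = nflow v'"
  shows "coset r N v = coset r N v'"
proof -
  \<comment> \<open>the indicator function of the first end point\<close>
  define P :: "letter list set \<Rightarrow> int" where "P c = of_bool (c = coset r N v)" for c
  define g where "g = (\<lambda>(c, i). P (c #>\<^bsub>F\<^esub> [(i, True)]) - P c)"
  let ?Y = "path_edges v \<union> path_edges v'"
  have Y: "finite ?Y" by (simp add: path_edges_def)
  have sum: "P (coset r N w) - P (coset r N []) = (\<Sum>y\<in>?Y. nflow w y * g y)" if "w \<in> {v, v'}" for w
  proof -
    have w: "w \<in> lists (letters r)" "path_edges w \<subseteq> ?Y" using that v by auto
    show ?thesis
      using sum_flow_times[OF Y, of "cayley_edge r N" w g] potential_along_path[OF w(1), of P] w(2)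
      by (simp add: g_def path_edges_def)
  qed
  have "P (coset r N v) = P (coset r N v')" using sum[of v] sum[of v'] eq by simp
  then show ?thesis by (auto simp: P_def split: if_splits)
qed

text \<open>
  A transversal. The representative of \<open>N\<close> itself may be any element of \<open>N\<close>; its contribution cancels
  when two words are compared.
\<close>

definition coset_rep :: "letter list set \<Rightarrow> letter list" where
  "coset_rep c = (SOME g. g \<in> c)"

lemma coset_rep_coset:
  assumes "w \<in> lists (letters r)"
  shows "coset_rep (coset r N w) \<in> carrier F" "reduce w \<otimes>\<^bsub>F\<^esub> inv\<^bsub>F\<^esub> coset_rep (coset r N w) \<in> N"
proof -
  have w: "reduce w \<in> carrier F" using reduce_in_carrier assms by blast
  have "reduce w \<in> coset r N w"
    unfolding coset_def using w by (rule F.rcos_self) (rule N.subgroup_axioms)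
  then have coset_rep: "coset_rep (coset r N w) \<in> coset r N w"
    unfolding coset_rep_def by (rule someI)
  then show c: "coset_rep (coset r N w) \<in> carrier F"
    using F.r_coset_subset_G[OF N.subset w] by (auto simp: coset_def)
  have "coset r N w = N #>\<^bsub>F\<^esub> coset_rep (coset r N w)"
    using F.repr_independence[OF _ w N.subgroup_axioms] coset_rep by (simp add: coset_def)
  then have "reduce w \<in> N #>\<^bsub>F\<^esub> coset_rep (coset r N w)"
    using \<open>reduce w \<in> coset r N w\<close> by simp
  then show "reduce w \<otimes>\<^bsub>F\<^esub> inv\<^bsub>F\<^esub> coset_rep (coset r N w) \<in> N"
    by (rule N.rcos_module_imp[OF F.group_axioms c])
qed

text \<open>
  The element of \<open>N\<close> obtained by going from the representative of the tail of an edge through that edge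
  and back from the representative of its head (a Schreier generator of \<open>N\<close>).
\<close>

definition "schreier = (\<lambda>(c, i). coset_rep c \<otimes>\<^bsub>F\<^esub> [(i, True)] \<otimes>\<^bsub>F\<^esub> inv\<^bsub>F\<^esub> coset_rep (c #>\<^bsub>F\<^esub> [(i, True)]))"

text \<open>
  The element of \<open>N\<close> obtained by reading \<open>w\<close> and returning from the representative of its end point.
\<close>

definition "loop w = reduce w \<otimes>\<^bsub>F\<^esub> inv\<^bsub>F\<^esub> coset_rep (coset r N w)"

lemma loop_in_N: "w \<in> lists (letters r) \<Longrightarrow> loop w \<in> N"
  using coset_rep_coset by (simp add: loop_def)

text \<open>
  Consecutive representatives cancel, so each step contributes the Schreier generator of its edge or the
  inverse of that generator.
\<close>

lemma loop_snoc:
  assumes "w \<in> lists (letters r)" "x \<in> letters r"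
  shows "loop (w @ [x]) = loop w \<otimes>\<^bsub>F\<^esub>
    (if snd x then schreier (step_edge (cayley_edge r N) w x)
     else inv\<^bsub>F\<^esub> schreier (step_edge (cayley_edge r N) w x))"
proof -
  have wx: "w @ [x] \<in> lists (letters r)" using assms by simp
  note c = reduce_in_carrier[OF assms(1)] coset_rep_coset(1)[OF assms(1)] coset_rep_coset(1)[OF wx]
    letter_in_carrier[OF assms(2)]
  have cancel: "inv\<^bsub>F\<^esub> a \<otimes>\<^bsub>F\<^esub> (a \<otimes>\<^bsub>F\<^esub> b) = b" if "a \<in> carrier F" "b \<in> carrier F" for a b
    using that by (simp add: F.m_assoc[symmetric])
  show ?thesis
    using assms
  proof (cases rule: step_edge_cases)
    case (forward i)
    show ?thesis
      unfolding forward(3) schreier_def loop_def prod.case forward(4) using c forward(1) assms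
      by (simp add: F.m_assoc cancel reduce_snoc)
  next
    case (backward i)
    have i: "(i, True) \<in> letters r" "x = inv_letter (i, True)"
      using backward by (auto simp: letters_def inv_letter_def)
    have "reduce (w @ [x]) = reduce w \<otimes>\<^bsub>F\<^esub> inv\<^bsub>F\<^esub> [(i, True)]"
      using mult_inv_letter[OF i(1)] i(2) reduce_snoc[OF assms(2)] by simp
    moreover have "\<not> snd x" using backward(1) by simp
    ultimately show ?thesis
      unfolding backward(3) schreier_def loop_def prod.case backward(4)
      using c letter_in_carrier[OF i(1)]
      by (simp add: F.m_assoc F.inv_mult_group cancel)
  qed
qed

lemma schreier_in_N:
  assumes "y \<in> edges"
  shows "schreier y \<in> N"
proof -
  obtain p i where p: "y = (coset r N p, i)" "p \<in> lists (letters r)" "(i, True) \<in> letters r"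
    using assms by (auto simp: edges_def letters_def)
  have p': "p @ [(i, True)] \<in> lists (letters r)" using p by simp
  note c = reduce_in_carrier[OF p(2)] coset_rep_coset(1)[OF p(2)] coset_rep_coset(1)[OF p'] letter_in_carrier[OF p(3)]
  have "step_edge (cayley_edge r N) p (i, True) = y"
    by (simp add: p step_edge_def cayley_edge_def)
  then have "loop (p @ [(i, True)]) = loop p \<otimes>\<^bsub>F\<^esub> schreier y"
    using loop_snoc[OF p(2,3)] by simp
  moreover have "schreier y \<in> carrier F"
    using c coset_snoc[OF p(2,3)] by (simp add: p schreier_def)
  moreover have "loop p \<in> carrier F" using loop_in_N[OF p(2)] N.subset by blast
  ultimately have "schreier y = inv\<^bsub>F\<^esub> loop p \<otimes>\<^bsub>F\<^esub> loop (p @ [(i, True)])"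
    by (simp add: F.m_assoc[symmetric])
  then show ?thesis using loop_in_N[OF p(2)] loop_in_N[OF p'] by simp
qed

text \<open>
  The abelianization of \<open>N\<close>.
\<close>

definition "A = (F\<lparr>carrier := N\<rparr>) Mod D"

sublocale A: comm_group A
  unfolding A_def by (rule F.derived_quot_of_subgroup_is_comm_group) (rule N.subgroup_axioms)

lemma carrier_A: "a \<in> N \<Longrightarrow> D #>\<^bsub>F\<^esub> a \<in> carrier A"
  by (auto simp: A_def carrier_FactGroup r_coset_consistent)

lemma mult_A:
  assumes "a \<in> N" "b \<in> N"
  shows "(D #>\<^bsub>F\<^esub> a) \<otimes>\<^bsub>A\<^esub> (D #>\<^bsub>F\<^esub> b) = D #>\<^bsub>F\<^esub> (a \<otimes>\<^bsub>F\<^esub> b)"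
proof -
  have "a \<in> carrier F" "b \<in> carrier F" using assms N.subset by auto
  then show ?thesis using D.rcos_sum[of a b] by (simp add: A_def set_mult_def)
qed

lemma inv_A:
  assumes "a \<in> N"
  shows "inv\<^bsub>A\<^esub> (D #>\<^bsub>F\<^esub> a) = D #>\<^bsub>F\<^esub> (inv\<^bsub>F\<^esub> a)"
proof (rule A.inv_equality)
  have "a \<in> carrier F" using assms N.subset by auto
  then show "(D #>\<^bsub>F\<^esub> inv\<^bsub>F\<^esub> a) \<otimes>\<^bsub>A\<^esub> (D #>\<^bsub>F\<^esub> a) = \<one>\<^bsub>A\<^esub>"
    using assms by (simp add: mult_A D.subset) (simp add: A_def)
qed (use assms carrier_A in auto)

text \<open>
  In the abelianization of \<open>N\<close> the Schreier generators collected along the path may be sorted by edges.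
  What remains of the path is its flow. The factor \<open>loop []\<close> accounts for the choice of the
  representative of \<open>N\<close>.
\<close>

lemma loop_eq_finprod:
  assumes "w \<in> lists (letters r)" "finite Y" "path_edges w \<subseteq> Y" "Y \<subseteq> edges"
  shows "D #>\<^bsub>F\<^esub> loop w = (D #>\<^bsub>F\<^esub> loop []) \<otimes>\<^bsub>A\<^esub>
    finprod A (\<lambda>y. (D #>\<^bsub>F\<^esub> schreier y) [^]\<^bsub>A\<^esub> nflow w y) Y"
  using assms
proof (induction w rule: rev_induct)
  case Nil
  then show ?case using loop_in_N[of "[]"] carrier_A by simp
next
  case (snoc x w)
  then have w: "w \<in> lists (letters r)" "x \<in> letters r" by auto
  let ?y = "step_edge (cayley_edge r N) w x"
  let ?h = "\<lambda>y. D #>\<^bsub>F\<^esub> schreier y"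
  let ?P = "\<lambda>w. finprod A (\<lambda>y. ?h y [^]\<^bsub>A\<^esub> nflow w y) Y"
  have h: "?h \<in> Y \<rightarrow> carrier A" using snoc.prems schreier_in_N carrier_A by blast
  have y: "?y \<in> Y" using snoc.prems by (simp add: path_edges_snoc)
  have sy: "schreier ?y \<in> N" using y snoc.prems schreier_in_N by blast
  have Pw: "?P w \<in> carrier A" using h by (intro A.finprod_closed) auto
  have "?P (w @ [x]) = ?P w \<otimes>\<^bsub>A\<^esub> ?h ?y [^]\<^bsub>A\<^esub> letter_sign x"
    unfolding flow_snoc by (rule A.finprod_int_pow_add_single) (use h y snoc.prems in auto)
  moreover have "?h ?y [^]\<^bsub>A\<^esub> letter_sign x = D #>\<^bsub>F\<^esub>
      (if snd x then schreier ?y else inv\<^bsub>F\<^esub> schreier ?y)"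
    using carrier_A[OF sy] sy by (simp add: letter_sign_def inv_A A.int_pow_neg)
  moreover have "D #>\<^bsub>F\<^esub> loop (w @ [x]) = (D #>\<^bsub>F\<^esub> loop w) \<otimes>\<^bsub>A\<^esub>
      (D #>\<^bsub>F\<^esub> (if snd x then schreier ?y else inv\<^bsub>F\<^esub> schreier ?y))"
    using loop_in_N[OF w(1)] sy by (simp add: mult_A loop_snoc[OF w])
  moreover have "D #>\<^bsub>F\<^esub> loop w = (D #>\<^bsub>F\<^esub> loop []) \<otimes>\<^bsub>A\<^esub> ?P w"
    using snoc by (simp add: path_edges_snoc)
  ultimately show ?case
    using Pw carrier_A[OF loop_in_N[of "[]"]] h y sy carrier_A
    by (simp add: A.m_assoc)
qed

text \<open>
  Equal flows imply equal end points and equal loops modulo \<open>[N, N]\<close>, and a word is recovered from its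
  loop and its end point.
\<close>

lemma coset_eq_if_flow_eq:
  assumes v: "v \<in> lists (letters r)" "v' \<in> lists (letters r)" and eq: "nflow v = nflow v'"
  shows "coset r D v = coset r D v'"
proof -
  let ?Y = "path_edges v \<union> path_edges v'"
  have Y: "finite ?Y" "?Y \<subseteq> edges"
    using path_edges_in_edges v by (auto simp: path_edges_def)
  have "D #>\<^bsub>F\<^esub> loop v = D #>\<^bsub>F\<^esub> loop v'"
    using loop_eq_finprod[OF v(1) Y(1) _ Y(2)] loop_eq_finprod[OF v(2) Y(1) _ Y(2)] eq by simp
  moreover have "coset r D w = (D #>\<^bsub>F\<^esub> loop w) #>\<^bsub>F\<^esub> coset_rep (coset r N w)"
    if "w \<in> lists (letters r)" for w
    using reduce_in_carrier[OF that] coset_rep_coset(1)[OF that]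
    by (simp add: coset_def loop_def F.coset_mult_assoc D.subset F.m_assoc)
  ultimately show ?thesis
    using v endpoint_eq_if_flow_eq[OF v eq] by simp
qed

text \<open>
  The flow description of the Magnus embedding: \<open>F/[N, N]\<close> is faithfully represented by flows in
  the Cayley graph of \<open>F/N\<close>.
\<close>

lemma flow_eq_iff:
  assumes "v \<in> lists (letters r)" "v' \<in> lists (letters r)"
  shows "nflow v = nflow v' \<longleftrightarrow> coset r D v = coset r D v'"
  using flow_eq_if_coset_eq coset_eq_if_flow_eq assms by blast

end

section \<open>Labels for the elements of free solvable groups\<close>

lemma nth_edge_prefix: "prefix u w \<Longrightarrow> m < length u \<Longrightarrow> nth_edge e u m = nth_edge e w m"
  by (auto simp: prefix_def nth_edge_append)

lemma derived_term_Suc: "derived_term r (Suc k) = derived (free_group r) (derived_term r k)"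
  by (simp add: derived_term_def)

text \<open>
  The induction behind the algorithm. If \<open>lab k\<close> separates the prefixes of \<open>w\<close> exactly as \<open>S\<^sub>r\<^sub>,\<^sub>k\<close> does,
  then flows computed with \<open>lab k\<close> coincide exactly when the flows in the Cayley graph of \<open>S\<^sub>r\<^sub>,\<^sub>k\<close> do,
  i.e. exactly for prefixes that are equal in \<open>S\<^sub>r\<^sub>,\<^sub>k\<^sub>+\<^sub>1\<close>. Edges enter through an arbitrary numbering
  \<open>e k\<close> that is injective on the edges used by \<open>w\<close>.
\<close>

lemma labels_faithful:
  fixes lab :: "nat \<Rightarrow> letter list \<Rightarrow> 'l" and e :: "nat \<Rightarrow> letter list \<Rightarrow> nat \<Rightarrow> 'e"
  assumes w: "w \<in> lists (letters r)"
    and lab0: "\<And>v v'. lab 0 v = lab 0 v'"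
    and edge: "\<And>k m n. \<lbrakk>k < d; m < length w; n < length w\<rbrakk> \<Longrightarrow>
        nth_edge (e k) w m = nth_edge (e k) w n \<longleftrightarrow>
        nth_edge (\<lambda>p i. (lab k p, i)) w m = nth_edge (\<lambda>p i. (lab k p, i)) w n"
    and lab: "\<And>k v v'. \<lbrakk>k < d; prefix v w; prefix v' w\<rbrakk> \<Longrightarrow>
        lab (Suc k) v = lab (Suc k) v' \<longleftrightarrow> flow (e k) v = flow (e k) v'"
  shows "\<lbrakk>k \<le> d; prefix v w; prefix v' w\<rbrakk> \<Longrightarrow>
    lab k v = lab k v' \<longleftrightarrow> coset r (derived_term r k) v = coset r (derived_term r k) v'"
proof (induction k arbitrary: v v')
  case 0
  have "coset r (derived_term r 0) u = carrier (free_group r)" if "prefix u w" for u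
  proof -
    interpret group "free_group r" by (rule group_free_group)
    have "reduce u \<in> carrier (free_group r)"
      using that w by (intro reduce_in_carrier) (auto simp: prefix_def)
    then show ?thesis
      using coset_join2[OF _ subgroup_self] by (simp add: coset_def derived_term_def)
  qed
  then show ?case using 0 lab0 by metis
next
  case (Suc k)
  let ?N = "derived_term r k"
  interpret normal_in_free r ?N by (rule normal_in_free.intro) (rule derived_term_normal)
  have pre: "prefix (take m w) w" for m by (rule take_is_prefix)
  have pat: "nth_edge (e k) w m = nth_edge (e k) w n \<longleftrightarrow>
      nth_edge (cayley_edge r ?N) w m = nth_edge (cayley_edge r ?N) w n"
    if "m < length w" "n < length w" for m n
  proof -
    \<comment> \<open>the vertex at which the edge used in step \<open>m\<close> starts\<close>
    define site where "site m = (if snd (w ! m) then take m w else take (Suc m) w)" for m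
    have at: "nth_edge f w m = f (site m) (fst (w ! m))" if "m < length w" for m and f :: "letter list \<Rightarrow> nat \<Rightarrow> 'x"
      using that by (simp add: nth_edge_def step_edge_def site_def take_Suc_conv_app_nth)
    have "prefix (site m) w" for m using pre by (simp add: site_def)
    then have "lab k (site m) = lab k (site n) \<longleftrightarrow> coset r ?N (site m) = coset r ?N (site n)"
      using Suc.IH Suc.prems(1) by simp
    then show ?thesis
      using edge[of k m n] that Suc.prems(1) by (simp add: at cayley_edge_def)
  qed
  have "flow (e k) v = flow (e k) v' \<longleftrightarrow> nflow v = nflow v'"
  proof
    have len: "length u \<le> length w" if "u \<in> {v, v'}" for u
      using that Suc.prems prefix_length_le by auto
    have *: "nth_edge (e k) u m = nth_edge (e k) u' n \<longleftrightarrow>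
      nth_edge (cayley_edge r ?N) u m = nth_edge (cayley_edge r ?N) u' n"
      if "u \<in> {v, v'}" "u' \<in> {v, v'}" "m < length u" "n < length u'" for u u' m n
    proof -
      have "prefix u w" "prefix u' w" using that Suc.prems by auto
      then show ?thesis
        using pat[of m n] that len[OF that(1)] len[OF that(2)] by (simp add: nth_edge_prefix)
    qed
    show "nflow v = nflow v'" if "flow (e k) v = flow (e k) v'"
      by (rule flow_eq_transport[OF _ that]) (use * in blast)
    show "flow (e k) v = flow (e k) v'" if "nflow v = nflow v'"
      by (rule flow_eq_transport[OF _ that]) (use * in blast)
  qed
  moreover have "v \<in> lists (letters r)" "v' \<in> lists (letters r)"
    using Suc.prems w set_mono_prefix[of v w] set_mono_prefix[of v' w]
    by (auto simp: in_lists_conv_set)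
  ultimately show ?case
    using lab[of k v v'] Suc.prems flow_eq_iff[of v v'] by (simp add: derived_term_Suc)
qed

lemma trivial_iff_label:
  assumes "w \<in> lists (letters r)"
  shows "solvable_value r d w = \<one>\<^bsub>free_solvable_group r d\<^esub> \<longleftrightarrow>
    coset r (derived_term r d) w = coset r (derived_term r d) []"
proof -
  interpret group "free_group r" by (rule group_free_group)
  interpret N: normal "derived_term r d" "free_group r" by (rule derived_term_normal)
  have "reduce [] = \<one>\<^bsub>free_group r\<^esub>" by (simp add: reduce_def free_group_def)
  then show ?thesis
    by (simp add: coset_def solvable_value_def free_solvable_group_def N.subset)
qed

section \<open>A structured language\<close>

text \<open>
  Structured programs work on named variables and on one table whose keys are lists of integers.
  The first element of a key serves as the name of a subtable.
\<close>

record 'v state =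
  vars :: "'v \<Rightarrow> int"
  tab :: "int list \<Rightarrow> int"
  inp :: "bool list"

datatype 'v prim =
    Lit 'v int
  | Copy 'v 'v
  | AddV 'v 'v 'v
  | SubV 'v 'v 'v
  | MulV 'v 'v 'v
  | Get 'v nat "'v list"
  | Put nat "'v list" 'v
  | NextBit 'v

datatype 'v com =
    Skip
  | Prim "'v prim"
  | Seq "'v com" "'v com" (infixr ";;" 60)
  | IfZero 'v "'v com" "'v com"
  | WhilePos 'v "'v com"

definition key :: "'v state \<Rightarrow> nat \<Rightarrow> 'v list \<Rightarrow> int list" where
  "key s q us = int q # map (vars s) us"

fun prim_effect :: "'v prim \<Rightarrow> 'v state \<Rightarrow> 'v state" where
  "prim_effect (Lit v k) s = s\<lparr>vars := (vars s)(v := k)\<rparr>"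
| "prim_effect (Copy v a) s = s\<lparr>vars := (vars s)(v := vars s a)\<rparr>"
| "prim_effect (AddV v a b) s = s\<lparr>vars := (vars s)(v := vars s a + vars s b)\<rparr>"
| "prim_effect (SubV v a b) s = s\<lparr>vars := (vars s)(v := vars s a - vars s b)\<rparr>"
| "prim_effect (MulV v a b) s = s\<lparr>vars := (vars s)(v := vars s a * vars s b)\<rparr>"
| "prim_effect (Get v q us) s = s\<lparr>vars := (vars s)(v := tab s (key s q us))\<rparr>"
| "prim_effect (Put q us v) s = s\<lparr>tab := (tab s)(key s q us := vars s v)\<rparr>"
| "prim_effect (NextBit v) s =
     (case inp s of
        [] \<Rightarrow> s\<lparr>vars := (vars s)(v := - 1)\<rparr>
      | b # bs \<Rightarrow> s\<lparr>vars := (vars s)(v := of_bool b), inp := bs\<rparr>)"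

text \<open>
  \<open>X\<close> bounds the absolute value of all numbers in the state, and the bound on the length of a key keeps
  its code polynomial in \<open>X\<close>. Both are needed to bound the cost of the machine code.
\<close>

fun prim_ok :: "int \<Rightarrow> 'v prim \<Rightarrow> 'v state \<Rightarrow> bool" where
  "prim_ok X (Lit v k) s \<longleftrightarrow> \<bar>k\<bar> \<le> X"
| "prim_ok X (Copy v a) s \<longleftrightarrow> True"
| "prim_ok X (AddV v a b) s \<longleftrightarrow> \<bar>vars s a + vars s b\<bar> \<le> X"
| "prim_ok X (SubV v a b) s \<longleftrightarrow> \<bar>vars s a - vars s b\<bar> \<le> X"
| "prim_ok X (MulV v a b) s \<longleftrightarrow> \<bar>vars s a * vars s b\<bar> \<le> X"
| "prim_ok X (Get v q us) s \<longleftrightarrow> int q \<le> X \<and> length us \<le> 3"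
| "prim_ok X (Put q us v) s \<longleftrightarrow> int q \<le> X \<and> length us \<le> 3"
| "prim_ok X (NextBit v) s \<longleftrightarrow> True"

definition values_le :: "int \<Rightarrow> 'v state \<Rightarrow> bool" where
  "values_le X s \<longleftrightarrow> (\<forall>v. \<bar>vars s v\<bar> \<le> X) \<and> (\<forall>xs. \<bar>tab s xs\<bar> \<le> X)"

lemma values_le_prim_effect:
  assumes "values_le X s" "prim_ok X p s" "1 \<le> X"
  shows "values_le X (prim_effect p s)"
  using assms by (cases p) (auto simp: values_le_def split: list.splits)

section \<open>Translation to machine programs\<close>

text \<open>
  An injective coding of integer lists by natural numbers that needs no case distinction on signs,
  no division and only boundedly many arithmetic operations per element. As
  \<open>\<bar>x\<bar> \<le> x\<^sup>2 \<le> s\<close>, the value \<open>s\<^sup>2 + s + x\<close> is nonnegative, and adding \<open>1\<close> separates nonempty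
  lists from the empty one.
\<close>

fun list_code :: "int list \<Rightarrow> int" where
  "list_code [] = 0"
| "list_code (x # xs) = (let s = x * x + list_code xs in s * s + s + x + 1)"

lemma abs_le_square: "\<bar>x\<bar> \<le> x * (x::int)"
proof (cases "x = 0")
  case False
  then have "\<bar>x\<bar> * 1 \<le> \<bar>x\<bar> * \<bar>x\<bar>" by (intro mult_left_mono) auto
  then show ?thesis by simp
qed simp

lemma list_code_nonneg: "0 \<le> list_code xs"
proof (induction xs)
  case (Cons x xs)
  then show ?case
    using abs_le_square[of x] zero_le_square[of "x * x + list_code xs"]
    unfolding list_code.simps Let_def by linarith
qed simp

text \<open>
  \<open>s\<^sup>2 + s + x\<close> lies between \<open>s\<^sup>2\<close> and \<open>s\<^sup>2 + 2 s < (s + 1)\<^sup>2\<close>, hence determines \<open>s\<close>.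
\<close>

lemma square_pair_inject:
  fixes s t x y :: int
  assumes "\<bar>x\<bar> \<le> s" "\<bar>y\<bar> \<le> t" "s * s + s + x = t * t + t + y"
  shows "s = t \<and> x = y"
proof -
  have less: False if "\<bar>x\<bar> \<le> s" "\<bar>y\<bar> \<le> t" "s * s + s + x = t * t + t + y" "s < t" for s t x y :: int
  proof -
    have "(s + 1) * (s + 1) \<le> t * t" using that by (intro mult_mono) auto
    then show False using that by (simp add: algebra_simps)
  qed
  have "s = t" using less[of x s y t] less[of y t x s] assms
    by (cases s t rule: linorder_cases) auto
  then show ?thesis using assms by simp
qed

lemma list_code_inject: "list_code xs = list_code ys \<Longrightarrow> xs = ys"
proof (induction xs arbitrary: ys)
  case Nil
  have "list_code (y # ys') > 0" for y ys'
    using abs_le_square[of y] list_code_nonneg[of ys'] zero_le_square[of "y * y + list_code ys'"]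
    unfolding list_code.simps Let_def by linarith
  from this[of "hd ys" "tl ys"] show ?case using Nil by (cases ys) auto
next
  case (Cons x xs)
  have "list_code (x # xs) > 0"
    using abs_le_square[of x] list_code_nonneg[of xs] zero_le_square[of "x * x + list_code xs"]
    unfolding list_code.simps Let_def by linarith
  then obtain y ys' where ys: "ys = y # ys'" using Cons.prems by (cases ys) auto
  let ?s = "x * x + list_code xs" and ?t = "y * y + list_code ys'"
  have "?s = ?t \<and> x = y"
    using Cons.prems abs_le_square[of x] abs_le_square[of y] list_code_nonneg[of xs] list_code_nonneg[of ys']
    by (intro square_pair_inject) (auto simp: ys Let_def)
  then show ?case using Cons.IH ys by auto
qed

text \<open>
  Memory layout: variables live in the even cells from \<open>8\<close> on, table entries in the odd cells from \<open>9\<close>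
  on, and the cells \<open>0\<close>, \<open>1\<close>, \<open>2\<close> are used for the computation of addresses. Direct addresses are free
  of charge, so any injective numbering of the variables will do.
\<close>

definition var_addr :: "'v::countable \<Rightarrow> nat" where
  "var_addr v = 8 + 2 * to_nat v"

definition tab_addr :: "int list \<Rightarrow> nat" where
  "tab_addr xs = nat (2 * list_code xs + 9)"

lemma var_addr_inject [simp]: "var_addr v = var_addr u \<longleftrightarrow> v = u"
  by (simp add: var_addr_def)

lemma tab_addr_inject [simp]: "tab_addr xs = tab_addr ys \<longleftrightarrow> xs = ys"
  using list_code_inject list_code_nonneg[of xs] list_code_nonneg[of ys]
  by (auto simp: tab_addr_def)

lemma var_addr_neq_tab_addr [simp]: "var_addr v \<noteq> tab_addr xs" "tab_addr xs \<noteq> var_addr v"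
proof -
  have "int (tab_addr xs) = 2 * list_code xs + 9"
    using list_code_nonneg[of xs] by (simp add: tab_addr_def)
  moreover have "int (var_addr v) = 2 * int (to_nat v) + 8" by (simp add: var_addr_def)
  ultimately show "var_addr v \<noteq> tab_addr xs" "tab_addr xs \<noteq> var_addr v" by presburger+
qed

lemma addr_ge: "var_addr v \<ge> 8" "tab_addr xs \<ge> 8"
  using list_code_nonneg[of xs] by (auto simp: var_addr_def tab_addr_def)

text \<open>
  The code of the list of the contents of the given cells is left in cell \<open>0\<close>; cell \<open>1\<close> is used for
  intermediate results.
\<close>

fun key_code :: "nat list \<Rightarrow> instr list" where
  "key_code [] = [Const 0 0]"
| "key_code (a # as) = key_code as @
     [Mult 1 a a, Add 1 1 0, Mult 0 1 1, Add 0 0 1, Add 0 0 a, Const 1 1, Add 0 0 1]"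

definition addr_code :: "nat \<Rightarrow> nat list \<Rightarrow> instr list" where
  "addr_code q as = [Const 2 (int q)] @ key_code (2 # as) @ [Add 0 0 0, Const 1 9, Add 0 0 1]"

fun prim_code :: "'v::countable prim \<Rightarrow> instr list" where
  "prim_code (Lit v k) = [Const (var_addr v) k]"
| "prim_code (Copy v a) = [Const 0 0, Add (var_addr v) (var_addr a) 0]"
| "prim_code (AddV v a b) = [Add (var_addr v) (var_addr a) (var_addr b)]"
| "prim_code (SubV v a b) = [Sub (var_addr v) (var_addr a) (var_addr b)]"
| "prim_code (MulV v a b) = [Mult (var_addr v) (var_addr a) (var_addr b)]"
| "prim_code (Get v q us) = addr_code q (map var_addr us) @ [Load (var_addr v) 0]"
| "prim_code (Put q us v) = addr_code q (map var_addr us) @ [Store 0 (var_addr v)]"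
| "prim_code (NextBit v) = [Read (var_addr v)]"

fun com_size :: "'v::countable com \<Rightarrow> nat" where
  "com_size Skip = 0"
| "com_size (Prim p) = length (prim_code p)"
| "com_size (c1 ;; c2) = com_size c1 + com_size c2"
| "com_size (IfZero v c1 c2) = com_size c1 + com_size c2 + 2"
| "com_size (WhilePos v c) = com_size c + 3"

fun com_code :: "nat \<Rightarrow> 'v::countable com \<Rightarrow> instr list" where
  "com_code p Skip = []"
| "com_code p (Prim q) = prim_code q"
| "com_code p (c1 ;; c2) = com_code p c1 @ com_code (p + com_size c1) c2"
| "com_code p (IfZero v c1 c2) =
     JumpZero (var_addr v) (p + 2 + com_size c2) # com_code (p + 1) c2 @
     Jump (p + 2 + com_size c2 + com_size c1) # com_code (p + 2 + com_size c2) c1"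
| "com_code p (WhilePos v c) =
     JumpPos (var_addr v) (p + 2) # Jump (p + 3 + com_size c) # com_code (p + 2) c @ [Jump p]"

lemma length_com_code [simp]: "length (com_code p c) = com_size c"
  by (induction c arbitrary: p) auto

text \<open>
  Big-step semantics. The natural number is the exact number of machine instructions that the
  translated program executes. A derivation also certifies that all numbers computed on the way are
  bounded by \<open>X\<close>.
\<close>

inductive exec :: "int \<Rightarrow> 'v::countable com \<Rightarrow> 'v state \<Rightarrow> nat \<Rightarrow> 'v state \<Rightarrow> bool" for X where
  Skip: "exec X Skip s 0 s"
| Prim: "prim_ok X p s \<Longrightarrow> exec X (Prim p) s (length (prim_code p)) (prim_effect p s)"
| Seq: "exec X c1 s m s' \<Longrightarrow> exec X c2 s' n s'' \<Longrightarrow> exec X (c1 ;; c2) s (m + n) s''"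
| IfZero: "vars s v = 0 \<Longrightarrow> exec X c1 s n s' \<Longrightarrow> exec X (IfZero v c1 c2) s (1 + n) s'"
| IfNonzero: "vars s v \<noteq> 0 \<Longrightarrow> exec X c2 s n s' \<Longrightarrow> exec X (IfZero v c1 c2) s (1 + (n + 1)) s'"
| WhileDone: "vars s v \<le> 0 \<Longrightarrow> exec X (WhilePos v c) s 2 s"
| WhileStep: "vars s v > 0 \<Longrightarrow> exec X c s m s' \<Longrightarrow> exec X (WhilePos v c) s' n s'' \<Longrightarrow>
    exec X (WhilePos v c) s (1 + (m + (1 + n))) s''"

subsection \<open>Runs of the machine\<close>

definition reaches :: "program \<Rightarrow> nat \<Rightarrow> config \<Rightarrow> config \<Rightarrow> bool" where
  "reaches P n s s' \<longleftrightarrow> run_steps P n s = return_pmf s'"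

lemma run_steps_add: "run_steps P (m + n) s = bind_pmf (run_steps P m s) (run_steps P n)"
proof (induction m arbitrary: s)
  case (Suc m)
  then have "run_steps P (m + n) = (\<lambda>s. bind_pmf (run_steps P m s) (run_steps P n))"
    by (rule ext)
  then show ?case by (simp add: bind_assoc_pmf)
qed (simp add: bind_return_pmf)

lemma reaches_trans: "reaches P m s s' \<Longrightarrow> reaches P n s' s'' \<Longrightarrow> reaches P (m + n) s s''"
  by (simp add: reaches_def run_steps_add bind_return_pmf)

lemma reaches_0: "reaches P 0 s s"
  by (simp add: reaches_def)

lemma reaches_step: "step P s = return_pmf s' \<Longrightarrow> reaches P (Suc 0) s s'"
  by (simp add: reaches_def bind_return_pmf bind_return_pmf')

abbreviation running :: "nat \<Rightarrow> (nat \<Rightarrow> int) \<Rightarrow> bool list \<Rightarrow> nat \<Rightarrow> config" where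
  "running p M xs \<tau> \<equiv> \<lparr>pc = p, mem = M, input = xs, time = \<tau>, answer = None\<rparr>"

definition code_at :: "program \<Rightarrow> nat \<Rightarrow> instr list \<Rightarrow> bool" where
  "code_at P p is \<longleftrightarrow> (\<exists>pre post. P = pre @ is @ post \<and> length pre = p)"

lemma code_at_append:
  "code_at P p (is @ js) \<Longrightarrow> code_at P p is \<and> code_at P (p + length is) js"
proof -
  assume "code_at P p (is @ js)"
  then obtain pre post where *: "P = pre @ is @ js @ post" "length pre = p"
    by (auto simp: code_at_def)
  then have "P = (pre @ is) @ js @ post" "length (pre @ is) = p + length is" by auto
  with * show ?thesis unfolding code_at_def by blast
qed

lemma code_at_Cons:
  assumes "code_at P p (i # is)"
  shows "p < length P" "P ! p = i" "code_at P (Suc p) is"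
proof -
  obtain pre post where P: "P = pre @ (i # is) @ post" "length pre = p"
    using assms unfolding code_at_def by blast
  then show "p < length P" "P ! p = i" by (simp_all add: nth_append)
  show "code_at P (Suc p) is" using code_at_append[of P p "[i]" "is"] assms by simp
qed

fun straight :: "instr \<Rightarrow> bool" where
  "straight (Jump l) = False"
| "straight (JumpZero a l) = False"
| "straight (JumpPos a l) = False"
| "straight (Rand a b) = False"
| "straight (Halt v) = False"
| "straight _ = True"

fun straight_effect :: "instr \<Rightarrow> (nat \<Rightarrow> int) \<times> bool list \<Rightarrow> (nat \<Rightarrow> int) \<times> bool list" where
  "straight_effect (Const a k) (M, xs) = (M(a := k), xs)"
| "straight_effect (Add a b c) (M, xs) = (M(a := M b + M c), xs)"
| "straight_effect (Sub a b c) (M, xs) = (M(a := M b - M c), xs)"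
| "straight_effect (Mult a b c) (M, xs) = (M(a := M b * M c), xs)"
| "straight_effect (Load a b) (M, xs) = (M(a := M (nat (M b))), xs)"
| "straight_effect (Store a b) (M, xs) = (M(nat (M a) := M b), xs)"
| "straight_effect (Read a) (M, xs) =
     (case xs of [] \<Rightarrow> (M(a := - 1), []) | v # vs \<Rightarrow> (M(a := of_bool v), vs))"
| "straight_effect _ m = m"

fun straight_run :: "instr list \<Rightarrow> (nat \<Rightarrow> int) \<times> bool list \<Rightarrow> (nat \<Rightarrow> int) \<times> bool list" where
  "straight_run [] m = m"
| "straight_run (i # is) m = straight_run is (straight_effect i m)"

text \<open>
  The costs have to be checked along the run, because the cost of an instruction depends on the memory
  at the time of its execution.
\<close>

fun costs_le :: "nat \<Rightarrow> instr list \<Rightarrow> (nat \<Rightarrow> int) \<times> bool list \<Rightarrow> bool" where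
  "costs_le \<kappa> [] m \<longleftrightarrow> True"
| "costs_le \<kappa> (i # is) m \<longleftrightarrow> straight i \<and> cost i (fst m) \<le> \<kappa> \<and> costs_le \<kappa> is (straight_effect i m)"

lemma straight_run_append [simp]: "straight_run (is @ js) m = straight_run js (straight_run is m)"
  by (induction "is" arbitrary: m) auto

lemma costs_le_append [simp]:
  "costs_le \<kappa> (is @ js) m \<longleftrightarrow> costs_le \<kappa> is m \<and> costs_le \<kappa> js (straight_run is m)"
  by (induction "is" arbitrary: m) auto

lemma straight_step:
  assumes "straight i" "p < length P" "P ! p = i" "straight_effect i (M, xs) = (M', xs')"
  shows "step P (running p M xs \<tau>) = return_pmf (running (Suc p) M' xs' (\<tau> + cost i M))"
  using assms by (cases i) (auto simp: step_def split: list.splits)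

lemma straight_reaches:
  assumes "code_at P p is" "costs_le \<kappa> is (M, xs)" "straight_run is (M, xs) = (M', xs')"
  shows "\<exists>\<tau>'\<le>\<tau> + length is * \<kappa>.
    reaches P (length is) (running p M xs \<tau>) (running (p + length is) M' xs' \<tau>')"
  using assms
proof (induction "is" arbitrary: p M xs \<tau>)
  case Nil
  then show ?case by (auto intro: reaches_0)
next
  case (Cons i "is")
  obtain M1 xs1 where e: "straight_effect i (M, xs) = (M1, xs1)" by fastforce
  note at = code_at_Cons[OF Cons.prems(1)]
  have i: "straight i" "cost i M \<le> \<kappa>" and rest: "costs_le \<kappa> is (M1, xs1)" "straight_run is (M1, xs1) = (M', xs')"
    using Cons.prems(2,3) e by auto
  obtain \<tau>' where \<tau>': "\<tau>' \<le> \<tau> + cost i M + length is * \<kappa>"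
    "reaches P (length is) (running (Suc p) M1 xs1 (\<tau> + cost i M)) (running (Suc p + length is) M' xs' \<tau>')"
    using Cons.IH[OF at(3) rest] by blast
  have "reaches P (Suc 0 + length is) (running p M xs \<tau>) (running (Suc p + length is) M' xs' \<tau>')"
    by (rule reaches_trans[OF reaches_step[OF straight_step[OF i(1) at(1,2) e]] \<tau>'(2)])
  then show ?case using \<tau>'(1) i(2) by (intro exI[of _ \<tau>']) auto
qed

subsection \<open>Bounds for the cost of instructions\<close>

lemma bits_le:
  assumes "\<bar>k\<bar> \<le> 2 ^ V"
  shows "bits k \<le> V + 2"
proof -
  have "\<bar>k\<bar> < 2 ^ Suc V" using le_less_trans[OF assms, of "2 ^ Suc V"] by simp
  then have "nat \<bar>k\<bar> < 2 ^ Suc V" by (simp add: nat_less_iff)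
  then have "floorlog 2 (nat \<bar>k\<bar>) \<le> Suc V" by (intro floorlog_leI) auto
  then show ?thesis by (simp add: bits_def)
qed

lemma bits_mono: "m \<le> n \<Longrightarrow> bits (int m) \<le> bits (int n)"
  by (simp add: bits_def floorlog_mono)

lemma bits_pos: "1 \<le> bits k"
  by (simp add: bits_def)

lemma mult_cost_mono: "m \<le> n \<Longrightarrow> mult_cost m \<le> mult_cost n"
  unfolding mult_cost_def by (intro mult_mono bits_mono) auto

lemma le_mult_cost: "n \<le> mult_cost n"
proof -
  have "n * 1 * 1 \<le> mult_cost n"
    unfolding mult_cost_def by (intro mult_le_mono bits_pos order_refl)
  then show ?thesis by simp
qed

text \<open>
  A bound for the cost of every instruction all of whose operands have absolute value at most \<open>2\<^sup>V\<close>.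
  The factor \<open>2\<close> is due to \<open>Load\<close> and \<open>Store\<close>, which are charged for address and content.
\<close>

definition instr_cost :: "nat \<Rightarrow> nat" where
  "instr_cost V = 2 * mult_cost (V + 2)"

text \<open>
  The numbers whose lengths determine the cost of an instruction.
\<close>

fun operands :: "instr \<Rightarrow> (nat \<Rightarrow> int) \<Rightarrow> int set" where
  "operands (Const a k) M = {k}"
| "operands (Add a b c) M = {M b, M c}"
| "operands (Sub a b c) M = {M b, M c}"
| "operands (Mult a b c) M = {M b, M c}"
| "operands (Load a b) M = {M b, M (nat (M b))}"
| "operands (Store a b) M = {M a, M b}"
| "operands (JumpZero a l) M = {M a}"
| "operands (JumpPos a l) M = {M a}"
| "operands (Rand a b) M = {M b}"
| "operands _ M = {}"

lemma cost_le:
  assumes "\<And>k. k \<in> operands i M \<Longrightarrow> \<bar>k\<bar> \<le> 2 ^ V"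
  shows "cost i M \<le> instr_cost V"
proof -
  have b: "bits k \<le> V + 2" if "k \<in> operands i M" for k using assms that by (intro bits_le)
  have "V + 2 \<le> mult_cost (V + 2)" by (rule le_mult_cost)
  moreover have "cost i M \<le> mult_cost (V + 2) \<or> cost i M \<le> 2 * (V + 2)"
  proof (cases i)
    case (Mult a b' c)
    then show ?thesis using b by (simp add: mult_cost_mono)
  next
    case (Load a b')
    then show ?thesis using b[of "M b'"] b[of "M (nat (M b'))"] by simp
  next
    case (Store a b')
    then show ?thesis using b[of "M b'"] b[of "M a"] by simp
  next
    case (Const a k)
    then show ?thesis using b[of k] by simp
  next
    case (Add a b' c)
    then show ?thesis using b[of "M b'"] b[of "M c"] by simp
  next
    case (Sub a b' c)
    then show ?thesis using b[of "M b'"] b[of "M c"] by simp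
  next
    case (JumpZero a l)
    then show ?thesis using b[of "M a"] by simp
  next
    case (JumpPos a l)
    then show ?thesis using b[of "M a"] by simp
  next
    case (Rand a b')
    then show ?thesis using b[of "M b'"] by simp
  qed auto
  ultimately show ?thesis unfolding instr_cost_def by (elim disjE) simp_all
qed

text \<open>
  Bounds for the code of a list of length \<open>m\<close> with entries of absolute value at most \<open>2\<^sup>\<beta>\<close>: prepending an
  element squares the code, up to a constant factor. The bound starts at \<open>2 \<beta>\<close> so that it always
  dominates the square of an entry.
\<close>

fun key_bits :: "nat \<Rightarrow> nat \<Rightarrow> nat" where
  "key_bits \<beta> 0 = 2 * \<beta>"
| "key_bits \<beta> (Suc m) = 2 * key_bits \<beta> m + 4"

lemma key_bits_mono: "m \<le> n \<Longrightarrow> key_bits \<beta> m \<le> key_bits \<beta> n"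
  by (rule lift_Suc_mono_le[of "key_bits \<beta>"]) auto

lemma twice_le_key_bits: "2 * \<beta> \<le> key_bits \<beta> m"
  using key_bits_mono[of 0 m \<beta>] by simp

lemma key_code_run:
  assumes "\<And>a. a \<in> set as \<Longrightarrow> 2 \<le> a \<and> \<bar>M a\<bar> \<le> 2 ^ \<beta>" "key_bits \<beta> (length as) \<le> V"
  shows "\<exists>M'. straight_run (key_code as) (M, xs) = (M', xs) \<and> M' 0 = list_code (map M as) \<and>
    (\<forall>a\<ge>2. M' a = M a) \<and> list_code (map M as) \<le> 2 ^ key_bits \<beta> (length as) \<and>
    costs_le (instr_cost V) (key_code as) (M, xs)"
  using assms
proof (induction as arbitrary: V)
  case Nil
  have "cost (Const 0 0) M \<le> instr_cost V" by (rule cost_le) simp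
  then show ?case by simp
next
  case (Cons a as)
  let ?e = "key_bits \<beta> (length as)"
  define x where "x = M a"
  define y where "y = list_code (map M as)"
  define s where "s = x * x + y"
  have a: "2 \<le> a" "\<bar>x\<bar> \<le> 2 ^ \<beta>" using Cons.prems by (auto simp: x_def)
  have V: "2 * ?e + 4 \<le> V" using Cons.prems by simp
  then have "?e \<le> V" by simp
  then obtain M' where M': "straight_run (key_code as) (M, xs) = (M', xs)" "M' 0 = y"
    "\<And>b. b \<ge> 2 \<Longrightarrow> M' b = M b" "y \<le> 2 ^ ?e" "costs_le (instr_cost V) (key_code as) (M, xs)"
    using Cons.IH[of V] Cons.prems(1) unfolding y_def by auto
  have M'a: "M' a = x" "a \<noteq> 0" "a \<noteq> Suc 0" using M'(3)[OF a(1)] a(1) by (auto simp: x_def)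
  define E :: int where "E = 2 ^ ?e"
  have E1: "1 \<le> E" by (simp add: E_def)
  have E: "1 \<le> E" "E \<le> E * E" "y \<le> E"
    using M'(4) E1 mult_left_mono[of 1 E E] by (simp_all add: E_def[symmetric])
  have "x * x = \<bar>x\<bar> * \<bar>x\<bar>" by simp
  also have "\<bar>x\<bar> * \<bar>x\<bar> \<le> 2 ^ \<beta> * 2 ^ \<beta>" using a(2) by (intro mult_mono) auto
  also have "\<dots> = (2::int) ^ (2 * \<beta>)" by (simp add: mult_2 power_add)
  also have "\<dots> \<le> E" unfolding E_def using twice_le_key_bits[of \<beta> "length as"] by (intro power_increasing) auto
  finally have xx: "x * x \<le> E" .
  have y0: "0 \<le> y" by (simp add: y_def list_code_nonneg)
  have s: "0 \<le> s" "s \<le> 2 * E" "\<bar>x\<bar> \<le> s"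
    using xx y0 E abs_le_square[of x] by (auto simp: s_def)
  have "s * s \<le> (2 * E) * (2 * E)" using s E by (intro mult_mono) auto
  then have ss: "s * s \<le> 4 * (E * E)" "0 \<le> s * s" by simp_all
  have "(2::int) ^ (2 * ?e + 4) = 2 ^ ?e * 2 ^ ?e * 2 ^ 4" by (simp only: power_add mult_2)
  then have E16: "(2::int) ^ (2 * ?e + 4) = 16 * (E * E)" by (simp add: E_def)
  have "(2::int) ^ (2 * ?e + 4) \<le> 2 ^ V" using V by (intro power_increasing) auto
  then have EV: "16 * (E * E) \<le> 2 ^ V" unfolding E16 .
  let ?is = "[Mult 1 a a, Add 1 1 0, Mult 0 1 1, Add 0 0 1, Add 0 0 a, Const 1 1, Add 0 0 1]"
  let ?M = "M'(1 := 1, 0 := s * s + s + x + 1)"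
  have run: "straight_run ?is (M', xs) = (?M, xs)"
    using M'a M'(2) by (auto simp: s_def fun_eq_iff)
  have le: "\<bar>x\<bar> \<le> 2 ^ V" "x * x \<le> 2 ^ V" "y \<le> 2 ^ V" "s \<le> 2 ^ V" "s * s \<le> 2 ^ V"
    "s * s + s \<le> 2 ^ V" "\<bar>s * s + s + x\<bar> \<le> 2 ^ V" "(1::int) \<le> 2 ^ V"
    using s ss E EV xx by linarith+
  have costs: "costs_le (instr_cost V) ?is (M', xs)"
    unfolding costs_le.simps
    by (intro conjI cost_le) (auto simp: M'a M'(2) s_def[symmetric] le s(1) ss(2) y0 abs_mult_self_eq)
  have code: "list_code (map M (a # as)) = s * s + s + x + 1"
    by (simp add: Let_def s_def x_def y_def)
  have "s * s + s + x + 1 \<le> 2 ^ (2 * ?e + 4)"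
    unfolding E16 using s ss E by linarith
  then have le_key_bits: "list_code (map M (a # as)) \<le> 2 ^ key_bits \<beta> (length (a # as))"
    unfolding code by simp
  have "?M 0 = list_code (map M (a # as))" unfolding code by simp
  moreover have "\<forall>b\<ge>2. ?M b = M b" using M'(3) by simp
  moreover have "straight_run (key_code (a # as)) (M, xs) = (?M, xs)"
    unfolding key_code.simps straight_run_append M'(1) by (rule run)
  moreover have "costs_le (instr_cost V) (key_code (a # as)) (M, xs)"
    unfolding key_code.simps costs_le_append M'(1) using M'(5) costs by blast
  ultimately show ?case using le_key_bits by blast
qed

text \<open>
  Keys consist of the name of a subtable and at most three further integers; the summand \<open>5\<close> pays for the
  step from a code to the corresponding odd address.
\<close>

definition address_bits :: "nat \<Rightarrow> nat" where
  "address_bits \<beta> = key_bits \<beta> 4 + 5"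

lemma addr_code_run:
  assumes "\<And>a. a \<in> set as \<Longrightarrow> 3 \<le> a \<and> \<bar>M a\<bar> \<le> 2 ^ \<beta>" "length as \<le> 3" "int q \<le> 2 ^ \<beta>"
  shows "\<exists>M'. straight_run (addr_code q as) (M, xs) = (M', xs) \<and>
    M' 0 = int (tab_addr (int q # map M as)) \<and> M' 0 \<le> 2 ^ address_bits \<beta> \<and>
    (\<forall>a\<ge>3. M' a = M a) \<and>
    costs_le (instr_cost (address_bits \<beta>)) (addr_code q as) (M, xs)"
proof -
  let ?V = "address_bits \<beta>" and ?M = "M(2 := int q)" and ?as = "2 # as"
  let ?y = "list_code (int q # map M as)"
  have map: "map ?M ?as = int q # map M as" using assms(1) by fastforce
  have prem: "2 \<le> a \<and> \<bar>?M a\<bar> \<le> 2 ^ \<beta>" if "a \<in> set ?as" for a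
    using that assms(1,3) by (cases "a = 2") (auto dest: assms(1))
  have kb: "key_bits \<beta> (length ?as) \<le> key_bits \<beta> 4" using assms(2) by (intro key_bits_mono) simp
  then have V: "key_bits \<beta> (length ?as) \<le> ?V" by (simp add: address_bits_def)
  obtain M' where M': "straight_run (key_code ?as) (?M, xs) = (M', xs)" "M' 0 = ?y"
    "\<And>a. a \<ge> 2 \<Longrightarrow> M' a = ?M a" "?y \<le> 2 ^ key_bits \<beta> (length ?as)"
    "costs_le (instr_cost ?V) (key_code ?as) (?M, xs)"
    using key_code_run[of ?as ?M \<beta> ?V xs, OF prem V] unfolding map by blast
  have y0: "0 \<le> ?y" by (rule list_code_nonneg)
  have y: "?y \<le> 2 ^ key_bits \<beta> 4"
    using M'(4) power_increasing[OF kb, of "2::int"] by linarith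
  have pV: "(2::int) ^ ?V = 32 * 2 ^ key_bits \<beta> 4" by (simp add: address_bits_def power_add)
  have p1: "(1::int) \<le> 2 ^ key_bits \<beta> 4" by simp
  have le: "2 * ?y + 9 \<le> 2 ^ ?V" "2 * ?y \<le> 2 ^ ?V" "?y \<le> 2 ^ ?V" "(9::int) \<le> 2 ^ ?V"
    using y y0 p1 unfolding pV by linarith+
  have "\<beta> \<le> ?V" using twice_le_key_bits[of \<beta> 4] by (simp add: address_bits_def)
  then have "(2::int) ^ \<beta> \<le> 2 ^ ?V" by (intro power_increasing) auto
  then have "int q \<le> 2 ^ ?V" using assms(3) by (rule order_trans[rotated])
  then have c2: "cost (Const 2 (int q)) M \<le> instr_cost ?V" by (intro cost_le) simp
  have c1: "straight_run [Const 2 (int q)] (M, xs) = (?M, xs)" by simp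
  let ?is = "[Add 0 0 0, Const 1 9, Add 0 0 1]" and ?M2 = "M'(1 := 9, 0 := 2 * ?y + 9)"
  have c3: "costs_le (instr_cost ?V) ?is (M', xs)"
    unfolding costs_le.simps
    by (intro conjI cost_le) (auto simp: M'(2) le y0 simp del: list_code.simps)
  have run: "straight_run ?is (M', xs) = (?M2, xs)"
    using M'(2) by (auto simp: fun_eq_iff simp del: list_code.simps)
  have "?M2 0 = int (tab_addr (int q # map M as))"
    using y0 by (simp add: tab_addr_def del: list_code.simps)
  moreover have "?M2 0 \<le> 2 ^ ?V" using le by (simp del: list_code.simps)
  moreover have "?M2 a = M a" if "a \<ge> 3" for a using that M'(3) by simp
  moreover have "straight_run (addr_code q as) (M, xs) = (?M2, xs)"
    unfolding addr_code_def straight_run_append c1 M'(1) run ..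
  moreover have "costs_le (instr_cost ?V) (addr_code q as) (M, xs)"
    unfolding addr_code_def costs_le_append c1 M'(1)
    using c2 c3 M'(5) by simp
  ultimately show ?thesis by (intro exI[of _ ?M2]) blast
qed

definition represents :: "(nat \<Rightarrow> int) \<Rightarrow> 'v::countable state \<Rightarrow> bool" where
  "represents M s \<longleftrightarrow> (\<forall>v. M (var_addr v) = vars s v) \<and> (\<forall>xs. M (tab_addr xs) = tab s xs)"

lemma represents_cong:
  fixes s :: "'v::countable state"
  shows "represents M s \<Longrightarrow> (\<And>a. a \<ge> 3 \<Longrightarrow> M' a = M a) \<Longrightarrow> represents M' s"
proof -
  have "3 \<le> var_addr v" "3 \<le> tab_addr xs" for v :: 'v and xs
    using addr_ge(1)[of v] addr_ge(2)[of xs] by linarith+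
  then show "represents M s \<Longrightarrow> (\<And>a. a \<ge> 3 \<Longrightarrow> M' a = M a) \<Longrightarrow> represents M' s"
    by (simp add: represents_def)
qed


text \<open>
  Independently of the contents of the cells used for address computations, \<open>n\<close> machine steps of average
  cost at most \<open>\<kappa>\<close> lead from a representation of \<open>s\<close> to one of \<open>s'\<close>.
\<close>

definition sim :: "nat \<Rightarrow> program \<Rightarrow> nat \<Rightarrow> nat \<Rightarrow> 'v::countable state \<Rightarrow> nat \<Rightarrow> 'v state \<Rightarrow> bool" where
  "sim \<kappa> P n p s p' s' \<longleftrightarrow> (\<forall>M \<tau>. represents M s \<longrightarrow> (\<exists>M' \<tau>'. represents M' s' \<and> \<tau>' \<le> \<tau> + n * \<kappa> \<and>
     reaches P n (running p M (inp s) \<tau>) (running p' M' (inp s') \<tau>')))"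

lemma sim_refl: "sim \<kappa> P 0 p s p s"
  unfolding sim_def using reaches_0 by fastforce

lemma sim_trans:
  assumes "sim \<kappa> P m p s p' s'" "sim \<kappa> P n p' s' p'' s''"
  shows "sim \<kappa> P (m + n) p s p'' s''"
  unfolding sim_def
proof (intro allI impI)
  fix M \<tau> assume "represents M s"
  then obtain M1 \<tau>1 where 1: "represents M1 s'" "\<tau>1 \<le> \<tau> + m * \<kappa>"
    "reaches P m (running p M (inp s) \<tau>) (running p' M1 (inp s') \<tau>1)"
    using assms(1) unfolding sim_def by blast
  then obtain M2 \<tau>2 where 2: "represents M2 s''" "\<tau>2 \<le> \<tau>1 + n * \<kappa>"
    "reaches P n (running p' M1 (inp s') \<tau>1) (running p'' M2 (inp s'') \<tau>2)"
    using assms(2) unfolding sim_def by blast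
  have "\<tau>2 \<le> \<tau> + (m + n) * \<kappa>" using 1(2) 2(2) by (simp add: algebra_simps)
  then show "\<exists>M' \<tau>'. represents M' s'' \<and> \<tau>' \<le> \<tau> + (m + n) * \<kappa> \<and>
      reaches P (m + n) (running p M (inp s) \<tau>) (running p'' M' (inp s'') \<tau>')"
    using 2(1) reaches_trans[OF 1(3) 2(3)] by blast
qed

lemma sim_straight:
  assumes "code_at P p is"
    and "\<And>M. represents M s \<Longrightarrow> \<exists>M'. straight_run is (M, inp s) = (M', inp s') \<and> represents M' s' \<and> costs_le \<kappa> is (M, inp s)"
  shows "sim \<kappa> P (length is) p s (p + length is) s'"
  unfolding sim_def
proof (intro allI impI)
  fix M \<tau> assume "represents M s"
  then obtain M' where *: "straight_run is (M, inp s) = (M', inp s')" "represents M' s'" "costs_le \<kappa> is (M, inp s)"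
    using assms(2) by blast
  show "\<exists>M' \<tau>'. represents M' s' \<and> \<tau>' \<le> \<tau> + length is * \<kappa> \<and> reaches P (length is)
      (running p M (inp s) \<tau>) (running (p + length is) M' (inp s') \<tau>')"
    using straight_reaches[OF assms(1) *(3,1), of \<tau>] *(2) by blast
qed

lemma sim_jump:
  assumes "\<And>M \<tau>. represents M s \<Longrightarrow> \<exists>\<tau>'\<le>\<tau> + \<kappa>. step P (running p M (inp s) \<tau>) = return_pmf (running p' M (inp s) \<tau>')"
  shows "sim \<kappa> P 1 p s p' s"
  unfolding sim_def
proof (intro allI impI)
  fix M \<tau> assume M: "represents M s"
  then obtain \<tau>' where "\<tau>' \<le> \<tau> + \<kappa>" "step P (running p M (inp s) \<tau>) = return_pmf (running p' M (inp s) \<tau>')"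
    using assms by blast
  then show "\<exists>M' \<tau>'. represents M' s \<and> \<tau>' \<le> \<tau> + 1 * \<kappa> \<and>
      reaches P 1 (running p M (inp s) \<tau>) (running p' M' (inp s) \<tau>')"
    using M reaches_step by (intro exI[of _ M] exI[of _ \<tau>']) simp
qed

lemma prim_sim:
  fixes q :: "'v::countable prim"
  assumes ok: "prim_ok (2 ^ \<beta>) q s" and bd: "values_le (2 ^ \<beta>) s" and code: "code_at P p (prim_code q)"
  shows "sim (instr_cost (address_bits \<beta>)) P (length (prim_code q)) p s (p + length (prim_code q))
    (prim_effect q s)"
proof (rule sim_straight[OF code])
  fix M assume M: "represents M s"
  let ?V = "address_bits \<beta>"
  let ?\<kappa> = "instr_cost ?V"
  have "\<beta> \<le> ?V" using twice_le_key_bits[of \<beta> 4] by (simp add: address_bits_def)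
  then have V: "(2::int) ^ \<beta> \<le> 2 ^ ?V" by (intro power_increasing) auto
  have v: "M (var_addr u) = vars s u" "\<bar>vars s u\<bar> \<le> 2 ^ \<beta>" "\<bar>vars s u\<bar> \<le> 2 ^ ?V" for u
    using M bd order_trans[OF _ V] by (auto simp: represents_def values_le_def)
  have t: "M (tab_addr k) = tab s k" "\<bar>tab s k\<bar> \<le> 2 ^ ?V" for k
    using M bd order_trans[OF _ V] by (auto simp: represents_def values_le_def)
  have addr: "\<exists>M'. straight_run (addr_code n (map var_addr us)) (M, inp s) = (M', inp s) \<and>
      M' 0 = int (tab_addr (key s n us)) \<and> M' 0 \<le> 2 ^ ?V \<and> (\<forall>a\<ge>3. M' a = M a) \<and>
      costs_le ?\<kappa> (addr_code n (map var_addr us)) (M, inp s)"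
    if "int n \<le> 2 ^ \<beta>" "length us \<le> 3" for n us
  proof -
    have "3 \<le> a \<and> \<bar>M a\<bar> \<le> 2 ^ \<beta>" if "a \<in> set (map var_addr us)" for a
      using that v(1,2) order_trans[OF _ addr_ge(1), of 3] by auto
    from addr_code_run[where xs = "inp s" and as = "map var_addr us", OF this _ that(1)] that(2)
    show ?thesis by (simp add: key_def v(1) comp_def)
  qed
  show "\<exists>M'. straight_run (prim_code q) (M, inp s) = (M', inp (prim_effect q s)) \<and>
      represents M' (prim_effect q s) \<and> costs_le ?\<kappa> (prim_code q) (M, inp s)"
  proof (cases q)
    case (Lit u k)
    have "cost (Const (var_addr u) k) M \<le> ?\<kappa>"
      using ok order_trans[OF _ V] Lit by (intro cost_le) auto
    then show ?thesis using M Lit by (simp add: represents_def)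
  next
    case (Copy u a)
    have ge: "var_addr w \<noteq> 0" "tab_addr k \<noteq> 0" for w :: 'v and k
      using addr_ge(1)[of w] addr_ge(2)[of k] by auto
    have "cost (Const 0 0) M \<le> ?\<kappa>"
      by (rule cost_le) simp
    moreover have "cost (Add (var_addr u) (var_addr a) 0) (M(0 := 0)) \<le> ?\<kappa>"
      using v by (intro cost_le) (auto simp: ge)
    ultimately show ?thesis using M Copy by (simp add: represents_def ge)
  next
    case (AddV u a b)
    have "cost (Add (var_addr u) (var_addr a) (var_addr b)) M \<le> ?\<kappa>"
      using v by (intro cost_le) auto
    then show ?thesis using M AddV by (simp add: represents_def)
  next
    case (SubV u a b)
    have "cost (Sub (var_addr u) (var_addr a) (var_addr b)) M \<le> ?\<kappa>"
      using v by (intro cost_le) auto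
    then show ?thesis using M SubV by (simp add: represents_def)
  next
    case (MulV u a b)
    have "cost (Mult (var_addr u) (var_addr a) (var_addr b)) M \<le> ?\<kappa>"
      using v by (intro cost_le) auto
    then show ?thesis using M MulV by (simp add: represents_def)
  next
    case (Get u n us)
    then obtain M' where M': "straight_run (addr_code n (map var_addr us)) (M, inp s) = (M', inp s)"
      "M' 0 = int (tab_addr (key s n us))" "M' 0 \<le> 2 ^ ?V" "\<And>a. a \<ge> 3 \<Longrightarrow> M' a = M a"
      "costs_le ?\<kappa> (addr_code n (map var_addr us)) (M, inp s)"
      using addr[of n us] ok by auto
    have represents: "represents M' s" by (rule represents_cong[OF M M'(4)])
    then have "cost (Load (var_addr u) 0) M' \<le> ?\<kappa>"
      using M'(2,3) t by (intro cost_le) (auto simp: represents_def)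
    then show ?thesis
      using represents Get M' by (simp add: represents_def)
  next
    case (Put n us u)
    then obtain M' where M': "straight_run (addr_code n (map var_addr us)) (M, inp s) = (M', inp s)"
      "M' 0 = int (tab_addr (key s n us))" "M' 0 \<le> 2 ^ ?V" "\<And>a. a \<ge> 3 \<Longrightarrow> M' a = M a"
      "costs_le ?\<kappa> (addr_code n (map var_addr us)) (M, inp s)"
      using addr[of n us] ok by auto
    have represents: "represents M' s" by (rule represents_cong[OF M M'(4)])
    then have "cost (Store 0 (var_addr u)) M' \<le> ?\<kappa>"
      using M'(2,3) v by (intro cost_le) (auto simp: represents_def)
    then show ?thesis
      using represents Put M' by (simp add: represents_def)
  next
    case (NextBit u)
    have "cost (Read (var_addr u)) M \<le> ?\<kappa>" by (rule cost_le) simp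
    then show ?thesis using M NextBit by (cases "inp s") (simp_all add: represents_def)
  qed
qed

lemma var_le_address_bits:
  assumes "values_le (2 ^ \<beta>) s"
  shows "\<bar>vars s v\<bar> \<le> 2 ^ address_bits \<beta>"
proof -
  have "\<beta> \<le> address_bits \<beta>" using twice_le_key_bits[of \<beta> 4] by (simp add: address_bits_def)
  then have "(2::int) ^ \<beta> \<le> 2 ^ address_bits \<beta>" by (intro power_increasing) auto
  moreover have "\<bar>vars s v\<bar> \<le> 2 ^ \<beta>" using assms by (simp add: values_le_def)
  ultimately show ?thesis by linarith
qed

lemma sim_Jump:
  assumes "p < length P" "P ! p = Jump q"
  shows "sim (instr_cost V) P 1 p s q s"
proof (rule sim_jump)
  fix M \<tau>
  have "cost (Jump q) M \<le> instr_cost V" by (rule cost_le) simp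
  then show "\<exists>\<tau>'\<le>\<tau> + instr_cost V. step P (running p M (inp s) \<tau>) = return_pmf (running q M (inp s) \<tau>')"
    using assms by (intro exI[of _ "\<tau> + cost (P ! p) M"]) (simp add: step_def)
qed

lemma sim_JumpZero:
  assumes "values_le (2 ^ \<beta>) s" "p < length P" "P ! p = JumpZero (var_addr v) q"
  shows "sim (instr_cost (address_bits \<beta>)) P 1 p s (if vars s v = 0 then q else Suc p) s"
proof (rule sim_jump)
  fix M \<tau> assume M: "represents M s"
  have "cost (JumpZero (var_addr v) q) M \<le> instr_cost (address_bits \<beta>)"
    by (rule cost_le) (use M var_le_address_bits[OF assms(1), of v] in \<open>auto simp: represents_def\<close>)
  then show "\<exists>\<tau>'\<le>\<tau> + instr_cost (address_bits \<beta>). step P (running p M (inp s) \<tau>)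
      = return_pmf (running (if vars s v = 0 then q else Suc p) M (inp s) \<tau>')"
    using M assms(2,3) by (intro exI[of _ "\<tau> + cost (P ! p) M"]) (simp add: step_def represents_def)
qed

lemma sim_JumpPos:
  assumes "values_le (2 ^ \<beta>) s" "p < length P" "P ! p = JumpPos (var_addr v) q"
  shows "sim (instr_cost (address_bits \<beta>)) P 1 p s (if vars s v > 0 then q else Suc p) s"
proof (rule sim_jump)
  fix M \<tau> assume M: "represents M s"
  have "cost (JumpPos (var_addr v) q) M \<le> instr_cost (address_bits \<beta>)"
    by (rule cost_le) (use M var_le_address_bits[OF assms(1), of v] in \<open>auto simp: represents_def\<close>)
  then show "\<exists>\<tau>'\<le>\<tau> + instr_cost (address_bits \<beta>). step P (running p M (inp s) \<tau>)
      = return_pmf (running (if vars s v > 0 then q else Suc p) M (inp s) \<tau>')"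
    using M assms(2,3) by (intro exI[of _ "\<tau> + cost (P ! p) M"]) (simp add: step_def represents_def)
qed

lemma exec_sim:
  assumes "exec (2 ^ \<beta>) c s n s'" "values_le (2 ^ \<beta>) s" "code_at P p (com_code p c)"
  shows "values_le (2 ^ \<beta>) s' \<and> sim (instr_cost (address_bits \<beta>)) P n p s (p + com_size c) s'"
  using assms
proof (induction arbitrary: p rule: exec.induct)
  case (Skip s)
  then show ?case by (simp add: sim_refl)
next
  case (Prim q s)
  then show ?case
    using prim_sim[OF Prim.hyps Prim.prems(1), of P p] values_le_prim_effect[of "2 ^ \<beta>" s q] by simp
next
  case (Seq c1 s m s' c2 n s'')
  have at: "code_at P p (com_code p c1)" "code_at P (p + com_size c1) (com_code (p + com_size c1) c2)"
    using code_at_append Seq.prems(2) by fastforce+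
  show ?case
    using Seq.IH(1)[OF Seq.prems(1) at(1)] Seq.IH(2)[OF _ at(2)] sim_trans
    by (fastforce simp: add.assoc)
next
  case (IfZero s v c1 n s' c2)
  let ?\<kappa> = "instr_cost (address_bits \<beta>)"
  let ?q = "p + 2 + com_size c2"
  note at = code_at_Cons[OF IfZero.prems(2)[unfolded com_code.simps]]
  have "code_at P ?q (com_code ?q c1)"
    using code_at_append[OF at(3)] code_at_Cons(3)[of P "Suc p + com_size c2"] by fastforce
  then have IH: "values_le (2 ^ \<beta>) s'" "sim ?\<kappa> P n ?q s (?q + com_size c1) s'"
    using IfZero.IH[OF IfZero.prems(1), of ?q] by blast+
  have "sim ?\<kappa> P 1 p s ?q s"
    using sim_JumpZero[OF IfZero.prems(1) at(1,2)] IfZero.hyps by simp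
  from sim_trans[OF this IH(2)] show ?case using IH(1) by (simp add: ac_simps)
next
  case (IfNonzero s v c2 n s' c1)
  let ?\<kappa> = "instr_cost (address_bits \<beta>)"
  let ?q = "p + 1 + com_size c2"
  let ?r = "p + 2 + com_size c2 + com_size c1"
  note at = code_at_Cons[OF IfNonzero.prems(2)[unfolded com_code.simps]]
  have at2: "code_at P (p + 1) (com_code (p + 1) c2)" "code_at P ?q (Jump ?r # com_code (p + 2 + com_size c2) c1)"
    using code_at_append[OF at(3)] by simp_all
  have IH: "values_le (2 ^ \<beta>) s'" "sim ?\<kappa> P n (p + 1) s ?q s'"
    using IfNonzero.IH[OF IfNonzero.prems(1) at2(1)] by auto
  have 1: "sim ?\<kappa> P 1 p s (p + 1) s"
    using sim_JumpZero[OF IfNonzero.prems(1) at(1,2)] IfNonzero.hyps by simp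
  have 2: "sim ?\<kappa> P 1 ?q s' ?r s'"
    by (rule sim_Jump[OF code_at_Cons(1,2)[OF at2(2)]])
  from sim_trans[OF 1 sim_trans[OF IH(2) 2]] show ?case using IH(1) by (simp add: ac_simps)
next
  case (WhileDone s v c)
  let ?\<kappa> = "instr_cost (address_bits \<beta>)"
  note at = code_at_Cons[OF WhileDone.prems(2)[unfolded com_code.simps]]
  have 1: "sim ?\<kappa> P 1 p s (Suc p) s"
    using sim_JumpPos[OF WhileDone.prems(1) at(1,2)] WhileDone.hyps by simp
  have 2: "sim ?\<kappa> P 1 (Suc p) s (p + 3 + com_size c) s"
    by (rule sim_Jump[OF code_at_Cons(1,2)[OF at(3)]])
  from sim_trans[OF 1 2] show ?case using WhileDone.prems(1) by (simp add: ac_simps numeral_2_eq_2)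
next
  case (WhileStep s v c m s' n s'')
  let ?\<kappa> = "instr_cost (address_bits \<beta>)"
  let ?q = "p + 2 + com_size c"
  note at = code_at_Cons[OF WhileStep.prems(2)[unfolded com_code.simps]]
  have at2: "code_at P (p + 2) (com_code (p + 2) c)" "code_at P ?q [Jump p]"
    using code_at_append[OF code_at_Cons(3)[OF at(3)]] by simp_all
  have IH1: "values_le (2 ^ \<beta>) s'" "sim ?\<kappa> P m (p + 2) s ?q s'"
    using WhileStep.IH(1)[OF WhileStep.prems(1) at2(1)] by auto
  have IH2: "values_le (2 ^ \<beta>) s''" "sim ?\<kappa> P n p s' (p + com_size (WhilePos v c)) s''"
    using WhileStep.IH(2)[OF IH1(1) WhileStep.prems(2)] by auto
  have 1: "sim ?\<kappa> P 1 p s (p + 2) s"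
    using sim_JumpPos[OF WhileStep.prems(1) at(1,2)] WhileStep.hyps by simp
  have 2: "sim ?\<kappa> P 1 ?q s' p s'"
    by (rule sim_Jump[OF code_at_Cons(1,2)[OF at2(2)]])
  from sim_trans[OF 1 sim_trans[OF IH1(2) sim_trans[OF 2 IH2(2)]]] show ?case using IH2(1) by simp
qed

text \<open>
  The answer is Yes if the variable \<open>v\<close> is \<open>0\<close> at the end.
\<close>

definition machine_program :: "'v::countable com \<Rightarrow> 'v \<Rightarrow> program" where
  "machine_program c v = com_code 0 c @ [JumpZero (var_addr v) (com_size c + 2), Halt False, Halt True]"

definition initial :: "bool list \<Rightarrow> 'v state" where
  "initial xs = \<lparr>vars = (\<lambda>_. 0), tab = (\<lambda>_. 0), inp = xs\<rparr>"

lemma reaches_halted: "answer s \<noteq> None \<Longrightarrow> reaches P n s s"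
proof (induction n)
  case (Suc n)
  have "reaches P (Suc 0) s s" using Suc.prems by (intro reaches_step) (simp add: step_def)
  from reaches_trans[OF this Suc.IH[OF Suc.prems]] show ?case by simp
qed (rule reaches_0)

lemma instr_cost_pos: "0 < instr_cost V"
  using le_mult_cost[of "V + 2"] by (simp add: instr_cost_def)

text \<open>
  Distributions disappear at this point: a terminating execution of a structured program determines the
  result of the machine after any sufficient number \<open>T\<close> of steps. The two additional steps are the
  final test and \<open>Halt\<close>.
\<close>

lemma machine_program_run:
  fixes c :: "'v::countable com"
  assumes ex: "exec (2 ^ \<beta>) c (initial xs) n s'"
    and T: "(n + 2) * instr_cost (address_bits \<beta>) \<le> T"
  shows "\<exists>s. run (machine_program c v) T xs = return_pmf s \<and> answer s = Some (vars s' v = 0) \<and> time s \<le> T"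
proof -
  let ?P = "machine_program c v" and ?\<kappa> = "instr_cost (address_bits \<beta>)" and ?p = "com_size c"
  have bd: "values_le (2 ^ \<beta>) (initial xs :: 'v state)" by (simp add: values_le_def initial_def)
  have at: "code_at ?P 0 (com_code 0 c)"
    unfolding code_at_def machine_program_def 
    by (intro exI[of _ "[]"] exI[of _ "[JumpZero (var_addr v) (com_size c + 2), Halt False, Halt True]"]) simp
  have ex': "values_le (2 ^ \<beta>) s'" "sim ?\<kappa> ?P n 0 (initial xs) ?p s'"
    using exec_sim[OF ex bd at] by auto
  have "represents (\<lambda>_. 0) (initial xs :: 'v state)" by (simp add: represents_def initial_def)
  from ex'(2)[unfolded sim_def, rule_format, OF this, of 0] obtain M \<tau> where M: "represents M s'" "\<tau> \<le> n * ?\<kappa>"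
    "reaches ?P n (running 0 (\<lambda>_. 0) xs 0) (running ?p M (inp s') \<tau>)"
    by (auto simp: initial_def)
  let ?q = "if vars s' v = 0 then ?p + 2 else ?p + 1"
  let ?\<tau> = "\<tau> + cost (JumpZero (var_addr v) (?p + 2)) M"
  let ?s = "(running ?q M (inp s') (?\<tau> + 1))\<lparr>pc := ?q + 1, answer := Some (vars s' v = 0)\<rparr>"
  have P: "?P ! ?p = JumpZero (var_addr v) (?p + 2)" "?P ! (?p + 1) = Halt False" "?P ! (?p + 2) = Halt True"
    "length ?P = ?p + 3"
    by (simp_all add: machine_program_def nth_append)
  have 1: "reaches ?P (Suc 0) (running ?p M (inp s') \<tau>) (running ?q M (inp s') ?\<tau>)"
    using M(1) P by (intro reaches_step) (simp add: step_def represents_def)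
  have 2: "reaches ?P (Suc 0) (running ?q M (inp s') ?\<tau>) ?s"
    using P by (intro reaches_step) (simp add: step_def)
  have 3: "reaches ?P (n + (Suc 0 + Suc 0)) (start xs) ?s"
    using reaches_trans[OF M(3) reaches_trans[OF 1 2]] by (simp add: start_def)
  have "cost (JumpZero (var_addr v) (?p + 2)) M \<le> ?\<kappa>"
    by (rule cost_le) (use M(1) var_le_address_bits[OF ex'(1), of v] in \<open>auto simp: represents_def\<close>)
  moreover have "(n + 2) * ?\<kappa> = n * ?\<kappa> + ?\<kappa> + ?\<kappa>" by simp
  ultimately have time: "time ?s \<le> T" using M(2) T instr_cost_pos[of "address_bits \<beta>"] by simp
  have "(n + 2) * 1 \<le> (n + 2) * ?\<kappa>"
    using instr_cost_pos[of "address_bits \<beta>"] by (intro mult_le_mono2) simp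
  then have "n + 2 \<le> T" using T by simp
  then have k: "T = n + (Suc 0 + Suc 0) + (T - (n + 2))" by simp
  have "reaches ?P T (start xs) ?s"
    by (subst k, rule reaches_trans[OF 3 reaches_halted]) simp
  then show ?thesis using time unfolding run_def reaches_def by (intro exI[of _ ?s]) simp
qed

subsection \<open>Reasoning about structured programs\<close>

text \<open>
  Weakest preconditions make the effect of loop-free programs computable by rewriting. Loops are
  treated by \<open>terminates_WhilePos\<close>.
\<close>

fun wp :: "int \<Rightarrow> 'v com \<Rightarrow> ('v state \<Rightarrow> bool) \<Rightarrow> 'v state \<Rightarrow> bool" where
  "wp X Skip Q s = Q s"
| "wp X (Prim p) Q s = (prim_ok X p s \<and> Q (prim_effect p s))"
| "wp X (c1 ;; c2) Q s = wp X c1 (wp X c2 Q) s"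
| "wp X (IfZero v c1 c2) Q s = (if vars s v = 0 then wp X c1 Q s else wp X c2 Q s)"
| "wp X (WhilePos v c) Q s = False"

lemma wp_mono: "wp X c Q s \<Longrightarrow> (\<And>s. Q s \<Longrightarrow> Q' s) \<Longrightarrow> wp X c Q' s"
  by (induction c arbitrary: Q Q' s) (auto split: if_splits)

definition terminates :: "int \<Rightarrow> 'v::countable com \<Rightarrow> 'v state \<Rightarrow> nat \<Rightarrow> ('v state \<Rightarrow> bool) \<Rightarrow> bool" where
  "terminates X c s n Q \<longleftrightarrow> (\<exists>m\<le>n. \<exists>s'. exec X c s m s' \<and> Q s')"

lemma terminates_Seq:
  assumes "terminates X c1 s m R" "\<And>s'. R s' \<Longrightarrow> terminates X c2 s' n Q"
  shows "terminates X (c1 ;; c2) s (m + n) Q"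
  using assms unfolding terminates_def by (meson Seq add_mono)

lemma terminates_mono: "terminates X c s m R \<Longrightarrow> (\<And>s'. R s' \<Longrightarrow> Q s') \<Longrightarrow> m \<le> n \<Longrightarrow> terminates X c s n Q"
  unfolding terminates_def by (meson order_trans)

lemma terminates_wp: "wp X c Q s \<Longrightarrow> terminates X c s (com_size c) Q"
proof (induction c arbitrary: s Q)
  case (Prim p)
  then show ?case using exec.Prim[of X p s] by (auto simp: terminates_def)
next
  case (Seq c1 c2)
  then show ?case using terminates_Seq[of X c1 s "com_size c1" "wp X c2 Q" c2 "com_size c2" Q] by simp
next
  case (IfZero v c1 c2)
  show ?case
  proof (cases "vars s v = 0")
    case True
    then obtain m s' where "m \<le> com_size c1" "exec X c1 s m s'" "Q s'"
      using IfZero.IH(1)[of Q s] IfZero.prems by (auto simp: terminates_def)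
    then show ?thesis
      unfolding terminates_def using exec.IfZero[of s v X c1 m s' c2] True
      by (intro exI[of _ "1 + m"] conjI exI[of _ s']) auto
  next
    case False
    then obtain m s' where "m \<le> com_size c2" "exec X c2 s m s'" "Q s'"
      using IfZero.IH(2)[of Q s] IfZero.prems by (auto simp: terminates_def)
    then show ?thesis
      unfolding terminates_def using exec.IfNonzero[of s v X c2 m s' c1] False
      by (intro exI[of _ "1 + (m + 1)"] conjI exI[of _ s']) auto
  qed
qed (auto simp: terminates_def intro: exec.Skip)

text \<open>
  The invariant \<open>I\<close> is indexed by an upper bound for the number of remaining rounds.
\<close>

lemma terminates_WhilePos:
  assumes "I k s"
    and stop: "\<And>k s. I k s \<Longrightarrow> vars s v \<le> 0 \<Longrightarrow> Q s"
    and step: "\<And>k s. I k s \<Longrightarrow> vars s v > 0 \<Longrightarrow> \<exists>j. k = Suc j \<and> terminates X c s n (I j)"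
  shows "terminates X (WhilePos v c) s (k * (n + 2) + 2) Q"
  using assms(1)
proof (induction k arbitrary: s)
  case 0
  then have "vars s v \<le> 0" using step[of 0 s] by fastforce
  then show ?case
    using stop[OF 0] exec.WhileDone[of s v X c] unfolding terminates_def
    by (intro exI[of _ 2] conjI exI[of _ s]) auto
next
  case (Suc k)
  show ?case
  proof (cases "vars s v > 0")
    case True
    then obtain m s' where m: "m \<le> n" "exec X c s m s'" "I k s'"
      using step[OF Suc.prems] by (auto simp: terminates_def)
    then obtain l s'' where l: "l \<le> k * (n + 2) + 2" "exec X (WhilePos v c) s' l s''" "Q s''"
      using Suc.IH[of s'] by (auto simp: terminates_def)
    show ?thesis
      unfolding terminates_def using m(1) l exec.WhileStep[OF True m(2) l(2)]
      by (intro exI[of _ "1 + (m + (1 + l))"] conjI exI[of _ s'']) auto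
  next
    case False
    then show ?thesis
      using stop[OF Suc.prems] exec.WhileDone[of s v X c] unfolding terminates_def
      by (intro exI[of _ 2] conjI exI[of _ s]) auto
  qed
qed

section \<open>The program for the word problem\<close>

text \<open>
  \<open>OldL\<close> and \<open>NewL\<close> are the labels, at the level treated last, of the prefix before and after the
  current letter \<open>(Gen, Sgn)\<close>. The subtables are: \<open>[0, k, j]\<close>, the flow of level \<open>k\<close> through edge \<open>j\<close>;
  \<open>[1, k, j]\<close>, the name of node \<open>j\<close> in the tree of level \<open>k\<close>; \<open>[2, x, l, r]\<close>, the name of the triple
  \<open>(x, l, r)\<close>; \<open>[3, a, i]\<close>, the number of the edge with label \<open>x\<^sub>i\<close> at the vertex named \<open>a\<close>; and \<open>[4, j]\<close>,
  the number \<open>j div 2\<close>, because the machine cannot divide. Names and edge numbers are shared by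
  all levels. Positive numbers are given out in order, so that \<open>0\<close> means undefined.
\<close>

datatype var = Bit | More | One | Gen | Sgn | OldL | NewL | Vtx | Lev | Edge | Node | Kid
  | FlowV | LeftV | RightV | Name | Test | EdgeCount | NameCount

instance var :: countable by countable_datatype

text \<open>
  Renews the name of a node from its flow and the names of its children, and moves on to its parent.
  The triple \<open>(0, 0, 0)\<close> keeps the name \<open>0\<close>: the infinitely many nodes that have never been touched are
  then named correctly by the initial contents of the memory. As names are nonnegative, this triple is
  recognized by \<open>x\<^sup>2 + l + r = 0\<close>.
\<close>

definition rename_node :: "var com" where
  "rename_node =
     Prim (Get FlowV 0 [Lev, Node]) ;;
     Prim (AddV Kid Node Node) ;; Prim (Get LeftV 1 [Lev, Kid]) ;;
     Prim (AddV Kid Kid One) ;; Prim (Get RightV 1 [Lev, Kid]) ;;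
     Prim (Get Name 2 [FlowV, LeftV, RightV]) ;;
     IfZero Name
       (Prim (MulV Test FlowV FlowV) ;; Prim (AddV Test Test LeftV) ;; Prim (AddV Test Test RightV) ;;
        IfZero Test Skip
          (Prim (AddV NameCount NameCount One) ;; Prim (Copy Name NameCount) ;;
           Prim (Put 2 [FlowV, LeftV, RightV] Name)))
       Skip ;;
     Prim (Put 1 [Lev, Node] Name) ;; Prim (Get Node 4 [Node])"

text \<open>
  When a new edge \<open>j\<close> is created, the halves of \<open>2 j\<close> and \<open>2 j + 1\<close> are recorded, so that all halves up to
  twice the number of edges are always available.
\<close>

definition find_edge :: "var com" where
  "find_edge =
     Prim (Get Edge 3 [Vtx, Gen]) ;;
     IfZero Edge
       (Prim (AddV EdgeCount EdgeCount One) ;; Prim (Copy Edge EdgeCount) ;;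
        Prim (Put 3 [Vtx, Gen] Edge) ;;
        Prim (AddV Kid Edge Edge) ;; Prim (Put 4 [Kid] Edge) ;;
        Prim (AddV Kid Kid One) ;; Prim (Put 4 [Kid] Edge))
       Skip"

definition traverse_edge :: "nat \<Rightarrow> var com" where
  "traverse_edge k =
     Prim (Lit Lev (int k)) ;; Prim (Copy Vtx NewL) ;; Prim (SubV Test Sgn One) ;;
     IfZero Test (Prim (Copy Vtx OldL)) Skip ;;
     find_edge ;;
     Prim (Get FlowV 0 [Lev, Edge]) ;; Prim (AddV FlowV FlowV Sgn) ;; Prim (Put 0 [Lev, Edge] FlowV) ;;
     Prim (Get OldL 1 [Lev, One]) ;; Prim (Copy Node Edge)"

definition level :: "nat \<Rightarrow> var com" where
  "level k = traverse_edge k ;; WhilePos Node rename_node ;; Prim (Get NewL 1 [Lev, One])"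

section \<open>Naming flows by hash consing\<close>

type_synonym table = "int list \<Rightarrow> int"

text \<open>
  The numbers \<open>ec\<close> of edges and \<open>nc\<close> of names given out so far bound the entries of the
  tables, and different keys have different nonzero entries.
\<close>

definition tables_ok :: "table \<Rightarrow> int \<Rightarrow> int \<Rightarrow> bool" where
  "tables_ok T ec nc \<longleftrightarrow> 0 \<le> ec \<and> 0 \<le> nc \<and>
     (\<forall>a i. 0 \<le> T [3, a, i] \<and> T [3, a, i] \<le> ec) \<and>
     (\<forall>a i b j. T [3, a, i] = T [3, b, j] \<longrightarrow> T [3, a, i] \<noteq> 0 \<longrightarrow> a = b \<and> i = j) \<and>
     (\<forall>j. 1 \<le> j \<longrightarrow> j \<le> 2 * ec + 1 \<longrightarrow> T [4, j] = j div 2) \<and>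
     (\<forall>x l r. 0 \<le> T [2, x, l, r] \<and> T [2, x, l, r] \<le> nc) \<and>
     (\<forall>x l r x' l' r'. T [2, x, l, r] = T [2, x', l', r'] \<longrightarrow> T [2, x, l, r] \<noteq> 0 \<longrightarrow>
        x = x' \<and> l = l' \<and> r = r') \<and>
     T [2, 0, 0, 0] = 0"

lemma tables_okD:
  assumes "tables_ok T ec nc"
  shows "0 \<le> ec" "0 \<le> nc" "0 \<le> T [3, a, i]" "T [3, a, i] \<le> ec"
    "T [3, a, i] = T [3, b, j] \<Longrightarrow> T [3, a, i] \<noteq> 0 \<Longrightarrow> a = b \<and> i = j"
    "1 \<le> j \<Longrightarrow> j \<le> 2 * ec + 1 \<Longrightarrow> T [4, j] = j div 2"
    "0 \<le> T [2, x, l, r]" "T [2, x, l, r] \<le> nc"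
    "T [2, x, l, r] = T [2, x', l', r'] \<Longrightarrow> T [2, x, l, r] \<noteq> 0 \<Longrightarrow> x = x' \<and> l = l' \<and> r = r'"
    "T [2, 0, 0, 0] = 0"
  using assms unfolding tables_ok_def by blast+

lemma tables_okI:
  assumes "0 \<le> ec" "0 \<le> nc" "\<And>a i. 0 \<le> T [3, a, i] \<and> T [3, a, i] \<le> ec"
    "\<And>a i b j. T [3, a, i] = T [3, b, j] \<Longrightarrow> T [3, a, i] \<noteq> 0 \<Longrightarrow> a = b \<and> i = j"
    "\<And>j. 1 \<le> j \<Longrightarrow> j \<le> 2 * ec + 1 \<Longrightarrow> T [4, j] = j div 2"
    "\<And>x l r. 0 \<le> T [2, x, l, r] \<and> T [2, x, l, r] \<le> nc"
    "\<And>x l r x' l' r'. T [2, x, l, r] = T [2, x', l', r'] \<Longrightarrow> T [2, x, l, r] \<noteq> 0 \<Longrightarrow>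
      x = x' \<and> l = l' \<and> r = r'"
    "T [2, 0, 0, 0] = 0"
  shows "tables_ok T ec nc"
  using assms unfolding tables_ok_def by blast

text \<open>
  \<open>m\<close> is the correct name for the triple \<open>(x, l, r)\<close>; the entry \<open>0\<close> counts as a name for the zero triple only.
\<close>

definition node_ok :: "table \<Rightarrow> int \<Rightarrow> int \<Rightarrow> int \<Rightarrow> int \<Rightarrow> bool" where
  "node_ok T m x l r \<longleftrightarrow> m = T [2, x, l, r] \<and> (m = 0 \<longrightarrow> x = 0 \<and> l = 0 \<and> r = 0)"

text \<open>
  \<open>a\<close> assigns correct names to all nodes of the heap-ordered binary tree that carries \<open>\<phi>\<close>. That names
  vanish far from the root expresses that the support is finite.
\<close>

definition tree :: "table \<Rightarrow> (int \<Rightarrow> int) \<Rightarrow> (int \<Rightarrow> int) \<Rightarrow> bool" where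
  "tree T \<phi> a \<longleftrightarrow> (\<forall>j\<ge>1. node_ok T (a j) (\<phi> j) (a (2 * j)) (a (2 * j + 1))) \<and> (\<exists>b. \<forall>j>b. a j = 0)"

definition named :: "table \<Rightarrow> (int \<Rightarrow> int) \<Rightarrow> int \<Rightarrow> bool" where
  "named T \<phi> m \<longleftrightarrow> (\<exists>a. tree T \<phi> a \<and> a 1 = m)"

lemma int_half_induct [consumes 1, case_names half]:
  fixes j :: int
  assumes "1 \<le> j" "\<And>j. 1 \<le> j \<Longrightarrow> (\<And>i. 1 \<le> i \<Longrightarrow> i < j \<Longrightarrow> P i) \<Longrightarrow> P j"
  shows "P j"
  using assms(1)
proof (induction "nat j" arbitrary: j rule: less_induct)
  case less
  show ?case by (rule assms(2)[OF less.prems]) (rule less.hyps, auto)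
qed

text \<open>
  From the root downwards: equal names come from equal triples.
\<close>

lemma tree_inject:
  assumes ok: "tables_ok T ec nc" and t: "tree T \<phi> a" "tree T \<phi>' a'" and root: "a 1 = a' 1" and j: "1 \<le> j"
  shows "a j = a' j \<and> \<phi> j = \<phi>' j"
proof -
  have inj: "x = x' \<and> l = l' \<and> r = r'" if "node_ok T m x l r" "node_ok T m x' l' r'" for m x l r x' l' r'
    using ok that unfolding tables_ok_def node_ok_def by metis
  have n: "node_ok T (a j) (\<phi> j) (a (2 * j)) (a (2 * j + 1))"
    "node_ok T (a' j) (\<phi>' j) (a' (2 * j)) (a' (2 * j + 1))" if "1 \<le> j" for j
    using t that by (auto simp: tree_def)
  have "a j = a' j" using j
  proof (induction j rule: int_half_induct)
    case (half j)
    show ?case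
    proof (cases "j = 1")
      case False
      then have i: "1 \<le> j div 2" "j div 2 < j" using half(1) by auto
      have "a (j div 2) = a' (j div 2)" using half(2)[OF i] .
      then have "a (2 * (j div 2)) = a' (2 * (j div 2)) \<and> a (2 * (j div 2) + 1) = a' (2 * (j div 2) + 1)"
        using inj n[OF i(1)] by metis
      moreover have "j = 2 * (j div 2) \<or> j = 2 * (j div 2) + 1" by presburger
      ultimately show ?thesis by metis
    qed (use root in simp)
  qed
  then show ?thesis using inj[of "a j"] n[OF j] by metis
qed

lemma treeD: "tree T \<phi> a \<Longrightarrow> 1 \<le> j \<Longrightarrow> a j = T [2, \<phi> j, a (2 * j), a (2 * j + 1)]"
  unfolding tree_def node_ok_def by blast

text \<open>
  From the leaves upwards: equal triples get equal names, and far from the root both names are \<open>0\<close>.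
\<close>

lemma tree_cong:
  assumes t: "tree T \<phi> a" "tree T \<phi>' a'" and eq: "\<And>j. 1 \<le> j \<Longrightarrow> \<phi> j = \<phi>' j" and j: "1 \<le> j"
  shows "a j = a' j"
proof -
  obtain b where b: "\<And>j. b < j \<Longrightarrow> a j = 0" "\<And>j. b < j \<Longrightarrow> a' j = 0"
  proof -
    obtain b1 b2 where "\<forall>j>b1. a j = 0" "\<forall>j>b2. a' j = 0" using t by (auto simp: tree_def)
    then show thesis by (intro that[of "max b1 b2"]) auto
  qed
  show ?thesis using j
  proof (induction "nat (b + 1 - j)" arbitrary: j rule: less_induct)
    case less
    show ?case
    proof (cases "b < j")
      case False
      have "a (2 * j) = a' (2 * j)" "a (2 * j + 1) = a' (2 * j + 1)"
        using less.prems False by (intro less.hyps; auto)+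
      then show ?thesis
        unfolding treeD[OF t(1) less.prems] treeD[OF t(2) less.prems] eq[OF less.prems] by simp
    qed (use b in simp)
  qed
qed

text \<open>
  The name of the root is a faithful label of the flow. Both names may have been computed at different
  times, as long as the tables have only been extended in between (\<open>named_extends\<close>).
\<close>

lemma named_inject:
  assumes "tables_ok T ec nc" "named T \<phi> m" "named T \<phi>' m'"
  shows "m = m' \<longleftrightarrow> (\<forall>j\<ge>1. \<phi> j = \<phi>' j)"
proof -
  obtain a a' where t: "tree T \<phi> a" "tree T \<phi>' a'" and root: "a 1 = m" "a' 1 = m'"
    using assms(2,3) unfolding named_def by blast
  show ?thesis
  proof
    assume "m = m'"
    then have "a 1 = a' 1" using root by simp
    then show "\<forall>j\<ge>1. \<phi> j = \<phi>' j" using tree_inject[OF assms(1) t] by blast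
  next
    assume "\<forall>j\<ge>1. \<phi> j = \<phi>' j"
    then have "a 1 = a' 1" by (intro tree_cong[OF t]) simp_all
    then show "m = m'" using root by simp
  qed
qed

definition extends :: "table \<Rightarrow> table \<Rightarrow> bool" where
  "extends T T' \<longleftrightarrow> T' [2, 0, 0, 0] = 0 \<and> (\<forall>x l r. T [2, x, l, r] \<noteq> 0 \<longrightarrow> T' [2, x, l, r] = T [2, x, l, r])"

lemma node_ok_extends: "node_ok T m x l r \<Longrightarrow> extends T T' \<Longrightarrow> node_ok T' m x l r"
  unfolding node_ok_def extends_def by metis

lemma tree_extends: "tree T \<phi> a \<Longrightarrow> extends T T' \<Longrightarrow> tree T' \<phi> a"
  unfolding tree_def using node_ok_extends by blast

lemma named_extends: "named T \<phi> m \<Longrightarrow> extends T T' \<Longrightarrow> named T' \<phi> m"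
  unfolding named_def using tree_extends by blast

definition level_node_ok :: "table \<Rightarrow> int \<Rightarrow> int \<Rightarrow> bool" where
  "level_node_ok T k j \<longleftrightarrow> node_ok T (T [1, k, j]) (T [0, k, j]) (T [1, k, 2 * j]) (T [1, k, 2 * j + 1])"

text \<open>
  A node beyond the edge count \<open>ec\<close> has no used edges below it, hence the name \<open>0\<close>.
\<close>

definition level_bounded :: "table \<Rightarrow> int \<Rightarrow> int \<Rightarrow> int \<Rightarrow> int \<Rightarrow> bool" where
  "level_bounded T ec nc q k \<longleftrightarrow> (\<forall>j. 0 \<le> T [1, k, j] \<and> T [1, k, j] \<le> nc \<and> \<bar>T [0, k, j]\<bar> \<le> q \<and>
     (ec < j \<longrightarrow> T [1, k, j] = 0))"

subsection \<open>Restoring the names on a path to the root\<close>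

text \<open>
  The tables differ at most in the node names of level \<open>k\<close> and in new entries for triples.
\<close>

definition renamed :: "int \<Rightarrow> table \<Rightarrow> table \<Rightarrow> bool" where
  "renamed k T T' \<longleftrightarrow> (\<forall>k' j. T' [0, k', j] = T [0, k', j]) \<and> (\<forall>k' j. k' \<noteq> k \<longrightarrow> T' [1, k', j] = T [1, k', j]) \<and>
     (\<forall>a i. T' [3, a, i] = T [3, a, i]) \<and> (\<forall>j. T' [4, j] = T [4, j]) \<and> extends T T'"

lemma renamed_trans: "renamed k T T' \<Longrightarrow> renamed k T' T'' \<Longrightarrow> renamed k T T''"
  by (simp add: renamed_def extends_def)

definition ancestors :: "int \<Rightarrow> int set" where
  "ancestors v = {v div 2 ^ i | i. True}"

lemma self_in_ancestors: "v \<in> ancestors v"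
  unfolding ancestors_def by (rule CollectI, rule exI[of _ 0]) simp

lemma ancestors_half: "ancestors v = insert v (ancestors (v div 2))"
proof -
  have Suc: "v div 2 ^ Suc i = v div 2 div 2 ^ i" for i by (simp add: zdiv_zmult2_eq)
  have "j \<in> insert v (ancestors (v div 2))" if "j = v div 2 ^ i" for i j
    using that Suc unfolding ancestors_def by (cases i) auto
  moreover have "v div 2 div 2 ^ i \<in> ancestors v" for i
    unfolding ancestors_def Suc[symmetric] by blast
  ultimately show ?thesis
    using self_in_ancestors[of v] by (auto simp: ancestors_def)
qed

lemma ancestors_0: "ancestors 0 = {0}"
  by (auto simp: ancestors_def)

text \<open>
  The effect of \<open>rename_node\<close> on the tables and on the number of names.
\<close>

definition new_name :: "table \<Rightarrow> int \<Rightarrow> int \<Rightarrow> int \<Rightarrow> table \<times> int" where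
  "new_name T k v nc =
    (let x = T [0, k, v]; l = T [1, k, 2 * v]; r = T [1, k, 2 * v + 1] in
     if T [2, x, l, r] = 0 \<and> (x \<noteq> 0 \<or> l \<noteq> 0 \<or> r \<noteq> 0)
     then (T([2, x, l, r] := nc + 1, [1, k, v] := nc + 1), nc + 1)
     else (T([1, k, v] := T [2, x, l, r]), nc))"

text \<open>
  The name of a node occurs only in the triple of its parent. So if all nodes outside the path from \<open>v\<close>
  to the root are correct, then after the renewal of \<open>v\<close> all nodes outside the path from the parent of
  \<open>v\<close> are correct.
\<close>

lemma new_name:
  assumes ok: "tables_ok T ec nc" and lb: "level_bounded T ec nc q k" and v: "1 \<le> v" "v \<le> ec"
    and nodes: "\<And>j. 1 \<le> j \<Longrightarrow> j \<notin> ancestors v \<Longrightarrow> level_node_ok T k j"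
    and T': "new_name T k v nc = (T', nc')"
  shows "tables_ok T' ec nc'" "level_bounded T' ec nc' q k" "nc' \<le> nc + 1" "renamed k T T'" "nc \<le> nc'"
    "\<And>j. 1 \<le> j \<Longrightarrow> j \<notin> ancestors (v div 2) \<Longrightarrow> level_node_ok T' k j"
proof -
  define x l r where "x = T [0, k, v]" "l = T [1, k, 2 * v]" "r = T [1, k, 2 * v + 1]"
  note xlr = x_l_r_def
  have range2: "0 \<le> T [2, x, l, r]" "T [2, x, l, r] \<le> nc" for x l r
    using ok unfolding tables_ok_def by blast+
  consider (fresh) "T [2, x, l, r] = 0" "x \<noteq> 0 \<or> l \<noteq> 0 \<or> r \<noteq> 0"
      "T' = T([2, x, l, r] := nc + 1, [1, k, v] := nc + 1)" "nc' = nc + 1"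
    | (old) "T [2, x, l, r] \<noteq> 0 \<or> (x = 0 \<and> l = 0 \<and> r = 0)"
      "T' = T([1, k, v] := T [2, x, l, r])" "nc' = nc"
  proof (cases "T [2, x, l, r] = 0 \<and> (x \<noteq> 0 \<or> l \<noteq> 0 \<or> r \<noteq> 0)")
    case True
    then have "(T', nc') = (T([2, x, l, r] := nc + 1, [1, k, v] := nc + 1), nc + 1)"
      using T' unfolding new_name_def Let_def xlr[symmetric] by (simp only: if_True simp_thms)
    then show thesis using True fresh by blast
  next
    case False
    then have "(T', nc') = (T([1, k, v] := T [2, x, l, r]), nc)"
      using T' unfolding new_name_def Let_def xlr[symmetric] by (simp only: if_False simp_thms)
    then show thesis using False old by blast
  qed
  note cases = this
  from cases show "nc' \<le> nc + 1" by cases auto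
  from cases show ok': "tables_ok T' ec nc'"
  proof cases
    case fresh
    have ne: "T [2, x', l', r'] \<noteq> nc + 1" for x' l' r' using range2(2)[of x' l' r'] by linarith
    have T2: "T' [2, x', l', r'] = (if x' = x \<and> l' = l \<and> r' = r then nc + 1 else T [2, x', l', r'])"
      for x' l' r' by (simp add: fresh)
    have T34: "T' [3, a, i] = T [3, a, i]" "T' [4, j] = T [4, j]" for a i j by (simp_all add: fresh)
    have inj: "x' = y \<and> l' = m \<and> r' = n" if "T [2, x', l', r'] = T [2, y, m, n]" "T [2, x', l', r'] \<noteq> 0"
      for x' l' r' y m n using ok that unfolding tables_ok_def by blast
    have inj': "x' = y \<and> l' = m \<and> r' = n" if "T' [2, x', l', r'] = T' [2, y, m, n]" "T' [2, x', l', r'] \<noteq> 0"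
      for x' l' r' y m n
    proof (cases "(x' = x \<and> l' = l \<and> r' = r) \<or> (y = x \<and> m = l \<and> n = r)")
      case True
      then show ?thesis using that(1) ne[of x' l' r'] ne[of y m n] unfolding T2 by (auto split: if_splits)
    next
      case False
      then have "T [2, x', l', r'] = T [2, y, m, n]" "T [2, x', l', r'] \<noteq> 0"
        using that unfolding T2 by (simp_all split: if_splits)
      then show ?thesis by (rule inj)
    qed
    have range2': "0 \<le> T' [2, x', l', r'] \<and> T' [2, x', l', r'] \<le> nc + 1" for x' l' r'
      using range2[of x' l' r'] range2[of x l r] unfolding T2 by simp
    have zero: "T' [2, 0, 0, 0] = 0"
      using tables_okD(10)[OF ok] fresh(2) unfolding T2 by auto
    show ?thesis
      unfolding fresh(4)
    proof (rule tables_okI)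
      show "T' [4, j] = j div 2" if "1 \<le> j" "j \<le> 2 * ec + 1" for j
        using tables_okD(6)[OF ok that] T34 by simp
      show "a = b \<and> i = j" if "T' [3, a, i] = T' [3, b, j]" "T' [3, a, i] \<noteq> 0" for a b i j
        using tables_okD(5)[OF ok that[unfolded T34]] .
      show "0 \<le> ec" "0 \<le> nc + 1" using tables_okD(1,2)[OF ok] by simp_all
      show "0 \<le> T' [3, a, i] \<and> T' [3, a, i] \<le> ec" for a i using tables_okD(3,4)[OF ok] T34 by simp
    qed (fact range2' inj' zero)+
  next
    case old
    then have T': "T' [2, x', l', r'] = T [2, x', l', r']" "T' [3, a, i] = T [3, a, i]" "T' [4, j] = T [4, j]"
      for x' l' r' a i j by simp_all
    show ?thesis using ok unfolding tables_ok_def T' old(3) .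
  qed
  have T'v: "T' [1, k, v] = T' [2, x, l, r]"
    using cases by cases auto
  have T'z: "x = 0 \<and> l = 0 \<and> r = 0" if "T' [1, k, v] = 0"
    using cases that by cases (use tables_okD(2)[OF ok] in auto)
  have T'1: "T' [1, k', j] = T [1, k', j]" if "\<not> (k' = k \<and> j = v)" for k' j
    using cases that by cases auto
  have T'0: "T' [0, k', j] = T [0, k', j]" for k' j
    using cases by cases auto
  have r1: "0 \<le> T' [1, k, v]" "T' [1, k, v] \<le> nc'"
    unfolding T'v using tables_okD(7,8)[OF ok'] by blast+
  show ncle: "nc \<le> nc'" using cases by cases auto
  show "level_bounded T' ec nc' q k"
    unfolding level_bounded_def
  proof (intro allI)
    fix j
    show "0 \<le> T' [1, k, j] \<and> T' [1, k, j] \<le> nc' \<and> \<bar>T' [0, k, j]\<bar> \<le> q \<and> (ec < j \<longrightarrow> T' [1, k, j] = 0)"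
      using lb r1 T'1[of k j] T'0[of k j] ncle v(2) unfolding level_bounded_def
      by (cases "j = v") (auto intro: order_trans)
  qed
  have ext: "extends T T'"
    using cases tables_okD(10)[OF ok'] by cases (auto simp: extends_def)
  show ren: "renamed k T T'"
    using cases ext by cases (auto simp: renamed_def)
  show "level_node_ok T' k j" if j: "1 \<le> j" "j \<notin> ancestors (v div 2)" for j
  proof (cases "j = v")
    case True
    have *: "T' [1, k, 2 * v] = l" "T' [1, k, 2 * v + 1] = r" "T' [0, k, v] = x"
      using T'1 T'0 v(1) by (auto simp: xlr)
    have "node_ok T' (T' [1, k, v]) x l r"
      unfolding node_ok_def using T'v T'z by blast
    then show ?thesis unfolding True level_node_ok_def * .
  next
    case False
    then have "j \<notin> ancestors v" using j ancestors_half[of v] by simp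
    then have "level_node_ok T k j" using nodes j by blast
    \<comment> \<open>otherwise \<open>j\<close> would be the parent of \<open>v\<close>, which lies on the remaining path\<close>
    moreover have "2 * j \<noteq> v" "2 * j + 1 \<noteq> v"
      using j self_in_ancestors[of "v div 2"] by auto
    ultimately show ?thesis
      using node_ok_extends[OF _ ext] T'1 T'0 False by (simp add: level_node_ok_def)
  qed
qed

definition scratch_vars :: "var set" where
  "scratch_vars = {Node, Kid, FlowV, LeftV, RightV, Name, Test, NameCount}"

lemma rename_node_wp:
  assumes "vars s One = 1" and k: "vars s Lev = k" and v: "vars s Node = v" "1 \<le> v" "v \<le> ec"
    and nc: "vars s NameCount = nc" and lb: "level_bounded (tab s) ec nc q k"
    and ok: "tables_ok (tab s) ec nc"
    and X: "2 * ec + 1 \<le> X" "q * q + 2 * nc \<le> X" "nc + 1 \<le> X" "4 \<le> X"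
  shows "wp X rename_node (\<lambda>s'. inp s' = inp s \<and> (\<forall>u. u \<notin> scratch_vars \<longrightarrow> vars s' u = vars s u) \<and>
    new_name (tab s) k v nc = (tab s', vars s' NameCount) \<and> vars s' Node = v div 2) s"
proof -
  define x l r where "x = tab s [0, k, v]" "l = tab s [1, k, 2 * v]" "r = tab s [1, k, 2 * v + 1]"
  note xlr = x_l_r_def
  have b: "0 \<le> l" "l \<le> nc" "0 \<le> r" "r \<le> nc" "\<bar>x\<bar> \<le> q"
    using lb unfolding level_bounded_def xlr by blast+
  have "x * x = \<bar>x\<bar> * \<bar>x\<bar>" by simp
  also have "\<dots> \<le> q * q" using b(5) by (intro mult_mono) auto
  finally have xx: "x * x \<le> q * q" "0 \<le> x * x" by simp_all
  have zero: "x * x + l + r = 0 \<longleftrightarrow> x = 0 \<and> l = 0 \<and> r = 0"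
    using b xx(2) by (auto simp: add_nonneg_eq_0_iff)
  have half: "tab s [4, v] = v div 2" by (rule tables_okD(6)[OF ok v(2)]) (use v in linarith)
  have le: "\<bar>x * x\<bar> \<le> X" "\<bar>x * x + l\<bar> \<le> X" "\<bar>x * x + l + r\<bar> \<le> X" "\<bar>nc + 1\<bar> \<le> X"
    using b xx X tables_okD(2)[OF ok] by linarith+
  have kid: "v + v = 2 * v" by simp
  show ?thesis
    using assms(1) k v nc X le zero half
    by (simp add: rename_node_def key_def kid xlr[symmetric] new_name_def scratch_vars_def)
qed

text \<open>
  Halving a number below \<open>2\<^sup>R\<close> repeatedly gives \<open>0\<close> after \<open>R\<close> rounds, and each round creates at most one
  name. Node \<open>0\<close> is above the root, so at the end all nodes are correct.
\<close>

lemma rename_path: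
  assumes "vars s One = 1" and k: "vars s Lev = k" and v: "0 \<le> vars s Node" "vars s Node \<le> ec" "vars s Node < 2 ^ R"
    and nc: "vars s NameCount = nc" and lb: "level_bounded (tab s) ec nc q k"
    and ok: "tables_ok (tab s) ec nc"
    and nodes: "\<And>j. 1 \<le> j \<Longrightarrow> j \<notin> ancestors (vars s Node) \<Longrightarrow> level_node_ok (tab s) k j"
    and X: "2 * ec + 1 \<le> X" "q * q + 2 * (nc + int R) \<le> X" "nc + int R + 1 \<le> X" "4 \<le> X"
  shows "terminates X (WhilePos Node rename_node) s (R * (com_size rename_node + 2) + 2) (\<lambda>s'.
    inp s' = inp s \<and> (\<forall>u. u \<notin> scratch_vars \<longrightarrow> vars s' u = vars s u) \<and>
    renamed k (tab s) (tab s') \<and> nc \<le> vars s' NameCount \<and> vars s' NameCount \<le> nc + int R \<and>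
    tables_ok (tab s') ec (vars s' NameCount) \<and> level_bounded (tab s') ec (vars s' NameCount) q k \<and>
    (\<forall>j\<ge>1. level_node_ok (tab s') k j))"
proof -
  define I where "I i s' \<longleftrightarrow> i \<le> R \<and> inp s' = inp s \<and> (\<forall>u. u \<notin> scratch_vars \<longrightarrow> vars s' u = vars s u) \<and>
    renamed k (tab s) (tab s') \<and> nc \<le> vars s' NameCount \<and> vars s' NameCount \<le> nc + int R - int i \<and>
    tables_ok (tab s') ec (vars s' NameCount) \<and> level_bounded (tab s') ec (vars s' NameCount) q k \<and>
    0 \<le> vars s' Node \<and> vars s' Node \<le> ec \<and> vars s' Node < 2 ^ i \<and>
    (\<forall>j\<ge>1. j \<notin> ancestors (vars s' Node) \<longrightarrow> level_node_ok (tab s') k j)" for i and s' :: "var state"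
  have "renamed k (tab s) (tab s)"
    using tables_okD(10)[OF ok] by (simp add: renamed_def extends_def)
  then have init: "I R s" using v nc lb ok nodes by (simp add: I_def)
  have stop: "inp s' = inp s \<and> (\<forall>u. u \<notin> scratch_vars \<longrightarrow> vars s' u = vars s u) \<and>
    renamed k (tab s) (tab s') \<and> nc \<le> vars s' NameCount \<and> vars s' NameCount \<le> nc + int R \<and>
    tables_ok (tab s') ec (vars s' NameCount) \<and> level_bounded (tab s') ec (vars s' NameCount) q k \<and>
    (\<forall>j\<ge>1. level_node_ok (tab s') k j)" if "I i s'" "vars s' Node \<le> 0" for i s'
  proof -
    have "vars s' Node = 0" using that by (simp add: I_def)
    then show ?thesis using that(1) by (simp add: I_def ancestors_0)
  qed
  have step: "\<exists>i'. i = Suc i' \<and> terminates X rename_node s' (com_size rename_node) (I i')"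
    if I: "I i s'" and pos: "vars s' Node > 0" for i s'
  proof -
    define v where "v = vars s' Node"
    have v: "1 \<le> v" "v \<le> ec" "v < 2 ^ i" using I pos by (simp_all add: I_def v_def)
    then obtain i' where i': "i = Suc i'" by (cases i) auto
    have unchanged: "vars s' One = 1" "vars s' Lev = k"
      using I assms(1) k by (simp_all add: I_def scratch_vars_def)
    note I' = I[unfolded I_def, folded v_def]
    then have nc_ge: "nc \<le> vars s' NameCount" by blast
    from I' have nc_le: "vars s' NameCount \<le> nc + int R - int i" by blast
    have "wp X rename_node (I i') s'"
    proof -
      have X': "q * q + 2 * vars s' NameCount \<le> X" "vars s' NameCount + 1 \<le> X"
        using order_trans[OF nc_le, of "nc + int R"] X by simp_all
      have "wp X rename_node (\<lambda>s2. inp s2 = inp s' \<and> (\<forall>u. u \<notin> scratch_vars \<longrightarrow> vars s2 u = vars s' u) \<and>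
          new_name (tab s') k v (vars s' NameCount) = (tab s2, vars s2 NameCount) \<and> vars s2 Node = v div 2) s'"
        using I' X' X(1,4) v by (intro rename_node_wp[OF unchanged]) (auto simp: v_def)
      then show ?thesis
      proof (rule wp_mono)
        fix s2 :: "var state"
        assume s2: "inp s2 = inp s' \<and> (\<forall>u. u \<notin> scratch_vars \<longrightarrow> vars s2 u = vars s' u) \<and>
          new_name (tab s') k v (vars s' NameCount) = (tab s2, vars s2 NameCount) \<and> vars s2 Node = v div 2"
        have nn: "new_name (tab s') k v (vars s' NameCount) = (tab s2, vars s2 NameCount)" using s2 by blast
        have nodes': "\<And>j. 1 \<le> j \<Longrightarrow> j \<notin> ancestors v \<Longrightarrow> level_node_ok (tab s') k j" using I' by blast
        have pre: "tables_ok (tab s') ec (vars s' NameCount)" "level_bounded (tab s') ec (vars s' NameCount) q k"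
          using I' by blast+
        note new = new_name[OF pre v(1,2) nodes' nn]
        have "v div 2 < 2 ^ i'" "v div 2 \<le> ec" using v i' by auto
        moreover have "vars s2 NameCount \<le> nc + int R - int i'" using new(3) nc_le i' by linarith
        moreover have "renamed k (tab s) (tab s2)" using I' new(4) renamed_trans by blast
        ultimately show "I i' s2"
          unfolding I_def using s2 I' i' v(1) new(1,2,6) order_trans[OF nc_ge new(5)] by auto
      qed
    qed
    from terminates_wp[OF this] show ?thesis using i' by blast
  qed
  show ?thesis
    by (rule terminates_WhilePos[of I R s, OF init stop step])
qed

subsection \<open>Traversing an edge\<close>

text \<open>
  The effect of \<open>find_edge\<close> on the tables and on the number of edges.
\<close>

definition new_edge :: "table \<Rightarrow> int \<Rightarrow> int \<Rightarrow> int \<Rightarrow> table \<times> int" where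
  "new_edge T a i ec =
    (if T [3, a, i] = 0
     then (T([3, a, i] := ec + 1, [4, 2 * (ec + 1)] := ec + 1, [4, 2 * (ec + 1) + 1] := ec + 1), ec + 1)
     else (T, ec))"

lemma new_edge:
  assumes ok: "tables_ok T ec nc" and T': "new_edge T a i ec = (T', ec')"
  shows "tables_ok T' ec' nc" "1 \<le> T' [3, a, i]" "ec \<le> ec'" "ec' \<le> ec + 1"
    "\<And>b j. T [3, b, j] \<noteq> 0 \<Longrightarrow> T' [3, b, j] = T [3, b, j]"
    "\<And>k j. T' [0, k, j] = T [0, k, j]" "\<And>k j. T' [1, k, j] = T [1, k, j]"
    "\<And>x l r. T' [2, x, l, r] = T [2, x, l, r]"
proof -
  note okD = tables_okD[OF ok]
  have "tables_ok T' ec' nc \<and> 1 \<le> T' [3, a, i] \<and> ec \<le> ec' \<and> ec' \<le> ec + 1 \<and>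
    (\<forall>b j. T [3, b, j] \<noteq> 0 \<longrightarrow> T' [3, b, j] = T [3, b, j]) \<and> (\<forall>k j. T' [0, k, j] = T [0, k, j]) \<and>
    (\<forall>k j. T' [1, k, j] = T [1, k, j]) \<and> (\<forall>x l r. T' [2, x, l, r] = T [2, x, l, r])"
  proof (cases "T [3, a, i] = 0")
    case False
    then have "T' = T" "ec' = ec" using T' by (simp_all add: new_edge_def)
    then show ?thesis using ok False okD(3)[of a i] by simp
  next
    case True
    have "(T', ec') =
        (T([3, a, i] := ec + 1, [4, 2 * (ec + 1)] := ec + 1, [4, 2 * (ec + 1) + 1] := ec + 1), ec + 1)"
      using T' unfolding new_edge_def if_P[OF True] by (rule sym)
    then have eq: "T' = T([3, a, i] := ec + 1, [4, 2 * (ec + 1)] := ec + 1, [4, 2 * (ec + 1) + 1] := ec + 1)"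
      "ec' = ec + 1" by (simp_all only: prod.inject)
    have T3: "T' [3, b, j] = (if b = a \<and> j = i then ec + 1 else T [3, b, j])" for b j
      by (simp add: eq(1))
    have T4: "T' [4, j] = (if j = 2 * (ec + 1) \<or> j = 2 * (ec + 1) + 1 then ec + 1 else T [4, j])" for j
      by (simp add: eq(1))
    have T2: "T' [2, x, l, r] = T [2, x, l, r]" for x l r by (simp add: eq(1))
    have T01: "T' [0, k, j] = T [0, k, j]" "T' [1, k, j] = T [1, k, j]" for k j by (simp_all add: eq(1))
    have ne: "T [3, b, j] \<noteq> ec + 1" for b j using okD(4)[of b j] by linarith
    have "tables_ok T' ec' nc"
      unfolding eq(2)
    proof (rule tables_okI)
      show "0 \<le> ec + 1" "0 \<le> nc" using okD(1,2) by simp_all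
      show "0 \<le> T' [3, b, j] \<and> T' [3, b, j] \<le> ec + 1" for b j
        unfolding T3 using okD(1) okD(3,4)[of b j] by simp
      show "b = c \<and> j = l" if "T' [3, b, j] = T' [3, c, l]" "T' [3, b, j] \<noteq> 0" for b j c l
      proof (cases "(b = a \<and> j = i) \<or> (c = a \<and> l = i)")
        case True
        then show ?thesis using that(1) ne[of b j] ne[of c l] unfolding T3 by (auto split: if_splits)
      next
        case False
        then have "T [3, b, j] = T [3, c, l]" "T [3, b, j] \<noteq> 0"
          using that unfolding T3 by (simp_all split: if_splits)
        then show ?thesis by (rule okD(5))
      qed
      show "T' [4, j] = j div 2" if "1 \<le> j" "j \<le> 2 * (ec + 1) + 1" for j
      proof (cases "j \<le> 2 * ec + 1")
        case True
        then show ?thesis unfolding T4 using okD(6)[OF that(1) True] by simp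
      next
        case False
        then have "j = 2 * (ec + 1) \<or> j = 2 * (ec + 1) + 1" using that by presburger
        then show ?thesis unfolding T4 by auto
      qed
      show "0 \<le> T' [2, x, l, r] \<and> T' [2, x, l, r] \<le> nc" for x l r
        unfolding T2 by (simp add: okD(7,8))
      show "x = x' \<and> l = l' \<and> r = r'" if "T' [2, x, l, r] = T' [2, x', l', r']" "T' [2, x, l, r] \<noteq> 0"
        for x l r x' l' r' using okD(9)[OF that[unfolded T2]] .
      show "T' [2, 0, 0, 0] = 0" unfolding T2 by (rule okD(10))
    qed
    moreover have "T' [3, b, j] = T [3, b, j]" if "T [3, b, j] \<noteq> 0" for b j
      using that True unfolding T3 by auto
    moreover have "1 \<le> T' [3, a, i]" using okD(1) unfolding T3 by simp
    ultimately show ?thesis using T2 T01 eq(2) by simp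
  qed
  then show "tables_ok T' ec' nc" "1 \<le> T' [3, a, i]" "ec \<le> ec'" "ec' \<le> ec + 1"
    "\<And>b j. T [3, b, j] \<noteq> 0 \<Longrightarrow> T' [3, b, j] = T [3, b, j]"
    "\<And>k j. T' [0, k, j] = T [0, k, j]" "\<And>k j. T' [1, k, j] = T [1, k, j]"
    "\<And>x l r. T' [2, x, l, r] = T [2, x, l, r]" by blast+
qed

definition flow_add :: "table \<Rightarrow> int \<Rightarrow> int \<Rightarrow> int \<Rightarrow> table" where
  "flow_add T k e \<sigma> = T([0, k, e] := T [0, k, e] + \<sigma>)"

text \<open>
  Reading \<open>x\<^sub>i\<close> uses the edge that starts at the old vertex and reading \<open>x\<^sub>i\<^sup>-\<^sup>1\<close> the one that
  starts at the new vertex, whence the case distinction for \<open>a\<close>. At the end \<open>OldL\<close> holds the label of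
  level \<open>k\<close> before the flow is changed.
\<close>

lemma traverse_edge_wp:
  assumes s: "vars s One = 1" "vars s Sgn = \<sigma>" "\<sigma> = 1 \<or> \<sigma> = -1" "vars s Gen = g"
      "vars s EdgeCount = ec" "a = (if \<sigma> = 1 then vars s OldL else vars s NewL)"
    and ok: "tables_ok (tab s) ec nc" and fl: "\<And>e. \<bar>tab s [0, int k, e]\<bar> \<le> q"
    and X: "2 * (ec + 1) + 1 \<le> X" "q + 1 \<le> X" "4 \<le> X" "int k \<le> X"
  shows "wp X (traverse_edge k) (\<lambda>s'. inp s' = inp s \<and>
    (\<forall>u. u \<notin> {Lev, Vtx, Test, Edge, EdgeCount, Kid, FlowV, OldL, Node} \<longrightarrow> vars s' u = vars s u) \<and>
    vars s' Lev = int k \<and> vars s' OldL = tab s [1, int k, 1] \<and>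
    (\<exists>T1. new_edge (tab s) a g ec = (T1, vars s' EdgeCount) \<and>
      vars s' Node = T1 [3, a, g] \<and> tab s' = flow_add T1 (int k) (T1 [3, a, g]) \<sigma>)) s"
proof -
  have e0: "0 \<le> ec" using tables_okD(1)[OF ok] .
  have f: "\<bar>tab s [0, int k, e] + 1\<bar> \<le> X" "\<bar>tab s [0, int k, e] - 1\<bar> \<le> X" for e
    using fl[of e] X(2) by linarith+
  have k: "ec + 1 + (ec + 1) = 2 * (ec + 1)" by simp
  have b: "\<bar>ec + 1\<bar> \<le> X" "\<bar>2 * (ec + 1)\<bar> \<le> X" "\<bar>2 * (ec + 1) + 1\<bar> \<le> X"
    using e0 X by auto
  show ?thesis
    using s(3)
  proof
    assume \<sigma>: "\<sigma> = 1"
    show ?thesis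
      using s e0 f b X \<sigma>
      by (cases "tab s [3, a, g] = 0")
        (simp_all add: traverse_edge_def find_edge_def key_def new_edge_def flow_add_def k fun_upd_twist)
  next
    assume \<sigma>: "\<sigma> = -1"
    show ?thesis
      using s e0 f b X \<sigma>
      by (cases "tab s [3, a, g] = 0")
        (simp_all add: traverse_edge_def find_edge_def key_def new_edge_def flow_add_def k fun_upd_twist)
  qed
qed

section \<open>The invariant\<close>

definition edge_id :: "table \<Rightarrow> (nat \<Rightarrow> letter list \<Rightarrow> int) \<Rightarrow> nat \<Rightarrow> letter list \<Rightarrow> nat \<Rightarrow> int" where
  "edge_id T lab k p i = T [3, lab k p, int i]"

text \<open>
  The state of level \<open>k + 1\<close> after the word \<open>u\<close> has been read. The function \<open>lab\<close> records the labels of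
  all prefixes; it does not occur in the memory, which stores the most recent labels only. The names given
  to earlier prefixes are still valid names of their flows in the current tables, so that labels from
  different times can be compared. All edges used by \<open>u\<close> have numbers.
\<close>

definition level_inv ::
    "table \<Rightarrow> int \<Rightarrow> int \<Rightarrow> int \<Rightarrow> (nat \<Rightarrow> letter list \<Rightarrow> int) \<Rightarrow> nat \<Rightarrow> letter list \<Rightarrow> bool" where
  "level_inv T ec nc q lab k u \<longleftrightarrow>
     level_bounded T ec nc q (int (Suc k)) \<and> (\<forall>j\<ge>1. level_node_ok T (int (Suc k)) j) \<and>
     (\<forall>j. T [0, int (Suc k), j] = flow (edge_id T lab k) u j) \<and> T [1, int (Suc k), 1] = lab (Suc k) u \<and>
     (\<forall>v. prefix v u \<longrightarrow> named T (flow (edge_id T lab k) v) (lab (Suc k) v)) \<and>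
     (\<forall>n<length u. nth_edge (edge_id T lab k) u n \<noteq> 0)"

lemma nth_edge_cong:
  assumes "\<And>p i. prefix p u \<Longrightarrow> e p i = e' p i" "n < length u"
  shows "nth_edge e u n = nth_edge e' u n"
proof -
  have "prefix (take n u @ [u ! n]) u"
    using take_is_prefix[of "Suc n" u] assms(2) by (simp add: take_Suc_conv_app_nth)
  then show ?thesis using assms(1) take_is_prefix[of n u] by (simp add: nth_edge_def step_edge_def)
qed

lemma flow_cong_nth_edge:
  assumes "\<And>n. n < length v \<Longrightarrow> nth_edge e v n = nth_edge e' v n"
  shows "flow e v = flow e' v"
  by (rule ext, rule flow_transport) (simp add: assms)

text \<open>
  A level is not affected by what happens at other levels, as shared tables are only extended
  and labels are only added for new prefixes.
\<close>

lemma level_inv_transport: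
  assumes inv: "level_inv T ec nc q lab k u"
    and T': "\<And>j. T' [0, int (Suc k), j] = T [0, int (Suc k), j]"
      "\<And>j. T' [1, int (Suc k), j] = T [1, int (Suc k), j]"
      "extends T T'" "\<And>b j. T [3, b, j] \<noteq> 0 \<Longrightarrow> T' [3, b, j] = T [3, b, j]"
    and le: "ec \<le> ec'" "nc \<le> nc'" "q \<le> q'"
    and lab: "\<And>v. prefix v u \<Longrightarrow> lab' k v = lab k v" "\<And>v. prefix v u \<Longrightarrow> lab' (Suc k) v = lab (Suc k) v"
  shows "level_inv T' ec' nc' q' lab' k u"
proof -
  note inv' = inv[unfolded level_inv_def]
  have edge: "nth_edge (edge_id T' lab' k) u n = nth_edge (edge_id T lab k) u n" if "n < length u" for n
  proof -
    have "nth_edge (edge_id T' lab' k) u n = nth_edge (edge_id T' lab k) u n"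
      by (rule nth_edge_cong[OF _ that]) (simp add: edge_id_def lab)
    also have "\<dots> = nth_edge (edge_id T lab k) u n"
      using inv' that T'(4) by (simp add: nth_edge_def step_edge_def edge_id_def)
    finally show ?thesis .
  qed
  have flow: "flow (edge_id T' lab' k) v = flow (edge_id T lab k) v" if "prefix v u" for v
  proof (rule flow_cong_nth_edge)
    fix n assume n: "n < length v"
    then have "n < length u" using prefix_length_le[OF that] by simp
    then show "nth_edge (edge_id T' lab' k) v n = nth_edge (edge_id T lab k) v n"
      using edge nth_edge_prefix[OF that n] by metis
  qed
  have "level_bounded T' ec' nc' q' (int (Suc k))"
    unfolding level_bounded_def T'(1,2)
  proof (intro allI)
    fix j
    have "0 \<le> T [1, int (Suc k), j] \<and> T [1, int (Suc k), j] \<le> nc \<and> \<bar>T [0, int (Suc k), j]\<bar> \<le> q \<and>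
     (ec < j \<longrightarrow> T [1, int (Suc k), j] = 0)" using inv' unfolding level_bounded_def by blast
    then show "0 \<le> T [1, int (Suc k), j] \<and> T [1, int (Suc k), j] \<le> nc' \<and> \<bar>T [0, int (Suc k), j]\<bar> \<le> q' \<and>
     (ec' < j \<longrightarrow> T [1, int (Suc k), j] = 0)" using le by auto
  qed
  moreover have "level_node_ok T' (int (Suc k)) j" if "1 \<le> j" for j
    using inv' that node_ok_extends[OF _ T'(3)] unfolding level_node_ok_def T'(1,2) by blast
  moreover have "named T' (flow (edge_id T' lab' k) v) (lab' (Suc k) v)" if "prefix v u" for v
    unfolding flow[OF that] lab(2)[OF that] using inv' that named_extends[OF _ T'(3)] by blast
  ultimately show ?thesis
    unfolding level_inv_def T'(1,2) using inv' edge flow[of u] lab(2)[of u] by simp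
qed

text \<open>
  After the flow has been changed at the edge \<open>e\<close> traversed by \<open>x\<close> and all names have been renewed, the root
  carries the name of the flow of \<open>u x\<close>.
\<close>

lemma level_inv_snoc:
  assumes inv: "level_inv T ec nc q lab k u"
    and e: "e = step_edge (edge_id T lab k) u x" "e \<noteq> 0"
    and ren: "renamed (int (Suc k)) (flow_add T (int (Suc k)) e (letter_sign x)) T'"
    and lb: "level_bounded T' ec nc' q' (int (Suc k))"
    and nodes: "\<And>j. 1 \<le> j \<Longrightarrow> level_node_ok T' (int (Suc k)) j"
    and lab': "lab' = lab(Suc k := (lab (Suc k))(u @ [x] := T' [1, int (Suc k), 1]))"
  shows "level_inv T' ec nc' q' lab' k (u @ [x])"
proof -
  note inv' = inv[unfolded level_inv_def]
  have T': "T' [0, int (Suc k), j] = T [0, int (Suc k), j] + (if e = j then letter_sign x else 0)"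
    "T' [3, b, i] = T [3, b, i]" "extends T T'" for b i j
    using ren by (auto simp: renamed_def flow_add_def extends_def)
  have id: "edge_id T' lab' k = edge_id T lab k"
    by (simp add: edge_id_def lab' T'(2) fun_eq_iff)
  have fl: "T' [0, int (Suc k), j] = flow (edge_id T' lab' k) (u @ [x]) j" for j
    unfolding id flow_snoc T'(1) using inv' e(1) by simp
  have "tree T' (flow (edge_id T' lab' k) (u @ [x])) (\<lambda>j. T' [1, int (Suc k), j])"
    unfolding tree_def
  proof
    show "\<forall>j\<ge>1. node_ok T' (T' [1, int (Suc k), j]) (flow (edge_id T' lab' k) (u @ [x]) j)
        (T' [1, int (Suc k), 2 * j]) (T' [1, int (Suc k), 2 * j + 1])"
      using nodes unfolding level_node_ok_def fl by blast
    show "\<exists>b. \<forall>j>b. T' [1, int (Suc k), j] = 0"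
      using lb unfolding level_bounded_def by blast
  qed
  then have "named T' (flow (edge_id T' lab' k) (u @ [x])) (lab' (Suc k) (u @ [x]))"
    unfolding named_def lab' by auto
  moreover have "named T' (flow (edge_id T' lab' k) v) (lab' (Suc k) v)" if "prefix v u" for v
  proof -
    have "v \<noteq> u @ [x]" using prefix_length_le[OF that] by auto
    then have "lab' (Suc k) v = lab (Suc k) v" by (simp add: lab')
    then show ?thesis unfolding id using inv' that named_extends[OF _ T'(3)] by simp
  qed
  moreover have "nth_edge (edge_id T' lab' k) (u @ [x]) n \<noteq> 0" if "n < length (u @ [x])" for n
  proof (cases "n < length u")
    case True
    then show ?thesis unfolding id using inv' by (simp add: nth_edge_append)
  next
    case False
    then have "n = length u" using that by simp
    then show ?thesis unfolding id using e by (simp add: nth_edge_def)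
  qed
  ultimately show ?thesis
    unfolding level_inv_def using lb nodes fl by (simp add: lab')
qed

text \<open>
  \<open>c k\<close> is the word that has been processed by level \<open>k + 1\<close>; while a letter is processed, it differs
  from level to level. \<open>q\<close> counts the edge traversals of all levels together. Each of them creates at most
  one edge and at most \<open>R\<close> names, which bounds all numbers in the memory.
\<close>

definition state_inv ::
    "nat \<Rightarrow> nat \<Rightarrow> nat \<Rightarrow> (nat \<Rightarrow> letter list \<Rightarrow> int) \<Rightarrow> (nat \<Rightarrow> letter list) \<Rightarrow> var state \<Rightarrow> bool" where
  "state_inv d R q lab c s \<longleftrightarrow> vars s One = 1 \<and>
     tables_ok (tab s) (vars s EdgeCount) (vars s NameCount) \<and>
     vars s EdgeCount \<le> int q \<and> vars s NameCount \<le> int q * int R \<and>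
     (\<forall>v. lab 0 v = 0) \<and> (\<forall>k. lab k [] = 0) \<and>
     (\<forall>k<d. level_inv (tab s) (vars s EdgeCount) (vars s NameCount) (int q) lab k (c k))"

text \<open>
  The conditions under which \<open>U\<close> edge traversals are possible with paths of length at most \<open>R\<close> and numbers
  bounded by \<open>X\<close>.
\<close>

definition sufficient :: "nat \<Rightarrow> nat \<Rightarrow> nat \<Rightarrow> int \<Rightarrow> bool" where
  "sufficient d U R X \<longleftrightarrow> U < 2 ^ R \<and> 2 * int U + 4 \<le> X \<and> int U * int U + 2 * (int U * int R) \<le> X \<and>
     int U * int R + 1 \<le> X \<and> int d \<le> X"

definition level_steps :: "nat \<Rightarrow> nat" where
  "level_steps R = com_size (traverse_edge 0) + (R * (com_size rename_node + 2) + 2)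
     + com_size (Prim (Get NewL 1 [Lev, One]))"

lemma com_size_traverse_edge: "com_size (traverse_edge k) = com_size (traverse_edge 0)"
  by (simp add: traverse_edge_def)

text \<open>
  One letter at one level: \<open>lab k u\<close> and \<open>lab k (u x)\<close> are passed on from the level below, and the
  corresponding labels of this level are passed on to the next one.
\<close>

lemma level_terminates:
  assumes inv: "state_inv d R q lab c s" and k: "k < d" "c k = u" "Suc k < d \<Longrightarrow> c (Suc k) = u"
    and s: "vars s OldL = lab k u" "vars s NewL = lab k (u @ [x])" "vars s Gen = int (fst x)"
      "vars s Sgn = letter_sign x"
    and q: "Suc q \<le> U" and X: "sufficient d U R X"
  shows "terminates X (level (Suc k)) s (level_steps R) (\<lambda>s'. inp s' = inp s \<and>
    (\<forall>u\<in>{Gen, Sgn, Bit, More}. vars s' u = vars s u) \<and>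
    (\<exists>lab'. state_inv d R (Suc q) lab' (c(k := u @ [x])) s' \<and>
      vars s' OldL = lab' (Suc k) u \<and> vars s' NewL = lab' (Suc k) (u @ [x])))"
    (is "terminates _ _ _ _ ?Q")
proof -
  define ec nc where "ec = vars s EdgeCount" "nc = vars s NameCount"
  note ecnc = ec_nc_def
  note inv' = inv[unfolded state_inv_def, folded ecnc]
  let ?k = "int (Suc k)"
  define a where "a = (if letter_sign x = 1 then vars s OldL else vars s NewL)"
  have ok: "tables_ok (tab s) ec nc" using inv' by blast
  have ec: "0 \<le> ec" "ec \<le> int q" and nc: "0 \<le> nc" "nc \<le> int q * int R"
    using inv' tables_okD(1,2)[OF ok] by blast+
  have lvl: "level_inv (tab s) ec nc (int q) lab m (c m)" if "m < d" for m using inv' that by blast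
  have fl: "\<bar>tab s [0, ?k, e]\<bar> \<le> int q" for e
    using lvl[OF k(1)] unfolding level_inv_def level_bounded_def by blast
  have X': "U < 2 ^ R" "2 * int U + 4 \<le> X" "int U * int U + 2 * (int U * int R) \<le> X"
    "int U * int R + 1 \<le> X" "int d \<le> X" using X unfolding sufficient_def by blast+
  have qU: "int q + 1 \<le> int U" using q by simp
  have qR: "int q * int R + int R \<le> int U * int R"
    using mult_right_mono[OF qU, of "int R"] by (simp add: algebra_simps)
  let ?traversed = "(\<lambda>s'. inp s' = inp s \<and>
      (\<forall>u. u \<notin> {Lev, Vtx, Test, Edge, EdgeCount, Kid, FlowV, OldL, Node} \<longrightarrow> vars s' u = vars s u) \<and>
      vars s' Lev = ?k \<and> vars s' OldL = tab s [1, ?k, 1] \<and>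
      (\<exists>T1. new_edge (tab s) a (int (fst x)) ec = (T1, vars s' EdgeCount) \<and>
        vars s' Node = T1 [3, a, int (fst x)] \<and>
        tab s' = flow_add T1 ?k (T1 [3, a, int (fst x)]) (letter_sign x)))"
  have step1: "terminates X (traverse_edge (Suc k)) s (com_size (traverse_edge 0))
    ?traversed"
    unfolding com_size_traverse_edge[of "Suc k", symmetric]
    by (rule terminates_wp[OF traverse_edge_wp[OF _ s(4) _ s(3) ecnc(1)[symmetric] a_def ok fl]])
      (use inv' ec qU X' k(1) in \<open>auto simp: letter_sign_def\<close>)
  have step2: "terminates X (WhilePos Node rename_node ;; Prim (Get NewL 1 [Lev, One])) s1
      ((R * (com_size rename_node + 2) + 2) + com_size (Prim (Get NewL 1 [Lev, One])))
      ?Q"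
    if s1: "?traversed s1" for s1
  proof -
    define ec1 where "ec1 = vars s1 EdgeCount"
    obtain T1 where T1: "new_edge (tab s) a (int (fst x)) ec = (T1, ec1)"
      "vars s1 Node = T1 [3, a, int (fst x)]"
      "tab s1 = flow_add T1 ?k (T1 [3, a, int (fst x)]) (letter_sign x)"
      using s1 unfolding ec1_def by blast
    define e where "e = T1 [3, a, int (fst x)]"
    note new = new_edge[OF ok T1(1)]
    have ec1: "ec1 \<le> int q + 1" "ec1 \<le> int U" using new(4) ec qU by linarith+
    have ext: "extends (tab s) T1" using new(8) tables_okD(10)[OF ok] by (simp add: extends_def)
    have lvl1: "level_inv T1 ec1 nc (int q) lab m (c m)" if "m < d" for m
      by (rule level_inv_transport[OF lvl[OF that] new(6,7) ext new(5,3)]) auto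
    have e: "e = step_edge (edge_id T1 lab k) u x"
      using s(1,2) by (auto simp: e_def a_def step_edge_def edge_id_def letter_sign_def)
    have e1: "1 \<le> e" "e \<le> ec1" using new(2) tables_okD(4)[OF new(1)] by (auto simp: e_def)
    have tab1: "tab s1 [2, y, l, r] = T1 [2, y, l, r]" "tab s1 [3, b, i] = T1 [3, b, i]"
      "tab s1 [4, j] = T1 [4, j]" "tab s1 [1, k', j] = T1 [1, k', j]"
      "tab s1 [0, k', j] = T1 [0, k', j] + (if k' = ?k \<and> j = e then letter_sign x else 0)"
      for y l r b i j k' by (simp_all add: T1(3) flow_add_def e_def)
    have ok1: "tables_ok (tab s1) ec1 nc"
      using new(1) unfolding tables_ok_def tab1 .
    note inv1 = lvl1[OF k(1), unfolded level_inv_def k(2)]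
    have lb1: "level_bounded (tab s1) ec1 nc (int q + 1) ?k"
      unfolding level_bounded_def tab1
    proof (intro allI)
      fix j
      have "0 \<le> T1 [1, ?k, j] \<and> T1 [1, ?k, j] \<le> nc \<and> \<bar>T1 [0, ?k, j]\<bar> \<le> int q \<and> (ec1 < j \<longrightarrow> T1 [1, ?k, j] = 0)"
        using inv1 unfolding level_bounded_def by blast
      then show "0 \<le> T1 [1, ?k, j] \<and> T1 [1, ?k, j] \<le> nc \<and>
        \<bar>T1 [0, ?k, j] + (if ?k = ?k \<and> j = e then letter_sign x else 0)\<bar> \<le> int q + 1 \<and>
        (ec1 < j \<longrightarrow> T1 [1, ?k, j] = 0)"
        by (auto simp: letter_sign_def)
    qed
    have nodes1: "level_node_ok (tab s1) ?k j" if "1 \<le> j" "j \<notin> ancestors (vars s1 Node)" for j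
    proof -
      have "j \<noteq> e" using that(2) self_in_ancestors[of e] T1(2) by (auto simp: e_def)
      moreover have "level_node_ok T1 ?k j" using inv1 that(1) by blast
      moreover have "node_ok (tab s1) m y l r = node_ok T1 m y l r" for m y l r
        unfolding node_ok_def tab1 ..
      ultimately show ?thesis unfolding level_node_ok_def tab1 by simp
    qed
    have "int U < 2 ^ R" using X'(1) by (metis of_nat_less_iff of_nat_numeral of_nat_power)
    then have node: "0 \<le> vars s1 Node" "vars s1 Node \<le> ec1" "vars s1 Node < 2 ^ R"
      unfolding T1(2) e_def[symmetric] using e1 ec1 by linarith+
    have qq: "(int q + 1) * (int q + 1) \<le> int U * int U" using qU by (intro mult_mono) auto
    have Xs: "2 * ec1 + 1 \<le> X" "(int q + 1) * (int q + 1) + 2 * (nc + int R) \<le> X" "nc + int R + 1 \<le> X" "4 \<le> X"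
    proof -
      have nc_R: "nc + int R \<le> int U * int R" using nc qR by linarith
      have "(int q + 1) * (int q + 1) + 2 * (nc + int R) \<le> int U * int U + 2 * (int U * int R)"
        by (rule add_mono[OF qq]) (use nc_R in simp)
      then show "(int q + 1) * (int q + 1) + 2 * (nc + int R) \<le> X" using X'(3) by (rule order_trans)
      show "nc + int R + 1 \<le> X" using nc_R X'(4) by linarith
      have "0 \<le> int U" by simp
      then show "4 \<le> X" "2 * ec1 + 1 \<le> X" using X'(2) ec1 by linarith+
    qed
    have sv: "vars s1 One = 1" "vars s1 Lev = ?k" "vars s1 NameCount = nc"
      using s1 inv' by (auto simp: ecnc)
    have post: "wp X (Prim (Get NewL 1 [Lev, One]))
      ?Q s2"
      if s2: "inp s2 = inp s1 \<and> (\<forall>u. u \<notin> scratch_vars \<longrightarrow> vars s2 u = vars s1 u) \<and>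
        renamed ?k (tab s1) (tab s2) \<and> nc \<le> vars s2 NameCount \<and> vars s2 NameCount \<le> nc + int R \<and>
        tables_ok (tab s2) ec1 (vars s2 NameCount) \<and>
        level_bounded (tab s2) ec1 (vars s2 NameCount) (int q + 1) ?k \<and>
        (\<forall>j\<ge>1. level_node_ok (tab s2) ?k j)" for s2
    proof -
      let ?nc = "vars s2 NameCount"
      define lab' where "lab' = lab(Suc k := (lab (Suc k))(u @ [x] := tab s2 [1, ?k, 1]))"
      have v2: "vars s2 One = 1" "vars s2 Lev = ?k" "vars s2 EdgeCount = ec1" "vars s2 OldL = tab s [1, ?k, 1]"
        "\<forall>u\<in>{Gen, Sgn, Bit, More}. vars s2 u = vars s u"
        using s1 s2 sv by (auto simp: scratch_vars_def ec1_def)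
      have ren: "renamed ?k (flow_add T1 ?k e (letter_sign x)) (tab s2)"
        using s2 T1(3) e_def by simp
      have nc2: "nc \<le> ?nc" using s2 by blast
      have new_level: "level_inv (tab s2) ec1 ?nc (int q + 1) lab' k (u @ [x])"
        using s2 e1 by (intro level_inv_snoc[OF lvl1[OF k(1), unfolded k(2)] e _ ren _ _ lab'_def]) auto
      have other: "level_inv (tab s2) ec1 ?nc (int q + 1) lab' m (c m)" if "m < d" "m \<noteq> k" for m
      proof (rule level_inv_transport[OF lvl1[OF that(1)]])
        show "tab s2 [0, int (Suc m), j] = T1 [0, int (Suc m), j]" "tab s2 [1, int (Suc m), j] = T1 [1, int (Suc m), j]" for j
          using ren that(2) by (simp_all add: renamed_def flow_add_def)
        show "extends T1 (tab s2)"
          using ren by (simp add: renamed_def extends_def flow_add_def)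
        show "tab s2 [3, b, j] = T1 [3, b, j]" for b j
          using ren by (simp add: renamed_def flow_add_def)
        show "lab' m v = lab m v" if "prefix v (c m)" for v
        proof (cases "m = Suc k")
          case True
          then have "prefix v u" using that k(3) \<open>m < d\<close> by simp
          then have "v \<noteq> u @ [x]" using prefix_length_le by fastforce
          then show ?thesis by (simp add: lab'_def)
        qed (simp add: lab'_def)
        show "lab' (Suc m) v = lab (Suc m) v" for v using that(2) by (simp add: lab'_def)
      qed (use nc2 in auto)
      have "state_inv d R (Suc q) lab' (c(k := u @ [x])) (s2\<lparr>vars := (vars s2)(NewL := tab s2 [1, ?k, 1])\<rparr>)"
        unfolding state_inv_def
        using v2 s2 ec1 nc qR inv' new_level other
        by (auto simp: lab'_def algebra_simps)
      moreover have "lab' (Suc k) u = tab s [1, ?k, 1]"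
        using lvl[OF k(1)] k(2) by (simp add: level_inv_def lab'_def)
      moreover have "lab' (Suc k) (u @ [x]) = tab s2 [1, ?k, 1]" by (simp add: lab'_def)
      ultimately show ?thesis
        using v2 s1 s2 Xs by (auto simp: key_def)
    qed
    show ?thesis
      by (rule terminates_Seq[OF rename_path[OF sv(1,2) node sv(3) lb1 ok1 nodes1 Xs] terminates_wp[OF post]])
  qed
  have "level_steps R = com_size (traverse_edge 0) + ((R * (com_size rename_node + 2) + 2)
     + com_size (Prim (Get NewL 1 [Lev, One])))" by (simp add: level_steps_def)
  then show ?thesis
    unfolding level_def using terminates_Seq[OF step1 step2] by simp
qed

section \<open>The main loop\<close>

fun levels :: "nat \<Rightarrow> var com" where
  "levels 0 = Skip"
| "levels (Suc k) = levels k ;; level (Suc k)"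

text \<open>
  A decision tree for a code of length \<open>l\<close> whose beginning \<open>ys\<close> is already known. The first unread bit is
  always kept in \<open>Bit\<close>: this makes the end of the input visible before a letter is started.
\<close>

fun decode :: "(bool list \<Rightarrow> letter) \<Rightarrow> nat \<Rightarrow> bool list \<Rightarrow> var com" where
  "decode D 0 ys = Prim (Lit Gen (int (fst (D ys)))) ;; Prim (Lit Sgn (letter_sign (D ys)))"
| "decode D (Suc l) ys = IfZero Bit
     (Prim (NextBit Bit) ;; decode D l (ys @ [False]))
     (Prim (NextBit Bit) ;; decode D l (ys @ [True]))"

definition read_letter :: "(bool list \<Rightarrow> letter) \<Rightarrow> nat \<Rightarrow> nat \<Rightarrow> var com" where
  "read_letter D l d = (decode D l [] ;; Prim (Lit OldL 0) ;; Prim (Lit NewL 0)) ;; levels d ;;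
     Prim (AddV More Bit One)"

definition word_problem :: "(bool list \<Rightarrow> letter) \<Rightarrow> nat \<Rightarrow> nat \<Rightarrow> var com" where
  "word_problem D l d = (Prim (Lit One 1) ;; Prim (NextBit Bit) ;; Prim (AddV More Bit One)) ;;
     WhilePos More (read_letter D l d)"

lemma state_inv_cong:
  assumes "state_inv d R q lab c s" "\<And>k. k < d \<Longrightarrow> c' k = c k" "tab s' = tab s"
    "\<And>v. v \<in> {One, EdgeCount, NameCount} \<Longrightarrow> vars s' v = vars s v"
  shows "state_inv d R q lab c' s'"
  using assms unfolding state_inv_def by simp

lemma levels_terminate:
  assumes inv: "state_inv d R q lab (\<lambda>_. u) s"
    and s: "vars s OldL = 0" "vars s NewL = 0" "vars s Gen = int (fst x)" "vars s Sgn = letter_sign x"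
    and X: "sufficient d U R X"
  shows "k \<le> d \<Longrightarrow> q + k \<le> U \<Longrightarrow> terminates X (levels k) s (k * level_steps R) (\<lambda>s'. inp s' = inp s \<and>
    (\<forall>v\<in>{Gen, Sgn, Bit, More}. vars s' v = vars s v) \<and>
    (\<exists>lab'. state_inv d R (q + k) lab' (\<lambda>m. if m < k then u @ [x] else u) s' \<and>
      vars s' OldL = lab' k u \<and> vars s' NewL = lab' k (u @ [x])))"
proof (induction k)
  case 0
  have "lab 0 v = 0" for v using inv unfolding state_inv_def by blast
  then have "wp X Skip (\<lambda>s'. inp s' = inp s \<and>
    (\<forall>v\<in>{Gen, Sgn, Bit, More}. vars s' v = vars s v) \<and>
    (\<exists>lab'. state_inv d R (q + 0) lab' (\<lambda>m. if m < 0 then u @ [x] else u) s' \<and>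
      vars s' OldL = lab' 0 u \<and> vars s' NewL = lab' 0 (u @ [x]))) s"
    using inv s by auto
  from terminates_wp[OF this] show ?case by simp
next
  case (Suc k)
  let ?Q = "\<lambda>k s'. inp s' = inp s \<and>
    (\<forall>v\<in>{Gen, Sgn, Bit, More}. vars s' v = vars s v) \<and>
    (\<exists>lab'. state_inv d R (q + k) lab' (\<lambda>m. if m < k then u @ [x] else u) s' \<and>
      vars s' OldL = lab' k u \<and> vars s' NewL = lab' k (u @ [x]))"
  have IH: "terminates X (levels k) s (k * level_steps R) (?Q k)"
    using Suc by simp
  have "terminates X (level (Suc k)) s1 (level_steps R) (?Q (Suc k))" if s1: "?Q k s1" for s1
  proof -
    obtain lab1 where lab1: "state_inv d R (q + k) lab1 (\<lambda>m. if m < k then u @ [x] else u) s1"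
      "vars s1 OldL = lab1 k u" "vars s1 NewL = lab1 k (u @ [x])" using s1 by blast
    have g: "vars s1 Gen = int (fst x)" "vars s1 Sgn = letter_sign x" using s1 s by auto
    have c: "(\<lambda>m. if m < k then u @ [x] else u)(k := u @ [x]) = (\<lambda>m. if m < Suc k then u @ [x] else u)"
      by (auto simp: fun_eq_iff)
    have q: "Suc (q + k) \<le> U" and k: "k < d" using Suc.prems by simp_all
    show ?thesis
    proof (rule terminates_mono[OF level_terminates[OF lab1(1) k _ _ lab1(2,3) g q X]])
      show "?Q (Suc k) s'" if "inp s' = inp s1 \<and> (\<forall>u\<in>{Gen, Sgn, Bit, More}. vars s' u = vars s1 u) \<and>
        (\<exists>lab'. state_inv d R (Suc (q + k)) lab' ((\<lambda>m. if m < k then u @ [x] else u)(k := u @ [x])) s' \<and>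
          vars s' OldL = lab' (Suc k) u \<and> vars s' NewL = lab' (Suc k) (u @ [x]))" for s'
        using that s1 unfolding c by auto
    qed simp_all
  qed
  from terminates_Seq[OF IH this] show ?case by (simp add: add.commute)
qed

definition reading :: "var state \<Rightarrow> bool list \<Rightarrow> bool" where
  "reading s ys \<longleftrightarrow> vars s Bit = (case ys of [] \<Rightarrow> -1 | b # _ \<Rightarrow> of_bool b) \<and> inp s = tl ys"

lemma NextBit_reading: "reading (prim_effect (NextBit Bit) s) (inp s)"
  by (cases "inp s") (simp_all add: reading_def)

lemma decode_wp:
  assumes "reading s (ys @ zs)" "length ys = l" "int (fst (D (pre @ ys))) \<le> X" "1 \<le> X"
  shows "wp X (decode D l pre) (\<lambda>s'. reading s' zs \<and> tab s' = tab s \<and>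
    vars s' Gen = int (fst (D (pre @ ys))) \<and> vars s' Sgn = letter_sign (D (pre @ ys)) \<and>
    (\<forall>v. v \<notin> {Bit, Gen, Sgn} \<longrightarrow> vars s' v = vars s v)) s"
  using assms
proof (induction l arbitrary: s ys pre)
  case 0
  then show ?case by (simp add: reading_def letter_sign_def)
next
  case (Suc l)
  then obtain b ys' where ys: "ys = b # ys'" "length ys' = l" by (cases ys) auto
  let ?s = "prim_effect (NextBit Bit) s"
  have "inp s = ys' @ zs" using Suc.prems(1) ys by (simp add: reading_def)
  then have "reading ?s (ys' @ zs)" using NextBit_reading[of s] by simp
  from Suc.IH[OF this ys(2), of "pre @ [b]"] Suc.prems(3,4)
  have IH: "wp X (decode D l (pre @ [b])) (\<lambda>s'. reading s' zs \<and> tab s' = tab ?s \<and>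
    vars s' Gen = int (fst (D (pre @ ys))) \<and> vars s' Sgn = letter_sign (D (pre @ ys)) \<and>
    (\<forall>v. v \<notin> {Bit, Gen, Sgn} \<longrightarrow> vars s' v = vars ?s v)) ?s"
    by (simp add: ys)
  have same: "tab ?s = tab s" "v \<noteq> Bit \<Longrightarrow> vars ?s v = vars s v" for v
    by (cases "inp s"; simp)+
  have "wp X (decode D l (pre @ [b])) (\<lambda>s'. reading s' zs \<and> tab s' = tab s \<and>
    vars s' Gen = int (fst (D (pre @ ys))) \<and> vars s' Sgn = letter_sign (D (pre @ ys)) \<and>
    (\<forall>v. v \<notin> {Bit, Gen, Sgn} \<longrightarrow> vars s' v = vars s v)) ?s"
    by (rule wp_mono[OF IH]) (simp add: same del: prim_effect.simps)
  moreover have "vars s Bit = of_bool b" using Suc.prems(1) ys by (simp add: reading_def)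
  ultimately show ?case by (cases b) (simp_all del: prim_effect.simps)
qed

text \<open>
  The condition \<open>1 \<le> l\<close> ensures that the input is exhausted only at the end of the word.
\<close>

definition decodes :: "(bool list \<Rightarrow> letter) \<Rightarrow> nat \<Rightarrow> (letter \<Rightarrow> bool list) \<Rightarrow> letter set \<Rightarrow> bool" where
  "decodes D l enc A \<longleftrightarrow> 1 \<le> l \<and> (\<forall>x\<in>A. length (enc x) = l \<and> D (enc x) = x)"

definition letter_steps :: "nat \<Rightarrow> nat \<Rightarrow> nat \<Rightarrow> nat" where
  "letter_steps l d R = (com_size (decode (\<lambda>_. (0, True)) l []) + 3) + d * level_steps R"

lemma com_size_decode: "com_size (decode D l pre) = com_size (decode D' l pre')"
proof (induction l arbitrary: pre pre')
  case (Suc l)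
  show ?case
    using Suc[of "pre @ [False]" "pre' @ [False]"] Suc[of "pre @ [True]" "pre' @ [True]"] by simp
qed simp

lemma sufficient_ge: "sufficient d U R X \<Longrightarrow> 4 \<le> X"
proof -
  have "0 \<le> int U" by simp
  then show "sufficient d U R X \<Longrightarrow> 4 \<le> X" unfolding sufficient_def by linarith
qed

lemma read_letter_terminates:
  assumes D: "decodes D l enc A" "x \<in> A" and inv: "state_inv d R (d * length u) lab (\<lambda>_. u) s"
    and rd: "reading s (enc x @ zs)" and X: "sufficient d U R X" "d * length u + d \<le> U"
      "int (fst x) \<le> X"
  shows "terminates X (read_letter D l d) s (letter_steps l d R) (\<lambda>s'.
    reading s' zs \<and> vars s' More = vars s' Bit + 1 \<and>
    (\<exists>lab'. state_inv d R (d * length (u @ [x])) lab' (\<lambda>_. u @ [x]) s' \<and> vars s' NewL = lab' d (u @ [x])))"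
    (is "terminates _ _ _ _ ?Q3")
proof -
  have enc: "length (enc x) = l" "D (enc x) = x" using D by (auto simp: decodes_def)
  have X1: "4 \<le> X" by (rule sufficient_ge[OF X(1)])
  let ?Q1 = "\<lambda>s'. reading s' zs \<and> state_inv d R (d * length u) lab (\<lambda>_. u) s' \<and> vars s' OldL = 0 \<and>
    vars s' NewL = 0 \<and> vars s' Gen = int (fst x) \<and> vars s' Sgn = letter_sign x"
  have "wp X (decode D l []) (\<lambda>s'. reading s' zs \<and> tab s' = tab s \<and>
    vars s' Gen = int (fst x) \<and> vars s' Sgn = letter_sign x \<and>
    (\<forall>v. v \<notin> {Bit, Gen, Sgn} \<longrightarrow> vars s' v = vars s v)) s"
    using decode_wp[OF rd enc(1), of D "[]" X] enc(2) X(3) X1 by simp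
  then have "wp X (decode D l []) (wp X (Prim (Lit OldL 0) ;; Prim (Lit NewL 0)) ?Q1) s"
  proof (rule wp_mono)
    fix s' assume "reading s' zs \<and> tab s' = tab s \<and>
      vars s' Gen = int (fst x) \<and> vars s' Sgn = letter_sign x \<and>
      (\<forall>v. v \<notin> {Bit, Gen, Sgn} \<longrightarrow> vars s' v = vars s v)"
    then show "wp X (Prim (Lit OldL 0) ;; Prim (Lit NewL 0)) ?Q1 s'"
      using X1 by (auto simp: reading_def intro!: state_inv_cong[OF inv])
  qed
  then have "wp X (decode D l [] ;; Prim (Lit OldL 0) ;; Prim (Lit NewL 0)) ?Q1 s" by simp
  note 1 = terminates_wp[OF this]
  let ?Q2 = "\<lambda>s'. reading s' zs \<and>
    (\<exists>lab'. state_inv d R (d * length (u @ [x])) lab' (\<lambda>_. u @ [x]) s' \<and> vars s' NewL = lab' d (u @ [x]))"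
  have 2: "terminates X (levels d) s1 (d * level_steps R) ?Q2" if Q1: "?Q1 s1" for s1
  proof (rule terminates_mono[OF levels_terminate[OF _ _ _ _ _ X(1) order_refl X(2)]])
    show "?Q2 s'" if s': "inp s' = inp s1 \<and> (\<forall>v\<in>{Gen, Sgn, Bit, More}. vars s' v = vars s1 v) \<and>
      (\<exists>lab'. state_inv d R (d * length u + d) lab' (\<lambda>m. if m < d then u @ [x] else u) s' \<and>
        vars s' OldL = lab' d u \<and> vars s' NewL = lab' d (u @ [x]))" for s'
    proof -
      obtain lab' where lab': "state_inv d R (d * length u + d) lab' (\<lambda>m. if m < d then u @ [x] else u) s'"
        "vars s' NewL = lab' d (u @ [x])" using s' by blast
      have "state_inv d R (d * length u + d) lab' (\<lambda>_. u @ [x]) s'"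
        by (rule state_inv_cong[OF lab'(1)]) auto
      then show ?thesis using lab'(2) s' Q1 by (auto simp: reading_def add.commute)
    qed
  qed (use Q1 in auto)
  have 3: "terminates X (Prim (AddV More Bit One)) s1 (com_size (Prim (AddV More Bit One))) ?Q3"
    if s1: "?Q2 s1" for s1
  proof (rule terminates_wp)
    obtain lab' where lab': "state_inv d R (d * length (u @ [x])) lab' (\<lambda>_. u @ [x]) s1"
      "vars s1 NewL = lab' d (u @ [x])" using s1 by blast
    have One: "vars s1 One = 1" using lab'(1) by (simp add: state_inv_def)
    let ?s = "prim_effect (AddV More Bit One) s1"
    have "state_inv d R (d * length (u @ [x])) lab' (\<lambda>_. u @ [x]) ?s"
      by (rule state_inv_cong[OF lab'(1)]) auto
    moreover have "\<bar>vars s1 Bit + 1\<bar> \<le> X" using s1 X1 by (auto simp: reading_def split: list.splits)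
    ultimately show "wp X (Prim (AddV More Bit One)) ?Q3 s1"
      using s1 One lab'(2) by (auto simp: reading_def)
  qed
  have "letter_steps l d R = com_size (decode D l [] ;; Prim (Lit OldL 0) ;; Prim (Lit NewL 0)) +
    (d * level_steps R + com_size (Prim (AddV More Bit One) :: var com))"
    using com_size_decode[of D l "[]" "\<lambda>_. (0, True)" "[]"] by (simp add: letter_steps_def)
  then show ?thesis
    unfolding read_letter_def using terminates_Seq[OF 1 terminates_Seq[OF 2 3]] by simp
qed

lemma state_inv_initial:
  assumes "tab s = (\<lambda>_. 0)" "vars s One = 1" "vars s EdgeCount = 0" "vars s NameCount = 0"
  shows "state_inv d R 0 (\<lambda>_ _. 0) (\<lambda>_. []) s"
proof -
  have "named (\<lambda>_. 0) (\<lambda>_. 0) 0"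
    unfolding named_def tree_def node_ok_def by (intro exI[of _ "\<lambda>_. 0"]) simp
  moreover have "flow e [] = (\<lambda>_. 0)" for e :: "letter list \<Rightarrow> nat \<Rightarrow> int" by (simp add: fun_eq_iff)
  ultimately have "level_inv (\<lambda>_. 0) 0 0 0 (\<lambda>_ _. 0) k []" for k
    by (simp add: level_inv_def level_bounded_def level_node_ok_def node_ok_def)
  moreover have "tables_ok (\<lambda>_. 0) 0 0"
    by (rule tables_okI) (auto simp: div_pos_pos_trivial)
  ultimately show ?thesis using assms by (simp add: state_inv_def)
qed

definition word_steps :: "nat \<Rightarrow> nat \<Rightarrow> nat \<Rightarrow> nat \<Rightarrow> nat" where
  "word_steps l d R n = 3 + (n * (letter_steps l d R + 2) + 2)"

lemma word_problem_terminates: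
  assumes D: "decodes D l enc A" and w: "w \<in> lists A" and X: "sufficient d (d * length w) R X"
    "\<And>x. x \<in> A \<Longrightarrow> int (fst x) \<le> X"
  shows "terminates X (word_problem D l d) (initial (encode_word enc w)) (word_steps l d R (length w)) (\<lambda>s'.
    \<exists>lab q. state_inv d R q lab (\<lambda>_. w) s' \<and> vars s' NewL = lab d w)"
proof -
  define I where "I i s \<longleftrightarrow> (\<exists>u v lab. w = u @ v \<and> length v = i \<and> reading s (encode_word enc v) \<and>
    vars s More = vars s Bit + 1 \<and> state_inv d R (d * length u) lab (\<lambda>_. u) s \<and> vars s NewL = lab d u)"
    for i s
  have X1: "4 \<le> X" by (rule sufficient_ge[OF X(1)])
  let ?init = "Prim (Lit One 1) ;; Prim (NextBit Bit) ;; Prim (AddV More Bit One) :: var com"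
  have "wp X ?init (I (length w)) (initial (encode_word enc w))"
  proof -
    let ?s1 = "prim_effect (Lit One 1) (initial (encode_word enc w)) :: var state"
    let ?s2 = "prim_effect (NextBit Bit) ?s1"
    let ?s3 = "prim_effect (AddV More Bit One) ?s2"
    have rd: "reading ?s2 (encode_word enc w)"
      using NextBit_reading[of ?s1] by (simp add: initial_def del: prim_effect.simps(8))
    have vars: "tab ?s2 = (\<lambda>_. 0)" "vars ?s2 One = 1" "vars ?s2 EdgeCount = 0" "vars ?s2 NameCount = 0"
      "vars ?s2 NewL = 0"
      by (simp_all add: initial_def split: list.split)
    have "\<bar>vars ?s2 Bit + vars ?s2 One\<bar> \<le> X"
      using X1 rd vars(2) by (auto simp: reading_def simp del: prim_effect.simps split: list.splits)
    moreover have "I (length w) ?s3"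
      unfolding I_def
    proof (intro exI conjI)
      show "state_inv d R (d * length ([] :: letter list)) (\<lambda>_ _. 0) (\<lambda>_. []) ?s3"
        using vars by (simp add: state_inv_initial del: prim_effect.simps(1,8))
      show "reading ?s3 (encode_word enc w)"
        using rd by (simp add: reading_def del: prim_effect.simps(1,8))
      show "vars ?s3 More = vars ?s3 Bit + 1" "vars ?s3 NewL = 0"
        using vars by (simp_all del: prim_effect.simps(1,8))
    qed simp_all
    ultimately show ?thesis using X1 by (simp del: prim_effect.simps)
  qed
  note 1 = terminates_wp[OF this]
  have bit: "vars s More = 0 \<longleftrightarrow> v = []" "0 \<le> vars s More"
    if "reading s (encode_word enc v)" "vars s More = vars s Bit + 1" "v \<in> lists A" for s v
  proof -
    have "encode_word enc v = [] \<longleftrightarrow> v = []"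
    proof (cases v)
      case (Cons x v')
      then have "enc x \<noteq> []" using that(3) D by (auto simp: decodes_def)
      then show ?thesis using Cons by (simp add: encode_word_def)
    qed (simp add: encode_word_def)
    then show "vars s More = 0 \<longleftrightarrow> v = []" "0 \<le> vars s More"
      using that(1,2) by (auto simp: reading_def split: list.splits)
  qed
  have stop: "\<exists>lab q. state_inv d R q lab (\<lambda>_. w) s' \<and> vars s' NewL = lab d w"
    if I: "I i s'" and le: "vars s' More \<le> 0" for i s'
  proof -
    obtain u v lab where *: "w = u @ v" "reading s' (encode_word enc v)" "vars s' More = vars s' Bit + 1"
      "state_inv d R (d * length u) lab (\<lambda>_. u) s'" "vars s' NewL = lab d u"
      using I unfolding I_def by blast
    have "v = []" using bit[OF *(2,3)] le *(1) w by simp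
    then show ?thesis using * by auto
  qed
  have step: "\<exists>j. i = Suc j \<and> terminates X (read_letter D l d) s (letter_steps l d R) (I j)"
    if I: "I i s" and pos: "0 < vars s More" for i s
  proof -
    obtain u v lab where *: "w = u @ v" "length v = i" "reading s (encode_word enc v)" "vars s More = vars s Bit + 1"
      "state_inv d R (d * length u) lab (\<lambda>_. u) s"
      using I unfolding I_def by blast
    have "v \<noteq> []" using bit[OF *(3,4)] pos *(1) w by auto
    then obtain x v' where v: "v = x # v'" by (cases v) auto
    have x: "x \<in> A" using w *(1) v by simp
    have rd: "reading s (enc x @ encode_word enc v')" using *(3) v by (simp add: encode_word_def)
    have le: "d * length u + d \<le> d * length w" using *(1) v by (simp add: algebra_simps)
    have "terminates X (read_letter D l d) s (letter_steps l d R) (I (length v'))"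
    proof (rule terminates_mono[OF read_letter_terminates[OF D x *(5) rd X(1) le X(2)[OF x]]])
      show "I (length v') s'" if "reading s' (encode_word enc v') \<and> vars s' More = vars s' Bit + 1 \<and>
        (\<exists>lab'. state_inv d R (d * length (u @ [x])) lab' (\<lambda>_. u @ [x]) s' \<and> vars s' NewL = lab' d (u @ [x]))" for s'
      proof -
        have "w = (u @ [x]) @ v'" using * v by simp
        then show ?thesis unfolding I_def using that by blast
      qed
    qed simp
    then show ?thesis using *(2) v by auto
  qed
  let ?Q = "\<lambda>s'. \<exists>lab q. state_inv d R q lab (\<lambda>_. w) s' \<and> vars s' NewL = lab d w"
  have 2: "terminates X (WhilePos More (read_letter D l d)) s (length w * (letter_steps l d R + 2) + 2) ?Q"
    if "I (length w) s" for s
    by (rule terminates_WhilePos[of I, OF that stop step])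
  have size: "com_size ?init = 3" by simp
  show ?thesis
    using terminates_Seq[OF 1 2] unfolding word_problem_def word_steps_def size .
qed


section \<open>Correctness\<close>

text \<open>
  At the end of the input the recorded labels satisfy the hypotheses of \<open>labels_faithful\<close>, and the label
  of the empty word is \<open>0\<close>.
\<close>

lemma state_inv_decides:
  assumes inv: "state_inv d R q lab (\<lambda>_. w) s" and w: "w \<in> lists (letters r)"
  shows "lab d w = 0 \<longleftrightarrow> solvable_value r d w = \<one>\<^bsub>free_solvable_group r d\<^esub>"
proof -
  let ?T = "tab s"
  note inv' = inv[unfolded state_inv_def]
  have ok: "tables_ok ?T (vars s EdgeCount) (vars s NameCount)" using inv' by blast
  have lvl: "level_inv ?T (vars s EdgeCount) (vars s NameCount) (int q) lab k w" if "k < d" for k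
    using inv' that by blast
  have nonzero: "nth_edge (edge_id ?T lab k) w n \<noteq> 0" if "k < d" "n < length w" for k n
    using lvl[OF that(1)] that(2) unfolding level_inv_def by blast
  have lab0: "lab 0 v = lab 0 v'" for v v' using inv' by simp
  have edge: "nth_edge (edge_id ?T lab k) w m = nth_edge (edge_id ?T lab k) w n \<longleftrightarrow>
    nth_edge (\<lambda>p i. (lab k p, i)) w m = nth_edge (\<lambda>p i. (lab k p, i)) w n"
    if "k < d" "m < length w" "n < length w" for k m n
  proof -
    \<comment> \<open>the vertex at which the edge used in step \<open>n\<close> starts\<close>
    define site where "site n = (if snd (w ! n) then take n w else take n w @ [w ! n])" for n
    have site: "nth_edge e w n = e (site n) (fst (w ! n))" for n and e :: "letter list \<Rightarrow> nat \<Rightarrow> 'x"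
      by (simp add: nth_edge_def step_edge_def site_def)
    have nz: "?T [3, lab k (site m), int (fst (w ! m))] \<noteq> 0"
      using nonzero[OF that(1,2)] unfolding site edge_id_def .
    have inj: "?T [3, lab k (site m), int (fst (w ! m))] = ?T [3, lab k (site n), int (fst (w ! n))] \<longleftrightarrow>
      lab k (site m) = lab k (site n) \<and> int (fst (w ! m)) = int (fst (w ! n))"
    proof
      assume eq: "?T [3, lab k (site m), int (fst (w ! m))] = ?T [3, lab k (site n), int (fst (w ! n))]"
      show "lab k (site m) = lab k (site n) \<and> int (fst (w ! m)) = int (fst (w ! n))"
        by (rule tables_okD(5)[OF ok eq nz])
    qed (simp only:)
    show ?thesis
      unfolding site edge_id_def prod.inject inj of_nat_eq_iff ..
  qed
  have lab: "lab (Suc k) v = lab (Suc k) v' \<longleftrightarrow> flow (edge_id ?T lab k) v = flow (edge_id ?T lab k) v'"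
    if "k < d" "prefix v w" "prefix v' w" for k v v'
  proof -
    \<comment> \<open>nodes of the trees have positive numbers, so this comparison is not covered by the names\<close>
    have zero: "flow (edge_id ?T lab k) u j = 0" if u: "prefix u w" and j: "j < 1" for u j
    proof (rule ccontr)
      assume "flow (edge_id ?T lab k) u j \<noteq> 0"
      from flow_support[OF this] obtain n
        where n: "n < length u" "nth_edge (edge_id ?T lab k) u n = j" by blast
      have "n < length w" using n(1) prefix_length_le[OF u] by simp
      from nonzero[OF \<open>k < d\<close> this] have "j \<noteq> 0"
        using n(2) unfolding nth_edge_prefix[OF u n(1)] by simp
      moreover have "0 \<le> j"
        using n(2) tables_okD(3)[OF ok] by (auto simp: nth_edge_def step_edge_def edge_id_def)
      ultimately show False using j by simp
    qed
    have "named ?T (flow (edge_id ?T lab k) u) (lab (Suc k) u)" if "prefix u w" for u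
      using lvl[OF \<open>k < d\<close>] that unfolding level_inv_def by blast
    from named_inject[OF ok this[OF that(2)] this[OF that(3)]]
    have "lab (Suc k) v = lab (Suc k) v' \<longleftrightarrow>
      (\<forall>j\<ge>1. flow (edge_id ?T lab k) v j = flow (edge_id ?T lab k) v' j)" .
    also have "\<dots> \<longleftrightarrow> flow (edge_id ?T lab k) v = flow (edge_id ?T lab k) v'"
    proof
      assume eq: "\<forall>j\<ge>1. flow (edge_id ?T lab k) v j = flow (edge_id ?T lab k) v' j"
      show "flow (edge_id ?T lab k) v = flow (edge_id ?T lab k) v'"
      proof
        fix j
        show "flow (edge_id ?T lab k) v j = flow (edge_id ?T lab k) v' j"
          using eq zero[OF that(2), of j] zero[OF that(3), of j] by (cases "j < 1") auto
      qed
    qed simp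
    finally show ?thesis .
  qed
  have "lab d w = lab d [] \<longleftrightarrow> coset r (derived_term r d) w = coset r (derived_term r d) []"
    by (rule labels_faithful[where d = d, OF w lab0 edge lab order_refl]) (simp_all only: prefix_order.refl Nil_prefix)
  moreover have "lab d [] = 0" using inv' by blast
  ultimately show ?thesis using trivial_iff_label[OF w] by simp
qed

section \<open>Running time\<close>

text \<open>
  The numbers of the at most \<open>d n\<close> edges are less than \<open>2\<close> to this power, which bounds the length of the
  paths in the trees.
\<close>

definition path_length :: "nat \<Rightarrow> nat \<Rightarrow> nat" where
  "path_length d n = floorlog 2 n + d"

text \<open>
  With \<open>R = path_length d n\<close> the edge counts are below \<open>2\<^sup>R\<close>, the square of an edge count plus twice
  a name count is at most \<open>3 \<cdot> 2\<^sup>2\<^sup>R\<close>, and generators are below \<open>2\<^sup>r\<close>.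
\<close>

definition value_bits :: "nat \<Rightarrow> nat \<Rightarrow> nat \<Rightarrow> nat" where
  "value_bits r d n = 2 * path_length d n + 3 + r"

lemma less_two_power_floorlog: "n < 2 ^ floorlog 2 n"
  using floorlog_leD[of 2 n "floorlog 2 n"] by simp

lemma edges_less_path_length: "d * n < 2 ^ path_length d n"
proof -
  have "d * n \<le> 2 ^ d * n" using less_exp[of d] by (intro mult_le_mono1) simp
  also have "\<dots> < 2 ^ d * 2 ^ floorlog 2 n" using less_two_power_floorlog by simp
  finally show ?thesis by (simp add: path_length_def power_add mult.commute)
qed

lemma sufficient_value_bits:
  "sufficient d (d * n) (path_length d n) (2 ^ value_bits r d n)" "int r \<le> 2 ^ value_bits r d n"
proof -
  define R where "R = path_length d n"
  define E :: int where "E = 2 ^ R"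
  define U where "U = int (d * n)"
  have U: "0 \<le> U" "U \<le> E" "d * n < 2 ^ R"
  proof -
    show *: "d * n < 2 ^ R" unfolding R_def by (rule edges_less_path_length)
    then have "int (d * n) < int (2 ^ R)" by (simp only: of_nat_less_iff)
    then show "U \<le> E" by (simp add: U_def E_def)
    show "0 \<le> U" unfolding U_def by simp
  qed
  have int_le: "int m \<le> 2 ^ k" if "m \<le> 2 ^ k" for m k
  proof -
    have "int m \<le> int (2 ^ k)" using that by (simp only: of_nat_le_iff)
    then show ?thesis by simp
  qed
  have R: "int R \<le> E" unfolding E_def by (rule int_le) (simp add: less_imp_le)
  have E: "1 \<le> E" "E \<le> E * E" using mult_left_mono[of 1 E E] by (simp_all add: E_def)
  have UU: "U * U \<le> E * E" "U * int R \<le> E * E"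
    by (rule mult_mono; use U R E in linarith)+
  have "d \<le> 2 ^ d" using less_exp[of d] by simp
  also have "\<dots> \<le> 2 ^ R" unfolding R_def path_length_def by (intro power_increasing) auto
  finally have d: "int d \<le> E" unfolding E_def by (rule int_le)
  have X: "(2::int) ^ value_bits r d n = 8 * (E * E) * 2 ^ r"
  proof -
    have "value_bits r d n = R + R + 3 + r" by (simp add: value_bits_def R_def)
    then have "(2::int) ^ value_bits r d n = E * E * 2 ^ 3 * 2 ^ r" unfolding E_def by (simp only: power_add)
    then show ?thesis by simp
  qed
  have "8 * (E * E) * 1 \<le> 8 * (E * E) * 2 ^ r" using E by (intro mult_left_mono) auto
  then have EX: "8 * (E * E) \<le> 2 ^ value_bits r d n" unfolding X by simp
  show "sufficient d (d * n) (path_length d n) (2 ^ value_bits r d n)"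
    unfolding sufficient_def U_def[symmetric] R_def[symmetric]
  proof (intro conjI)
    show "d * n < 2 ^ R" by (rule U(3))
    show "2 * U + 4 \<le> 2 ^ value_bits r d n" "U * int R + 1 \<le> 2 ^ value_bits r d n"
      "U * U + 2 * (U * int R) \<le> 2 ^ value_bits r d n" "int d \<le> 2 ^ value_bits r d n"
      using U E UU d EX by linarith+
  qed
  have "int r \<le> 2 ^ r" by (rule int_le) (simp add: less_imp_le)
  also have "1 * (2::int) ^ r \<le> 8 * (E * E) * 2 ^ r" 
  proof (rule mult_right_mono)
    show "1 \<le> 8 * (E * E)" using E by linarith
  qed simp
  finally show "int r \<le> 2 ^ value_bits r d n" unfolding X by simp
qed

lemma floorlog_le_self: "floorlog 2 n \<le> n"
  using less_exp[of n] by (intro floorlog_leI) auto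

lemma mult_cost_le: "mult_cost n \<le> (n + 2) ^ 3"
proof -
  have b: "bits (int m) \<le> m + 1" for m
    using floorlog_le_self[of m] by (simp add: bits_def)
  have "bits (int (bits (int n))) \<le> n + 2" using b[of "bits (int n)"] b[of n] by simp
  then have "mult_cost n \<le> (n + 2) * (n + 2) * (n + 2)"
    unfolding mult_cost_def using b[of n] by (intro mult_le_mono) simp_all
  then show ?thesis by (simp add: power3_eq_cube)
qed

definition level_const :: nat where
  "level_const = com_size (traverse_edge 0) + com_size rename_node + com_size (Prim (Get NewL 1 [Lev, One])) + 4"

definition word_const :: "nat \<Rightarrow> nat \<Rightarrow> nat" where
  "word_const l d = com_size (decode (\<lambda>_. (0, True)) l []) + d * level_const + 12"

lemma word_steps_le: "word_steps l d R n + 2 \<le> word_const l d * (n + 1) * (R + 1)"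
proof -
  let ?c = "com_size (decode (\<lambda>_. (0, True)) l [])"
  have "level_steps R \<le> level_const * (R + 1)"
    by (simp add: level_steps_def level_const_def algebra_simps)
  then have "letter_steps l d R \<le> ?c + 3 + d * (level_const * (R + 1))"
    unfolding letter_steps_def by (intro add_mono mult_le_mono2) simp_all
  also have "\<dots> + 2 \<le> (word_const l d - 7) * (R + 1)"
    by (simp add: word_const_def algebra_simps)
  finally have "letter_steps l d R + 2 \<le> (word_const l d - 7) * (R + 1)" by simp
  then have "n * (letter_steps l d R + 2) \<le> n * ((word_const l d - 7) * (R + 1))"
    by (rule mult_le_mono2)
  moreover have "n * ((word_const l d - 7) * (R + 1)) + 7 \<le> word_const l d * (n + 1) * (R + 1)"
  proof -
    have "n * ((word_const l d - 7) * (R + 1)) \<le> n * (word_const l d * (R + 1))"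
      by (intro mult_le_mono2 mult_le_mono1) simp
    moreover have "7 \<le> word_const l d * (R + 1)"
      by (simp add: word_const_def algebra_simps)
    ultimately show ?thesis by (simp add: algebra_simps)
  qed
  ultimately show ?thesis unfolding word_steps_def by linarith
qed

text \<open>
  Keys of length \<open>4\<close> with \<open>\<beta>\<close>-bit entries have codes of \<open>32 \<beta> + 60\<close> bits; the constants collect the
  resulting coefficients for \<open>\<beta> = 2 R + 3 + r\<close>.
\<close>

lemma instr_cost_le:
  "instr_cost (address_bits (value_bits r d n)) \<le> 2 * (165 + 32 * r) ^ 3 * (path_length d n + 1) ^ 3"
proof -
  let ?R = "path_length d n"
  have kb: "key_bits \<beta> 4 = 32 * \<beta> + 60" for \<beta> by (simp add: numeral_eq_Suc)
  have "address_bits (value_bits r d n) + 4 \<le> (165 + 32 * r) * (?R + 1)"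
    by (simp add: address_bits_def kb value_bits_def algebra_simps)
  then have "(address_bits (value_bits r d n) + 4) ^ 3 \<le> ((165 + 32 * r) * (?R + 1)) ^ 3"
    by (rule power_mono) simp
  also have "((165 + 32 * r) * (?R + 1)) ^ 3 = (165 + 32 * r) ^ 3 * (?R + 1) ^ 3"
    by (rule power_mult_distrib)
  finally have "(address_bits (value_bits r d n) + 4) ^ 3 \<le> (165 + 32 * r) ^ 3 * (?R + 1) ^ 3" .
  moreover have "mult_cost (address_bits (value_bits r d n) + 2) \<le> (address_bits (value_bits r d n) + 4) ^ 3"
  proof -
    have "address_bits (value_bits r d n) + 2 + 2 = address_bits (value_bits r d n) + 4" by simp
    then show ?thesis using mult_cost_le[of "address_bits (value_bits r d n) + 2"] by (simp only:)
  qed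
  ultimately have "mult_cost (address_bits (value_bits r d n) + 2) \<le> (165 + 32 * r) ^ 3 * (?R + 1) ^ 3"
    by (rule order_trans[rotated])
  then show ?thesis
    unfolding instr_cost_def mult.assoc by (rule mult_le_mono2)
qed

definition time_bound :: "nat \<Rightarrow> nat \<Rightarrow> nat \<Rightarrow> nat \<Rightarrow> nat" where
  "time_bound l r d n = (word_const l d * (2 * (165 + 32 * r) ^ 3)) * (n + 1) * (path_length d n + 1) ^ 4"

lemma steps_time_bound:
  "(word_steps l d (path_length d n) n + 2) * instr_cost (address_bits (value_bits r d n)) \<le> time_bound l r d n"
proof -
  let ?R = "path_length d n"
  have "(word_steps l d ?R n + 2) * instr_cost (address_bits (value_bits r d n))
    \<le> (word_const l d * (n + 1) * (?R + 1)) * (2 * (165 + 32 * r) ^ 3 * (?R + 1) ^ 3)"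
    by (intro mult_le_mono word_steps_le instr_cost_le)
  also have "\<dots> = time_bound l r d n"
    unfolding time_bound_def by (simp only: power4_eq_xxxx power3_eq_cube mult.assoc mult.commute mult.left_commute)
  finally show ?thesis .
qed

text \<open>
  There are \<open>O(n log n)\<close> instructions, and each costs \<open>O(log\<^sup>3 n)\<close>, a crude bound for a multiplication
  of numbers of length \<open>O(log n)\<close>.
\<close>

lemma quasi_linear_time_bound: "quasi_linear (time_bound l r d)"
proof -
  have "(\<lambda>n. real (path_length d n + 1)) \<in> O(\<lambda>n. ln (real n))"
  proof (rule bigoI)
    show "\<forall>\<^sub>F n in sequentially. norm (real (path_length d n + 1)) \<le> (real d + 4) * norm (ln (real n))"
      using eventually_ge_at_top[of 3]
    proof eventually_elim
      case (elim n)
      have "1 \<le> ln (4::real)" using exp_le by (simp add: ln_ge_iff)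
      moreover have "ln (4::real) = 2 * ln 2" using ln_realpow[of "2::real" 2] by simp
      ultimately have ln2: "1 / 2 \<le> ln (2::real)" by simp
      have "exp 1 \<le> (3::real)" by (rule exp_le)
      then have "1 \<le> ln (3::real)" by (simp add: ln_ge_iff)
      also have "\<dots> \<le> ln (real n)" using elim by simp
      finally have l: "1 \<le> ln (real n)" .
      have "real (floorlog 2 n) \<le> log 2 (real n) + 1"
        using elim floorlog_def[of 2 n] by (simp add: floor_le_iff le_floor_iff)
      also have "log 2 (real n) \<le> 2 * ln (real n)"
      proof -
        have "ln (real n) = 1 / 2 * (2 * ln (real n))" by simp
        also have "\<dots> \<le> ln 2 * (2 * ln (real n))" using ln2 l by (intro mult_right_mono) auto
        finally show ?thesis by (simp add: log_def divide_le_eq mult.commute)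
      qed
      finally have "real (path_length d n + 1) \<le> 2 * ln (real n) + 2 + real d"
        by (simp add: path_length_def)
      also have "\<dots> \<le> 2 * ln (real n) + (2 + real d) * ln (real n)"
        using mult_left_mono[OF l, of "2 + real d"] by simp
      finally show ?case using l by (simp add: algebra_simps)
    qed
  qed
  then have log: "(\<lambda>n. real (path_length d n + 1) ^ 4) \<in> O(\<lambda>n. ln (real n) ^ 4)"
    by (rule landau_o.big_power)
  have "(\<lambda>n. real (n + 1)) \<in> O(\<lambda>n. real n)"
    by (intro bigoI[of _ 2] eventually_mono[OF eventually_ge_at_top[of 1]]) simp
  from landau_o.big.mult[OF this log]
  have prod: "(\<lambda>n. real (n + 1) * real (path_length d n + 1) ^ 4) \<in> O(\<lambda>n. real n * ln (real n) ^ 4)" .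
  have "(\<lambda>n::nat. real (word_const l d * (2 * (165 + 32 * r) ^ 3))) \<in> O(\<lambda>_. 1)" by simp
  from landau_o.big.mult[OF this prod] have "(\<lambda>n. real (word_const l d * (2 * (165 + 32 * r) ^ 3)) *
      (real (n + 1) * real (path_length d n + 1) ^ 4)) \<in> O(\<lambda>n. 1 * (real n * ln (real n) ^ 4))"
    .
  moreover have "real (time_bound l r d n) = real (word_const l d * (2 * (165 + 32 * r) ^ 3)) *
      (real (n + 1) * real (path_length d n + 1) ^ 4)" for n
    unfolding time_bound_def by (simp only: of_nat_mult of_nat_power mult.assoc)
  ultimately show ?thesis unfolding quasi_linear_def by (intro exI[of _ 4]) simp
qed

lemma success_bound_le_1: "success_bound n \<le> 1"
proof (cases "n \<le> 1")
  case False
  then have "(1 - 1 / real n) powr log 3 (real n) \<le> 1 powr log 3 (real n)"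
    by (intro powr_mono2) auto
  then show ?thesis by (simp add: success_bound_def)
next
  case True
  then have "n = 0 \<or> n = 1" by auto
  then show ?thesis by (auto simp: success_bound_def)
qed

theorem theorem4p5:
  fixes r d :: nat and enc :: "letter \<Rightarrow> bool list"
  assumes "letter_code r enc"
  shows "\<exists>(P::program) (T::nat \<Rightarrow> nat). quasi_linear T \<and>
    (\<forall>w\<in>lists (letters r).
       halts_within P (T (length w)) (encode_word enc w) \<and>
       (solvable_value r d w = \<one>\<^bsub>free_solvable_group r d\<^esub> \<longrightarrow>
          surely_answers P (T (length w)) (encode_word enc w) True) \<and>
       (solvable_value r d w \<noteq> \<one>\<^bsub>free_solvable_group r d\<^esub> \<longrightarrow>
          answer_prob P (T (length w)) (encode_word enc w) False \<ge> success_bound (length w)))"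
proof -
  define l where "l = nat (\<lceil>log 2 (real r)\<rceil> + 1)"
  define D where "D = inv_into (letters r) enc"
  have "1 \<le> l"
  proof (cases "r = 0")
    case False
    then have "0 \<le> log 2 (real r)" by simp
    then show ?thesis by (simp add: l_def) linarith
  qed (simp add: l_def log_def)
  moreover have "length (enc x) = l" "D (enc x) = x" if "x \<in> letters r" for x
  proof -
    have "int (length (enc x)) = \<lceil>log 2 (real r)\<rceil> + 1"
      using assms that unfolding letter_code_def by blast
    then show "length (enc x) = l" unfolding l_def by linarith
    show "D (enc x) = x"
      unfolding D_def using assms that by (simp add: letter_code_def)
  qed
  ultimately have D: "decodes D l enc (letters r)" unfolding decodes_def by blast
  let ?P = "machine_program (word_problem D l d) NewL" and ?T = "time_bound l r d"
  have run: "\<exists>s. run ?P (?T (length w)) (encode_word enc w) = return_pmf s \<and> time s \<le> ?T (length w) \<and>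
      answer s = Some (solvable_value r d w = \<one>\<^bsub>free_solvable_group r d\<^esub>)"
    if w: "w \<in> lists (letters r)" for w
  proof -
    let ?n = "length w"
    let ?\<beta> = "value_bits r d ?n"
    have "int (fst x) \<le> 2 ^ ?\<beta>" if "x \<in> letters r" for x
      using that sufficient_value_bits(2)[of r d ?n] by (auto simp: letters_def)
    from word_problem_terminates[OF D w sufficient_value_bits(1) this]
    obtain m s lab q where m: "m \<le> word_steps l d (path_length d ?n) ?n"
      and ex: "exec (2 ^ ?\<beta>) (word_problem D l d) (initial (encode_word enc w)) m s"
      and s: "state_inv d (path_length d ?n) q lab (\<lambda>_. w) s" "vars s NewL = lab d w"
      unfolding terminates_def by blast
    have "(m + 2) * instr_cost (address_bits ?\<beta>)
      \<le> (word_steps l d (path_length d ?n) ?n + 2) * instr_cost (address_bits ?\<beta>)"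
      using m by (intro mult_le_mono1) simp
    also have "\<dots> \<le> ?T ?n" by (rule steps_time_bound)
    finally show ?thesis
      using machine_program_run[OF ex, of "?T ?n" NewL] state_inv_decides[OF s(1) w] s(2) by auto
  qed
  show ?thesis
  proof (intro exI[of _ ?P] exI[of _ ?T] conjI ballI impI)
    show "quasi_linear ?T" by (rule quasi_linear_time_bound)
    fix w assume w: "w \<in> lists (letters r)"
    obtain s where s: "run ?P (?T (length w)) (encode_word enc w) = return_pmf s" "time s \<le> ?T (length w)"
      "answer s = Some (solvable_value r d w = \<one>\<^bsub>free_solvable_group r d\<^esub>)"
      using run[OF w] by blast
    show "halts_within ?P (?T (length w)) (encode_word enc w)"
      using s by (simp add: halts_within_def)
    show "surely_answers ?P (?T (length w)) (encode_word enc w) True"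
      if "solvable_value r d w = \<one>\<^bsub>free_solvable_group r d\<^esub>"
      using s that by (simp add: surely_answers_def)
    show "answer_prob ?P (?T (length w)) (encode_word enc w) False \<ge> success_bound (length w)"
      if "solvable_value r d w \<noteq> \<one>\<^bsub>free_solvable_group r d\<^esub>"
      using s that success_bound_le_1 by (simp add: answer_prob_def)
  qed
qed

end
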